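(* Let $\phi:\mathcal H\to\mathbb R\cup\{+\infty\}$ be a convex lower semicontinuous proper function, and let $\alpha\ge 0$, $\beta>0$, $t_0>0$. For any Cauchy data $(x_0,y_0)\in\operatorname{dom}\phi\times\mathcal H$, there exists a unique global strong solution $(x,y):[t_0,+\infty[\to\mathcal H\times\mathcal H$ of the system $$\left\{\begin{array}{rcl}\dot x(t)+\beta\partial\phi(x(t))-\left(\frac1\beta-\frac{\alpha}{t}\right)x(t)+\frac1\beta y(t)&\ni&0\\[2mm] \dot y(t)-\left(\frac1\beta-\frac{\alpha}{t}+\frac{\alpha\beta}{t^2}\right)x(t)+\frac1\beta y(t)&=&0\end{array}\right.$$ satisfying $x(t_0)=x_0$, $y(t_0)=y_0$. This solution has the following further properties: (i) $y$ is continuously differentiable on $[t_0,+\infty[$, and $\dot y(t)-\left(\frac1\beta-\frac{\alpha}{t}+\frac{\alpha\beta}{t^2}\right)x(t)+\frac1\beta y(t)=0$ for all $t\ge t_0$; (ii) $x$ is absolutely continuous on $[t_0,T]$ and $\dot x\in L^2(t_0,T;\mathcal H)$ for all $T>t_0$; (iii) $x(t)\in\operatorname{dom}(\partial\phi)$ for all $t>t_0$; (iv) $x$ is Lipschitz continuous on any compact subinterval of $]t_0,+\infty[$; (v) the function $t\in[t_0,+\infty[\,\mapsto\phi(x(t))$ is absolutely continuous on $[t_0,T]$ for all $T>t_0$; (vi) there exists a function $\xi:[t_0,+\infty[\to\mathcal H$ such that (a) $\xi(t)\in\partial\phi(x(t))$ for all $t>t_0$; (b) $\dot x(t)+\beta\xi(t)-\left(\frac1\beta-\frac{\alpha}{t}\right)x(t)+\frac1\beta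 y(t)=0$ for almost every $t>t_0$; (c) $\xi\in L^2(t_0,T;\mathcal H)$ for all $T>t_0$; (d) $\frac{d}{dt}\phi(x(t))=\langle\xi(t),\dot x(t)\rangle$ for almost every $t>t_0$.
   Context: $\mathcal H$ is a real Hilbert space with inner product $\langle\cdot,\cdot\rangle$; $\partial\phi$ is the convex subdifferential; $\operatorname{dom}\phi=\{x:\phi(x)<+\infty\}$ and $\operatorname{dom}(\partial\phi)=\{x:\partial\phi(x)\ne\emptyset\}$. Strong solution: given $T>t_0$, a pair $(x,y):[t_0,T]\to\mathcal H\times\mathcal H$ is a strong solution of the system on $[t_0,T]$ if it is continuous on $[t_0,T]$, absolutely continuous on every compact subset of $]t_0,T]$, $x(t)\in\operatorname{dom}(\partial\phi)$ for almost every $t\in]t_0,T]$, and both relations of the system hold for almost every $t\in]t_0,T]$. A pair defined on $[t_0,+\infty[$ is a global strong solution if its restriction to $[t_0,T]$ is a strong solution for every $T>t_0$. *)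

theory Defs
  imports "HOL-Analysis.Analysis"
begin

section \<open>Extended-real-valued convex functions\<close>

definition proper_fun :: "('a \<Rightarrow> ereal) \<Rightarrow> bool" where
  "proper_fun \<phi> \<longleftrightarrow> (\<forall>x. \<phi> x \<noteq> -\<infinity>) \<and> (\<exists>x. \<phi> x \<noteq> \<infinity>)"

text \<open>The library's \<open>convex_on\<close> only covers real-valued functions.  For functions that never
  take the value \<open>-\<infinity>\<close>, the right-hand side below is unambiguous; at \<open>u = 0\<close> and
  \<open>u = 1\<close> it relies on \<open>0 * \<infinity> = 0\<close> in \<open>ereal\<close>.\<close>

definition convex_fun :: "('a::real_vector \<Rightarrow> ereal) \<Rightarrow> bool" where
  "convex_fun \<phi> \<longleftrightarrow> (\<forall>x y. \<forall>u\<in>{0..1}.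
     \<phi> ((1 - u) *\<^sub>R x + u *\<^sub>R y) \<le> ereal (1 - u) * \<phi> x + ereal u * \<phi> y)"

definition lower_semicontinuous :: "('a::topological_space \<Rightarrow> ereal) \<Rightarrow> bool" where
  "lower_semicontinuous \<phi> \<longleftrightarrow> (\<forall>x. \<phi> x \<le> Liminf (at x) \<phi>)"

definition dom_fun :: "('a \<Rightarrow> ereal) \<Rightarrow> 'a set" where
  "dom_fun \<phi> = {x. \<phi> x < \<infinity>}"

text \<open>For proper \<open>\<phi>\<close> this set is empty whenever \<open>\<phi> x = \<infinity>\<close>.\<close>

definition subdifferential :: "('a::real_inner \<Rightarrow> ereal) \<Rightarrow> 'a \<Rightarrow> 'a set" where
  "subdifferential \<phi> x = {p. \<forall>z. \<phi> x + ereal (p \<bullet> (z - x)) \<le> \<phi> z}"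

definition dom_subdifferential :: "('a::real_inner \<Rightarrow> ereal) \<Rightarrow> 'a set" where
  "dom_subdifferential \<phi> = {x. subdifferential \<phi> x \<noteq> {}}"


section \<open>Absolute continuity and square integrability\<close>

text \<open>The finitely many non-overlapping intervals are \<open>[a i, b i]\<close> for \<open>i < n\<close>; their end
  points have to lie in \<open>S\<close>.\<close>

definition abs_continuous_on :: "real set \<Rightarrow> (real \<Rightarrow> 'a::metric_space) \<Rightarrow> bool" where
  "abs_continuous_on S f \<longleftrightarrow>
     (\<forall>\<epsilon>>0. \<exists>\<delta>>0. \<forall>(n::nat) a b.
        (\<forall>i<n. a i \<in> S \<and> b i \<in> S \<and> a i \<le> b i) \<and>
        disjoint_family_on (\<lambda>i. {a i<..<b i}) {..<n} \<and>
        (\<Sum>i<n. b i - a i) < \<delta>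
        \<longrightarrow> (\<Sum>i<n. dist (f (a i)) (f (b i))) < \<epsilon>)"

text \<open>Membership in \<open>L\<^sup>2(S; H)\<close>.  The Bochner integral of the library requires a second countable
  target, whereas \<open>H\<close> may be non-separable.  The library's \<open>measurable_on\<close> (almost everywhere
  limit of continuous functions) has no such restriction and is strong measurability: continuous
  images of the real line are separable.\<close>

definition square_integrable_on :: "(real \<Rightarrow> 'a::real_normed_vector) \<Rightarrow> real set \<Rightarrow> bool" where
  "square_integrable_on f S \<longleftrightarrow>
     f measurable_on S \<and> (\<integral>\<^sup>+t\<in>S. ennreal ((norm (f t))\<^sup>2) \<partial>lebesgue) < \<infinity>"


section \<open>Strong solutions\<close>

definition strong_solution ::
  "('a::real_inner \<Rightarrow> ereal) \<Rightarrow> real \<Rightarrow> real \<Rightarrow> real \<Rightarrow> real \<Rightarrow> (real \<Rightarrow> 'a) \<Rightarrow> (real \<Rightarrow> 'a) \<Rightarrow> bool"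
where
  "strong_solution \<phi> \<alpha> \<beta> t0 T x y \<longleftrightarrow>
     continuous_on {t0..T} (\<lambda>t. (x t, y t)) \<and>
     (\<forall>K. compact K \<and> K \<subseteq> {t0<..T} \<longrightarrow> abs_continuous_on K (\<lambda>t. (x t, y t))) \<and>
     (AE t in lebesgue. t \<in> {t0<..T} \<longrightarrow> x t \<in> dom_subdifferential \<phi>) \<and>
     (AE t in lebesgue. t \<in> {t0<..T} \<longrightarrow>
        (\<exists>x' y'.
           (x has_vector_derivative x') (at t within {t0..T}) \<and>
           (y has_vector_derivative y') (at t within {t0..T}) \<and>
           0 \<in> (\<lambda>p. x' + \<beta> *\<^sub>R p - (1 / \<beta> - \<alpha> / t) *\<^sub>R x t + (1 / \<beta>) *\<^sub>R y t)
                 ` subdifferential \<phi> (x t) \<and>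
           y' - (1 / \<beta> - \<alpha> / t + \<alpha> * \<beta> / t\<^sup>2) *\<^sub>R x t + (1 / \<beta>) *\<^sub>R y t = 0))"

text \<open>Functions on the half-line \<open>[t0, \<infinity>[\<close> are represented by total functions whose values to the
  left of \<open>t0\<close> are irrelevant.\<close>

definition global_strong_solution ::
  "('a::real_inner \<Rightarrow> ereal) \<Rightarrow> real \<Rightarrow> real \<Rightarrow> real \<Rightarrow> (real \<Rightarrow> 'a) \<Rightarrow> (real \<Rightarrow> 'a) \<Rightarrow> bool"
where
  "global_strong_solution \<phi> \<alpha> \<beta> t0 x y \<longleftrightarrow> (\<forall>T>t0. strong_solution \<phi> \<alpha> \<beta> t0 T x y)"

end

(* On H x H the system reads z'(t) in B(t) z(t) - dPhi(z(t)), where Phi(x, y) = beta phi(x) and B(t)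
   is linear and Lipschitz in t. The Yosida approximations z_l' + A_l z_l = B(t) z_l are ordinary differential
   equations; the energy identity for the Moreau envelope along z_l bounds the integral of |A_l z_l|^2,
   which makes z_l Cauchy as l tends to 0 and, combined with the Gronwall estimate for
   z_l(t + h) - z_l(t), yields |z_l'(t)| <= C / sqrt(t - t0).

   The limit z satisfies integral inequalities against every point of the graph of dPhi. They force
   z to have at every t > t0 a right derivative v(t), the element of minimal norm of
   B(t) z(t) - dPhi(z(t)). Since exp(-K t) |v(t)|^2 - M t is nonincreasing, |v| is continuous outside
   a countable set, and where |v| is continuous z is differentiable and v is continuous. This avoids
   any Radon-Nikodym or Bochner theory in the possibly non-separable space H, and it also gives the
   chain rule for Phi o z. Square integrability of v comes from |v|^2 <= |B z|^2 - 2 (Phi o z)' and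
   the absolute continuity of Phi o z, uniqueness from an almost everywhere Gronwall argument. *)

theory Submission
  imports Defs
begin

section \<open>Convex functions and Yosida approximation\<close>

text \<open>The datum lies in dom phi but possibly outside the domain of the subdifferential, so the
  velocity may be unbounded near t0, whereas the energy is finite there. The estimates up to t0
  therefore start from |B z|^2 = |A z|^2 + 2 A z . z' + |z'|^2 with z' = B z - A z: the cross term
  is twice the derivative of the energy, so |A z|^2 and |z'|^2 have bounds with an explicit
  primitive, and the Gronwall arguments need no time integrals. The rate 1 / sqrt (t - t0) is
  integrable, which saves absolute continuity up to t0. Weak compactness is avoided throughout. The
  element of least norm is the strong limit of backward Euler velocities, whose norms increase as
  the step shrinks. The same quotients identify limits: a family whose norms are asymptotically no
  greater and which obeys the limiting inequality against each graph point must converge strongly.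
  This one principle yields the right derivative, the left derivative and the continuity of the
  velocity.\<close>

lemma norm_add_scaleR_sq:
  fixes a b :: "'b::real_inner"
  shows "(norm (a + u *\<^sub>R b))\<^sup>2 = (norm a)\<^sup>2 + 2 * u * (a \<bullet> b)
      + u\<^sup>2 * (norm b)\<^sup>2"
  unfolding power2_norm_eq_inner
  by (simp add: inner_add_left inner_add_right inner_commute power2_eq_square algebra_simps)

text \<open>The pair \<open>D\<close>, \<open>g\<close> stands for the extended-valued function
  equal to \<open>g\<close> on \<open>D\<close> and infinite elsewhere; closed sublevel sets express
  lower semicontinuity of that extension. Real values keep the calculus free of extended
  arithmetic.\<close>

locale lsc_convex =
  fixes D :: "'b::{real_inner,complete_space} set" and g :: "'b \<Rightarrow> real"
  assumes D_ne: "D \<noteq> {}"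
    and conv: "convex_on D g"
    and closed_sublevel: "closed {x \<in> D. g x \<le> c}"
begin

section \<open>Subgradients, lower bounds and existence of proximal points\<close>

definition sub :: "'b \<Rightarrow> 'b set" where
  "sub x = {p. x \<in> D \<and> (\<forall>w\<in>D. g x + p \<bullet> (w - x) \<le> g w)}"

lemma sub_D: "p \<in> sub x \<Longrightarrow> x \<in> D"
  by (simp add: sub_def)

lemma sub_ineq: "p \<in> sub x \<Longrightarrow> w \<in> D \<Longrightarrow> g x
    + p \<bullet> (w - x) \<le> g w"
  by (simp add: sub_def)

lemma sub_mono: "p \<in> sub x \<Longrightarrow> q \<in> sub y \<Longrightarrow> 0
    \<le> (p - q) \<bullet> (x - y)"
  using sub_ineq[of p x y] sub_ineq[of q y x] sub_D[of p x] sub_D[of q y]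
  by (simp add: inner_diff_left inner_diff_right)

text \<open>For each \<open>e > 0\<close> a tail of \<open>X\<close> lies in the closed sublevel set
  at \<open>c0 + e\<close>, a subset of \<open>D\<close>, and so does the limit.\<close>

lemma lsc_seq:
  assumes X: "\<And>n. X n \<in> D" "\<And>n. g (X n) \<le> c n" and lim: "X
      \<longlonglongrightarrow> x" "c \<longlonglongrightarrow> c0"
  shows "x \<in> D \<and> g x \<le> c0"
proof -
  have *: "x \<in> {x \<in> D. g x \<le> c0 + e}" if "e > 0" for e
  proof (rule Lim_in_closed_set[OF closed_sublevel _ _ lim(1)])
    have "\<forall>\<^sub>F n in sequentially. c n < c0 + e"
      using order_tendstoD(2)[OF lim(2)] that by simp
    then show "\<forall>\<^sub>F n in sequentially. X n \<in> {x \<in> D. g x \<le> c0 + e}"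
    proof eventually_elim
      case (elim n)
      then show ?case using X(1)[of n] X(2)[of n] by simp
    qed
  qed simp
  show ?thesis
    using *[of 1] * by (auto intro: field_le_epsilon)
qed

text \<open>For fixed \<open>w\<close> the subgradient inequality is a convergent upper bound for
  \<open>g (X n)\<close>, and lower semicontinuity preserves it.\<close>

lemma sub_closed:
  assumes p: "\<And>n. p n \<in> sub (X n)" and lim: "X \<longlonglongrightarrow> x" "p
      \<longlonglongrightarrow> q"
  shows "q \<in> sub x"
proof -
  have *: "x \<in> D \<and> g x \<le> g w - q \<bullet> (w - x)" if w: "w \<in> D" for w
  proof (rule lsc_seq[OF _ _ lim(1)])
    show "X n \<in> D" for n using p sub_D by blast
    show "g (X n) \<le> g w - p n \<bullet> (w - X n)" for n using sub_ineq[OF p w, of n] by simp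
    show "(\<lambda>n. g w - p n \<bullet> (w - X n))
        \<longlonglongrightarrow> g w - q \<bullet> (w - x)"
      by (intro tendsto_intros lim)
  qed
  obtain w where "w \<in> D" using D_ne by blast
  with * show ?thesis by (force simp: sub_def)
qed

text \<open>Lower semicontinuity bounds \<open>g\<close> from below near one point; convexity along
  segments carries the bound outward with at most linear loss. This cone does the work of an affine
  minorant from Hahn-Banach separation.\<close>

lemma minorant:
  obtains x a b where "x \<in> D" "0 \<le> b" "\<And>w. w \<in> D
      \<Longrightarrow> a - b * norm (w - x) \<le> g w"
proof -
  obtain x where x: "x \<in> D" using D_ne by blast
  have "x \<in> - {y \<in> D. g y \<le> g x - 1}" "open (- {y \<in> D. g y \<le> g x - 1})"
    using closed_sublevel by auto
  then obtain r where r: "r > 0" "ball x r \<subseteq> - {y \<in> D. g y \<le> g x - 1}"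
    using open_contains_ball by blast
  have near: "g x - 1 < g w" if "w \<in> D" "norm (w - x) < r" for w
    using that r(2) by (force simp: dist_norm norm_minus_commute subset_iff)
  have "(g x - 1) - (2 / r) * norm (w - x) \<le> g w" if w: "w \<in> D" for w
  proof (cases "norm (w - x) < r")
    case True
    then show ?thesis using near[OF w] r(1)
      by (smt (verit) divide_nonneg_nonneg mult_nonneg_nonneg norm_ge_zero)
  next
    case False
    then have n: "norm (w - x) \<ge> r" by simp
    \<comment> \<open>With this parameter the point \<open>?p\<close> of the segment has distance r
      / 2 from \<open>x\<close>, so \<open>near\<close> applies to it.\<close>
    define u where "u = r / (2 * norm (w - x))"
    have pos: "norm (w - x) > 0" using n r(1) by linarith
    then have u: "0 < u" "u < 1" using n r(1) by (simp_all add: u_def divide_simps)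
    let ?p = "(1 - u) *\<^sub>R x + u *\<^sub>R w"
    have "?p - x = u *\<^sub>R (w - x)" by (simp add: algebra_simps)
    then have "norm (?p - x) = u * norm (w - x)" using u by simp
    also have "\<dots> = r / 2" using pos by (simp add: u_def)
    finally have "norm (?p - x) < r" using r by simp
    moreover have "?p \<in> D"
      using conv x w u by (auto simp: convex_on_def intro: convexD)
    ultimately have "g x - 1 < g ?p" using near by blast
    also have "\<dots> \<le> (1 - u) * g x + u * g w"
      using convex_onD[OF conv, of u x w] x w u by simp
    finally have "- 1 \<le> u * (g w - g x)" by (simp add: algebra_simps)
    then have "- (1 / u) \<le> g w - g x"
      using u(1) by (simp add: field_simps)
    moreover have "1 / u = (2 / r) * norm (w - x)"
      using pos by (simp add: u_def)
    ultimately show ?thesis by linarith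
  qed
  then show ?thesis using that[of x "2 / r" "g x - 1"] x r(1) by simp
qed

text \<open>The functional \<open>F\<close> is strongly convex, so a minimising sequence is Cauchy
  by the parallelogram law; the variational inequality at the minimiser is the inclusion
  sought.\<close>

lemma prox_exists:
  assumes l: "0 < l"
  shows "\<exists>w. (1 / l) *\<^sub>R (y - w) \<in> sub w"
proof -
  define F where "F w = g w + (norm (w - y))\<^sup>2 / (2 * l)" for w
  obtain x a b where x: "x \<in> D" "0 \<le> b" and m: "\<And>w. w \<in> D
      \<Longrightarrow> a - b * norm (w - x) \<le> g w"
    by (rule minorant) blast
  \<comment> \<open>Completing the square in \<open>norm (w - y) - b * l\<close> lets the quadratic
    penalty absorb the linear descent of the cone.\<close>
  have low: "a - b * norm (y - x) - b\<^sup>2 * l / 2 \<le> F w" if w: "w \<in> D" for w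
  proof -
    have "norm (w - x) \<le> norm (w - y) + norm (y - x)"
      by (metis norm_triangle_ineq diff_add_cancel add_diff_eq)
    then have "b * norm (w - x) \<le> b * norm (w - y) + b * norm (y - x)"
      using x(2) by (metis distrib_left mult_left_mono)
    moreover have "0 \<le> (norm (w - y) - b * l)\<^sup>2 / (2 * l)" using l by simp
    moreover have "(norm (w - y) - b * l)\<^sup>2 / (2 * l)
        = (norm (w - y))\<^sup>2 / (2 * l) - b * norm (w - y) + b\<^sup>2 * l / 2"
      using l by (simp add: field_simps power2_eq_square)
    ultimately show ?thesis using m[OF w] by (simp add: F_def)
  qed
  define d where "d = Inf (F ` D)"
  have bdd: "bdd_below (F ` D)" using low by (auto simp: bdd_below_def)
  have dle: "d \<le> F w" if "w \<in> D" for w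
    using that bdd by (auto simp: d_def intro: cInf_lower)
  have "\<exists>w\<in>D. F w < d + inverse (real (Suc n))" for n
    using cInf_less_iff[of "F ` D" "d + inverse (real (Suc n))"] bdd D_ne
    by (auto simp: d_def)
  then obtain X where X: "\<And>n. X n \<in> D" "\<And>n. F (X n) < d + inverse (real (Suc n))"
    by metis
  \<comment> \<open>At the midpoint the parallelogram law produces the gap |w - v|^2 / (8 l), while
    the value of \<open>F\<close> there is still at least \<open>d\<close>.\<close>
  have par: "(norm (w - v))\<^sup>2 \<le> 4 * l * ((F w - d)
      + (F v - d))" if w: "w \<in> D" "v \<in> D" for w v
  proof -
    let ?m = "(1 - 1/2) *\<^sub>R w + (1/2) *\<^sub>R v"
    have mD: "?m \<in> D" using conv w by (auto simp: convex_on_def intro: convexD)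
    have gm: "g ?m \<le> (1/2) * g w + (1/2) * g v"
      using convex_onD[OF conv, of "1/2" w v] w by simp
    have "?m - y = (1/2) *\<^sub>R ((w - y) + (v - y))"
      by (simp add: algebra_simps flip: scaleR_add_left)
    then have "(norm (?m - y))\<^sup>2 = (norm ((w - y) + (v - y)))\<^sup>2 / 4"
      by (simp add: power_divide)
    moreover have "(norm ((w - y) + (v - y)))\<^sup>2 + (norm ((w - y) - (v - y)))\<^sup>2
        = 2 * (norm (w - y))\<^sup>2 + 2 * (norm (v - y))\<^sup>2"
      by (simp add: power2_norm_eq_inner algebra_simps inner_commute)
    moreover have "(w - y) - (v - y) = w - v" by simp
    ultimately have nm: "(norm (?m - y))\<^sup>2
        = (norm (w - y))\<^sup>2 / 2 + (norm (v - y))\<^sup>2 / 2 - (norm (w - v))\<^sup>2 / 4"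
      by simp
    have "d \<le> F ?m" using dle mD by blast
    also have "\<dots> \<le> (F w + F v) / 2 - (norm (w - v))\<^sup>2 / (8 * l)"
    proof -
      have *: "(a / 2 + b / 2 - c / 4) / (2 * l) = (a / (2 * l)
          + b / (2 * l)) / 2 - c / (8 * l)" for a b c
        using l by (simp add: field_simps)
      have "G + ((a + b) / 2 - c) \<le> (p + a + (q + b)) / 2 - c" if "G \<le> 1/2 * p + 1/2 * q"
        for G a b c p q :: real using that by (simp add: field_simps)
      from this[OF gm] show ?thesis unfolding F_def nm * .
    qed
    finally have "(norm (w - v))\<^sup>2 / (8 * l) \<le> (F w + F v) / 2 - d" by simp
    then show ?thesis using l by (simp add: field_simps)
  qed
  have "Cauchy X"
  proof (rule CauchyI)
    fix e :: real assume e: "0 < e"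
    obtain N where N: "inverse (real (Suc N)) < e\<^sup>2 / (8 * l)"
      using reals_Archimedean[of "e\<^sup>2 / (8 * l)"] e l by auto
    have "norm (X i - X j) < e" if ij: "i \<ge> N" "j \<ge> N" for i j
    proof -
      have "F (X k) - d < e\<^sup>2 / (8 * l)" if "k \<ge> N" for k
      proof -
        have "inverse (real (Suc k)) \<le> inverse (real (Suc N))" using that by simp
        then show ?thesis using X(2)[of k] N by linarith
      qed
      from this[OF ij(1)] this[OF ij(2)]
      have "(F (X i) - d) + (F (X j) - d) < e\<^sup>2 / (4 * l)" by (simp add: field_simps)
      then have "4 * l * ((F (X i) - d) + (F (X j) - d)) < 4 * l * (e\<^sup>2 / (4 * l))"
        using l by (intro mult_strict_left_mono) auto
      also have "\<dots> = e\<^sup>2" using l by simp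
      finally have "(norm (X i - X j))\<^sup>2 < e\<^sup>2"
        using par[OF X(1) X(1), of i j] by linarith
      then show ?thesis using e by (simp add: power2_less_imp_less)
    qed
    then show "\<exists>M. \<forall>m\<ge>M. \<forall>n\<ge>M. norm (X m - X n) < e" by blast
  qed
  then obtain w where w: "X \<longlonglongrightarrow> w"
    using Cauchy_convergent convergent_def by blast
  have "w \<in> D \<and> g w \<le> (d + 0) - (norm (w - y))\<^sup>2 / (2 * l)"
  proof (rule lsc_seq[OF X(1) _ w])
    show "g (X n) \<le> (d + inverse (real (Suc n))) - (norm (X n - y))\<^sup>2 / (2 * l)" for n
      using X(2)[of n] by (simp add: F_def)
    show "(\<lambda>n. d + inverse (real (Suc n)) - (norm (X n - y))\<^sup>2 / (2 * l))
        \<longlonglongrightarrow> d + 0 - (norm (w - y))\<^sup>2 / (2 * l)"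
      by (intro tendsto_intros w LIMSEQ_inverse_real_of_nat) (use l in auto)
  qed
  then have wD: "w \<in> D" and wmin: "F w \<le> d" by (auto simp: F_def)
  have "g w + (1 / l) *\<^sub>R (y - w) \<bullet> (v - w) \<le> g v" if v: "v \<in> D" for v
  proof -
    define c where "c = (norm (v - w))\<^sup>2 / (2 * l)"
    \<comment> \<open>Minimality of \<open>w\<close> against a point of the segment towards
      \<open>v\<close>, divided by \<open>u\<close>; the remainder \<open>u * c\<close> vanishes as
      \<open>u\<close> decreases to 0.\<close>
    have *: "g w - g v + (1 / l) *\<^sub>R (y - w) \<bullet> (v - w)
        \<le> u * c" if u: "0 < u" "u < 1" for u
    proof -
      let ?m = "(1 - u) *\<^sub>R w + u *\<^sub>R v"
      have mD: "?m \<in> D" using conv wD v u by (auto simp: convex_on_def intro: convexD)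
      have "?m - y = (w - y) + u *\<^sub>R (v - w)" by (simp add: algebra_simps)
      then have nm: "(norm (?m - y))\<^sup>2 = (norm (w - y))\<^sup>2
          + 2 * u * ((w - y) \<bullet> (v - w)) + u\<^sup>2 * (norm (v - w))\<^sup>2"
        by (simp only: norm_add_scaleR_sq)
      have "F w \<le> F ?m" using wmin dle[OF mD] by linarith
      then have "g w + (norm (w - y))\<^sup>2 / (2 * l) \<le> g ?m
          + ((norm (w - y))\<^sup>2 + 2 * u * ((w - y) \<bullet> (v - w)) + u\<^sup>2 * (norm (v - w))\<^sup>2) / (2 * l)"
        unfolding F_def nm .
      moreover have "(1 - u) * g w = g w - u * g w" by (simp add: algebra_simps)
      moreover have "g ?m \<le> (1 - u) * g w + u * g v"
        using convex_onD[OF conv, of u w v] wD v u by simp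
      ultimately have "(norm (w - y))\<^sup>2 / (2 * l) + u * g w \<le> u * g v
          + ((norm (w - y))\<^sup>2 + 2 * u * ((w - y) \<bullet> (v - w)) + u\<^sup>2 * (norm (v - w))\<^sup>2) / (2 * l)"
        by linarith
      note * = this
      have "u * (g w - g v) \<le> u * (((w - y) \<bullet> (v - w)) / l + u * c)"
      proof -
        have "(N + 2 * u * X + u\<^sup>2 * n) / (2 * l) = N / (2 * l) + u * (X / l
            + u * (n / (2 * l)))" for N X n
          using l by (simp add: field_simps power2_eq_square)
        with * show ?thesis unfolding c_def by (simp add: right_diff_distrib)
      qed
      then have "g w - g v \<le> ((w - y) \<bullet> (v - w)) / l + u * c" using u by simp
      moreover have "(1 / l) *\<^sub>R (y - w) \<bullet> (v - w)
          = - (((w - y) \<bullet> (v - w)) / l)"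
        by (simp add: inner_diff_left field_simps diff_divide_distrib)
      ultimately show ?thesis by linarith
    qed
    have "((\<lambda>u. u * c) \<longlongrightarrow> 0 * c) (at_right 0)" by (intro tendsto_intros)
    then have "g w - g v + (1 / l) *\<^sub>R (y - w) \<bullet> (v - w) \<le> 0 * c"
      by (rule tendsto_lowerbound)
        (use * in \<open>auto simp: eventually_at_right_field intro!: exI[of _ "1::real"]\<close>)
    then show ?thesis by simp
  qed
  then show ?thesis using wD by (auto simp: sub_def)
qed

section \<open>Resolvents and Yosida approximations\<close>

definition J :: "real \<Rightarrow> 'b \<Rightarrow> 'b" where
  "J l y = (SOME w. (1 / l) *\<^sub>R (y - w) \<in> sub w)"

definition A :: "real \<Rightarrow> 'b \<Rightarrow> 'b" where
  "A l y = (1 / l) *\<^sub>R (y - J l y)"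

lemma A_sub: "0 < l \<Longrightarrow> A l y \<in> sub (J l y)"
  unfolding A_def J_def using prox_exists by (rule someI_ex)

lemma J_eq: "0 < l \<Longrightarrow> J l y = y - l *\<^sub>R A l y"
  by (simp add: A_def)

lemma sub_nonempty: obtains w p where "p \<in> sub w"
  using A_sub[of 1] by auto

text \<open>Monotonicity between the two resolvent points. Equal parameters give the Lipschitz
  constant 1 / l, different ones the Cauchy estimate in the regularisation parameter.\<close>

lemma A_coercive:
  assumes "0 < l" "0 < m"
  shows "(A l x - A m y) \<bullet> (l *\<^sub>R A l x - m *\<^sub>R A m y)
      \<le> (A l x - A m y) \<bullet> (x - y)"
proof -
  have "0 \<le> (A l x - A m y) \<bullet> (J l x - J m y)"
    by (rule sub_mono) (use assms in \<open>auto intro: A_sub\<close>)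
  then show ?thesis using assms by (simp add: J_eq algebra_simps)
qed

lemma A_mono: "0 < l \<Longrightarrow> 0 \<le> (A l x - A l y) \<bullet> (x - y)"
  using A_coercive[of l l x y]
  by (smt (verit) inner_ge_zero inner_scaleR_right mult_nonneg_nonneg scaleR_right_diff_distrib)

lemma A_lipschitz: "0 < l \<Longrightarrow> norm (A l x - A l y) \<le> (1 / l) * norm (x - y)"
proof -
  assume l: "0 < l"
  have "l * (norm (A l x - A l y))\<^sup>2 \<le> (A l x - A l y) \<bullet> (x - y)"
    using A_coercive[OF l l, of x y]
    by (simp add: power2_norm_eq_inner flip: scaleR_right_diff_distrib)
  also have "\<dots> \<le> norm (A l x - A l y) * norm (x - y)" by (rule norm_cauchy_schwarz)
  finally have "norm (A l x - A l y) * (l * norm (A l x - A l y))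
      \<le> norm (A l x - A l y) * norm (x - y)"
    by (simp add: power2_eq_square algebra_simps)
  then have "l * norm (A l x - A l y) \<le> norm (x - y)"
    by (cases "A l x = A l y") auto
  then show ?thesis using l by (simp add: field_simps)
qed

text \<open>Monotonicity holds at \<open>J l x\<close>, which differs from \<open>x\<close> by
  \<open>l *\<^sub>R A l x\<close>; completing the square shows that the replacement costs at most l
  |p|^2 / 4. So the Yosida approximation is monotone against the original graph up to an error
  vanishing with \<open>l\<close>.\<close>

lemma A_sub_ineq:
  assumes l: "0 < l" and p: "p \<in> sub w"
  shows "- (l * (norm p)\<^sup>2 / 4) \<le> (A l x - p) \<bullet> (x - w)"
proof -
  have "0 \<le> (A l x - p) \<bullet> (J l x - w)"
    by (rule sub_mono) (use l p in \<open>auto intro: A_sub\<close>)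
  then have "l * ((A l x - p) \<bullet> A l x) \<le> (A l x - p) \<bullet> (x - w)"
    using l by (simp add: J_eq algebra_simps)
  moreover have "0 \<le> l * (norm (A l x - (1/2) *\<^sub>R p))\<^sup>2" using l by simp
  then have "0 \<le> l * ((A l x - p) \<bullet> A l x) + l * (norm p)\<^sup>2 / 4"
    by (simp add: power2_norm_eq_inner inner_diff_left inner_diff_right inner_commute
        algebra_simps)
  ultimately show ?thesis by linarith
qed

text \<open>Monotonicity between \<open>J l w\<close> and \<open>w\<close> gives |A|^2 <= p . A. The
  bound is independent of \<open>l\<close>, which makes the later estimates uniform in the
  parameter.\<close>

lemma A_bound:
  assumes l: "0 < l" and p: "p \<in> sub w"
  shows "norm (A l w) \<le> norm p"
proof -
  have "0 \<le> (A l w - p) \<bullet> (J l w - w)"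
    by (rule sub_mono) (use l p in \<open>auto intro: A_sub\<close>)
  then have "l * (A l w \<bullet> A l w) \<le> l * (p \<bullet> A l w)"
    using l by (simp add: J_eq algebra_simps)
  then have "A l w \<bullet> A l w \<le> p \<bullet> A l w" using l by simp
  also have "\<dots> \<le> norm p * norm (A l w)" by (rule norm_cauchy_schwarz)
  finally show ?thesis by (cases "A l w = 0") (simp_all add: dot_square_norm power2_eq_square)
qed

section \<open>The Moreau envelope\<close>

definition env :: "real \<Rightarrow> 'b \<Rightarrow> real" where
  "env l x = g (J l x) + l / 2 * (norm (A l x))\<^sup>2"

text \<open>\<open>env l x\<close> is the minimum over w of g w + |w - x|^2 / (2 l), attained at
  \<open>J l x\<close>. The subgradient inequality between the two resolvent points leaves exactly
  the square l / 2 |A l y - A l x|^2 to spare.\<close>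

lemma env_sub: "0 < l \<Longrightarrow> env l x + A l x \<bullet> (y - x) \<le> env l y"
proof -
  assume l: "0 < l"
  have "g (J l x) + A l x \<bullet> (J l y - J l x) \<le> g (J l y)"
    by (rule sub_ineq) (use l in \<open>auto intro: A_sub sub_D\<close>)
  moreover have "0 \<le> l / 2 * (norm (A l y - A l x))\<^sup>2" using l by simp
  ultimately show ?thesis using l
    by (simp add: env_def J_eq power2_norm_eq_inner inner_diff_left inner_diff_right
        inner_commute algebra_simps)
qed

lemma env_le: "0 < l \<Longrightarrow> x \<in> D \<Longrightarrow> env l x \<le> g x"
proof -
  assume l: "0 < l" and x: "x \<in> D"
  have "x - J l x = l *\<^sub>R A l x" using l by (simp add: J_eq)
  then have "g (J l x) + l * (norm (A l x))\<^sup>2 \<le> g x"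
    using sub_ineq[OF A_sub[OF l] x, of x] by (simp add: power2_norm_eq_inner)
  moreover have "0 \<le> l * (norm (A l x))\<^sup>2" using l by simp
  ultimately show ?thesis by (simp add: env_def)
qed

lemma env_ge: "0 < l \<Longrightarrow> g (J l x) \<le> env l x"
  by (simp add: env_def)

text \<open>The inequality for \<open>p\<close>, evaluated at \<open>J l x\<close>, loses l p . A l
  x; the penalty absorbs this up to l |p|^2 / 2, and \<open>l \<le> 1\<close> makes the bound
  uniform.\<close>

lemma env_lower:
  assumes l: "0 < l" "l \<le> 1" and p: "p \<in> sub w"
  shows "g w + p \<bullet> (x - w) - (norm p)\<^sup>2 / 2 \<le> env l x"
proof -
  have "g w + p \<bullet> (J l x - w) \<le> g (J l x)"
    by (rule sub_ineq) (use l p in \<open>auto intro: A_sub sub_D\<close>)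
  moreover have "0 \<le> l / 2 * (norm (A l x - p))\<^sup>2" using l by simp
  moreover have "l * (norm p)\<^sup>2 \<le> (norm p)\<^sup>2"
    using l by (simp add: mult_left_le_one_le)
  ultimately show ?thesis using l
    by (simp add: env_def J_eq power2_norm_eq_inner inner_diff_left inner_diff_right
        inner_commute algebra_simps)
qed

text \<open>The first-order remainder of the envelope lies between 0 and |y - x|^2 / l, by the
  subgradient inequality at both points and the Lipschitz bound. So \<open>A l\<close> is its
  gradient, and the chain rule applies.\<close>

lemma env_derivative:
  assumes l: "0 < l"
    and u: "(u has_vector_derivative u') (at t within S)"
  shows "((\<lambda>s. env l (u s)) has_real_derivative (A l (u t) \<bullet> u')) (at t within S)"
proof -
  have "((\<lambda>x. env l x) has_derivative (\<lambda>h. A l (u t) \<bullet> h)) (at (u t))"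
  proof (rule has_derivativeI)
    show "bounded_linear (\<lambda>h. A l (u t) \<bullet> h)" by (rule bounded_linear_inner_right)
    show "((\<lambda>y. (env l y - env l (u t) - A l (u t) \<bullet> (y - u t)) /\<^sub>R norm (y - u t)) \<longlongrightarrow> 0) (at (u t))"
    proof (rule Lim_null_comparison)
      show "\<forall>\<^sub>F y in at (u t). norm ((env l y - env l (u t) - A l (u t) \<bullet> (y - u t)) /\<^sub>R norm (y - u t))
          \<le> (1 / l) * norm (y - u t)"
      proof (rule eventually_at_topological[THEN iffD2], intro exI[of _ UNIV] conjI ballI impI)
        fix y assume "y \<noteq> u t"
        have 1: "0 \<le> env l y - env l (u t) - A l (u t) \<bullet> (y - u t)"
          using env_sub[OF l, of "u t" y] by simp
        have "env l y - env l (u t) - A l (u t) \<bullet> (y - u t)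
            \<le> (A l y - A l (u t)) \<bullet> (y - u t)"
          using env_sub[OF l, of y "u t"] by (simp add: inner_diff_left inner_diff_right)
        also have "\<dots> \<le> norm (A l y - A l (u t)) * norm (y - u t)"
          by (rule norm_cauchy_schwarz)
        also have "\<dots> \<le> ((1 / l) * norm (y - u t)) * norm (y - u t)"
          by (intro mult_right_mono A_lipschitz l) auto
        finally show "norm ((env l y - env l (u t) - A l (u t) \<bullet> (y - u t)) /\<^sub>R norm (y - u t))
          \<le> (1 / l) * norm (y - u t)"
          using 1 \<open>y \<noteq> u t\<close> l by (simp add: field_simps)
      qed auto
      have "((\<lambda>y. (1 / l) * norm (y - u t)) \<longlongrightarrow> (1 / l) * norm (u t - u t)) (at (u t))"
        by (intro tendsto_intros)
      then show "((\<lambda>y. (1 / l) * norm (y - u t)) \<longlongrightarrow> 0) (at (u t))"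
        by simp
    qed
  qed
  from has_derivative_compose[OF u[unfolded has_vector_derivative_def] this]
  show ?thesis
    by (simp add: has_field_derivative_def mult.commute[of _ "A l (u t) \<bullet> u'"] mult_commute_abs)
qed

section \<open>Backward Euler velocities and their limit\<close>

definition quot :: "real \<Rightarrow> 'b \<Rightarrow> 'b \<Rightarrow> 'b" where
  "quot m f z = (1 / m) *\<^sub>R (J m (z + m *\<^sub>R f) - z)"

text \<open>\<open>quot m f z\<close> is the velocity of one backward Euler step of length
  \<open>m\<close>, started at \<open>z\<close>, for the inclusion u' in f - sub u: the subgradient
  is taken at the new point.\<close>

lemma quot_sub: "0 < m \<Longrightarrow> f - quot m f z \<in> sub (z + m *\<^sub>R quot m f z)"
  using A_sub[of m "z + m *\<^sub>R f"]
  by (simp add: quot_def A_def algebra_simps)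

lemma quot_bound:
  assumes m: "0 < m" and p: "p \<in> sub z"
  shows "norm (quot m f z) \<le> norm (f - p)"
proof -
  let ?e = "quot m f z"
  have "0 \<le> (f - ?e - p) \<bullet> (z + m *\<^sub>R ?e - z)"
    by (rule sub_mono[OF quot_sub p]) (rule m)
  then have "0 \<le> m * ((f - p) \<bullet> ?e - ?e \<bullet> ?e)"
    by (simp add: algebra_simps)
  then have "?e \<bullet> ?e \<le> (f - p) \<bullet> ?e" using m by (simp add: zero_le_mult_iff)
  also have "\<dots> \<le> norm (f - p) * norm ?e" by (rule norm_cauchy_schwarz)
  finally show ?thesis by (cases "?e = 0") (simp_all add: dot_square_norm power2_eq_square)
qed

text \<open>Along \<open>m \<down> 0\<close> the norms of \<open>quot m f z\<close> increase, and the increments of the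
  squared norms control the distances; this replaces weak compactness.\<close>

lemma quot_cauchy:
  assumes m: "0 < n" "n \<le> m"
  shows "norm (quot m f z) \<le> norm (quot n f z)"
    and "(norm (quot m f z - quot n f z))\<^sup>2
        \<le> (norm (quot n f z))\<^sup>2 - (norm (quot m f z))\<^sup>2"
proof -
  define a b where "a = quot m f z" and "b = quot n f z"
  have m0: "0 < m" using m by simp
  have "0 \<le> ((f - a) - (f - b)) \<bullet> ((z + m *\<^sub>R a) - (z + n *\<^sub>R b))"
    unfolding a_def b_def by (rule sub_mono) (use m m0 in \<open>auto intro: quot_sub\<close>)
  then have 1: "m * (norm a)\<^sup>2 + n * (norm b)\<^sup>2 \<le> (m + n) * (a \<bullet> b)"
    by (simp add: power2_norm_eq_inner inner_diff_left inner_diff_right inner_commute algebra_simps)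
  also have "\<dots> \<le> (m + n) * (norm a * norm b)"
    using m m0 by (intro mult_left_mono norm_cauchy_schwarz) auto
  finally have "(norm a - norm b) * (m * norm a - n * norm b) \<le> 0"
    by (simp add: algebra_simps power2_eq_square)
  moreover have "(norm a - norm b) * (m * norm a - n * norm b) > 0" if "norm b < norm a"
  proof (rule mult_pos_pos)
    have "n * norm b \<le> m * norm b" using m by (intro mult_right_mono) auto
    also have "\<dots> < m * norm a" using that m0 by simp
    finally show "0 < m * norm a - n * norm b" by simp
  qed (use that in simp)
  ultimately have ab: "norm a \<le> norm b" by force
  then show "norm (quot m f z) \<le> norm (quot n f z)" by (simp add: a_def b_def)
  have "n * (norm a)\<^sup>2 \<le> n * (norm b)\<^sup>2"
    using ab m by (intro mult_left_mono power_mono) auto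
  then have "(m + n) * (norm a)\<^sup>2 \<le> (m + n) * (a \<bullet> b)"
    using 1 by (simp add: algebra_simps)
  then have "(norm a)\<^sup>2 \<le> a \<bullet> b" using m m0 by simp
  then show "(norm (quot m f z - quot n f z))\<^sup>2
      \<le> (norm (quot n f z))\<^sup>2 - (norm (quot m f z))\<^sup>2"
    unfolding a_def[symmetric] b_def[symmetric]
    by (simp add: power2_norm_eq_inner inner_diff_left inner_diff_right inner_commute)
qed

text \<open>For nonempty \<open>sub z\<close> this is the projection of 0 onto the closed convex set
  f - sub z.\<close>

definition min_velocity :: "'b \<Rightarrow> 'b \<Rightarrow> 'b" where
  "min_velocity f z = lim (\<lambda>n. quot (inverse (real (Suc n))) f z)"

text \<open>A bound on the quotients is assumed rather than a subgradient at \<open>z\<close>, so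
  that the lemma can also produce one. The squared norms increase to a finite limit, and their
  increments dominate the squared distances.\<close>

lemma min_velocity_limit:
  assumes C: "\<And>m. 0 < m \<Longrightarrow> norm (quot m f z) \<le> C"
  shows "(\<lambda>n. quot (inverse (real (Suc n))) f z) \<longlonglongrightarrow> min_velocity f z"
    and "f - min_velocity f z \<in> sub z" and "norm (min_velocity f z) \<le> C"
proof -
  let ?e = "\<lambda>n. quot (inverse (real (Suc n))) f z"
  have mono: "norm (?e i) \<le> norm (?e j)"
    "(norm (?e i - ?e j))\<^sup>2 \<le> (norm (?e j))\<^sup>2 - (norm (?e i))\<^sup>2" if "i
        \<le> j" for i j
    using that by (auto intro!: quot_cauchy)
  have inc: "incseq (\<lambda>n. (norm (?e n))\<^sup>2)"
    unfolding incseq_def using mono(1) by (simp add: power_mono)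
  have "(norm (?e n))\<^sup>2 \<le> C\<^sup>2" for n
    using C[of "inverse (real (Suc n))"] by (intro power_mono) auto
  then obtain L where "(\<lambda>n. (norm (?e n))\<^sup>2) \<longlonglongrightarrow> L"
    using incseq_convergent[OF inc, of "C\<^sup>2"] by blast
  then have "Cauchy (\<lambda>n. (norm (?e n))\<^sup>2)"
    by (rule LIMSEQ_imp_Cauchy)
  have "Cauchy ?e"
  proof (rule metric_CauchyI)
    fix d :: real assume d: "0 < d"
    then obtain M where M: "\<And>i j. i \<ge> M \<Longrightarrow> j \<ge> M
        \<Longrightarrow> \<bar>(norm (?e i))\<^sup>2 - (norm (?e j))\<^sup>2\<bar> < d\<^sup>2"
      using metric_CauchyD[OF \<open>Cauchy (\<lambda>n. (norm (?e n))\<^sup>2)\<close>, of "d\<^sup>2"]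
      by (auto simp: dist_real_def)
    have *: "dist (?e i) (?e j) < d" if "i \<ge> M" "j \<ge> M" "i \<le> j" for i j
    proof -
      have "(norm (?e i - ?e j))\<^sup>2 < d\<^sup>2"
        using mono(2)[OF that(3)] M[OF that(1,2)] by linarith
      then show ?thesis using d by (simp add: dist_norm power2_less_imp_less)
    qed
    show "\<exists>M. \<forall>i\<ge>M. \<forall>j\<ge>M. dist (?e i) (?e j) < d"
      by (intro exI[of _ M]) (metis * dist_commute nle_le)
  qed
  then show lim: "?e \<longlonglongrightarrow> min_velocity f z"
    unfolding min_velocity_def using Cauchy_convergent convergent_LIMSEQ_iff by blast
  show "norm (min_velocity f z) \<le> C"
    by (rule LIMSEQ_le_const2[OF tendsto_norm[OF lim]]) (use C in auto)
  show "f - min_velocity f z \<in> sub z"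
  proof (rule sub_closed)
    show "f - ?e n \<in> sub (z + inverse (real (Suc n)) *\<^sub>R ?e n)" for n
      by (rule quot_sub) simp
    have "(\<lambda>n. z + inverse (real (Suc n)) *\<^sub>R ?e n) \<longlonglongrightarrow> z
        + 0 *\<^sub>R min_velocity f z"
      by (intro tendsto_intros lim LIMSEQ_inverse_real_of_nat)
    then show "(\<lambda>n. z + inverse (real (Suc n)) *\<^sub>R ?e n) \<longlonglongrightarrow> z"
      by simp
    show "(\<lambda>n. f - ?e n) \<longlonglongrightarrow> f - min_velocity f z"
      by (intro tendsto_intros lim)
  qed
qed

lemma min_velocity_props:
  assumes p: "p \<in> sub z"
  shows "(\<lambda>n. quot (inverse (real (Suc n))) f z) \<longlonglongrightarrow> min_velocity f z"
    and "f - min_velocity f z \<in> sub z" and "norm (min_velocity f z) \<le> norm (f - p)"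
  using min_velocity_limit[of f z "norm (f - p)"] quot_bound[OF _ p] by auto

text \<open>Demiclosedness by strong limits only: testing monotonicity against the pairs (X n, p n)
  and letting n grow bounds the backward Euler velocities at \<open>x\<close>, for
  \<open>f = 0\<close>, by \<open>C\<close>; their limit is minus a subgradient.\<close>

lemma sub_bounded_limit:
  assumes p: "\<And>n. p n \<in> sub (X n)" "\<And>n. norm (p n) \<le> C" and X: "X
      \<longlonglongrightarrow> x"
  shows "\<exists>q\<in>sub x. norm q \<le> C"
proof -
  have C: "0 \<le> C" using p(2)[of 0] norm_ge_zero order_trans by blast
  have "norm (quot m 0 x) \<le> C" if m: "0 < m" for m
  proof -
    let ?e = "quot m 0 x"
    have *: "m * (norm ?e)\<^sup>2 \<le> m * (C * norm ?e) + (norm ?e + C) * norm (x - X n)" for n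
    proof -
      have "0 \<le> (- ?e - p n) \<bullet> (x + m *\<^sub>R ?e - X n)"
        by (rule sub_mono) (use quot_sub[OF m, of 0 x] p in auto)
      then have "m * (norm ?e)\<^sup>2 \<le> m * (- p n \<bullet> ?e)
          + (- ?e - p n) \<bullet> (x - X n)"
        by (simp add: power2_norm_eq_inner algebra_simps)
      moreover have "- p n \<bullet> ?e \<le> C * norm ?e"
        using norm_cauchy_schwarz[of "- p n" ?e] mult_right_mono[OF p(2)[of n], of "norm ?e"] by simp
      then have "m * (- p n \<bullet> ?e) \<le> m * (C * norm ?e)"
        using m by (intro mult_left_mono) auto
      moreover have "(- ?e - p n) \<bullet> (x - X n) \<le> norm (- ?e - p n) * norm (x - X n)"
        by (rule norm_cauchy_schwarz)
      moreover have "norm (- ?e - p n) \<le> norm ?e + C"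
        using norm_triangle_ineq4[of "- ?e" "p n"] p(2)[of n] by simp
      then have "norm (- ?e - p n) * norm (x - X n) \<le> (norm ?e + C) * norm (x - X n)"
        by (intro mult_right_mono) auto
      ultimately show ?thesis by linarith
    qed
    have "(\<lambda>n. m * (C * norm ?e) + (norm ?e + C) * norm (x - X n))
        \<longlonglongrightarrow> m * (C * norm ?e) + (norm ?e + C) * norm (x - x)"
      by (intro tendsto_intros X)
    then have "m * (norm ?e)\<^sup>2 \<le> m * (C * norm ?e) + (norm ?e + C) * norm (x - x)"
      by (rule LIMSEQ_le_const) (use * in auto)
    then have "norm ?e * norm ?e \<le> C * norm ?e" using m by (simp add: power2_eq_square)
    then show ?thesis using C by (cases "?e = 0") auto
  qed
  from min_velocity_limit(2,3)[of 0 x C, OF this] show ?thesis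
    by (intro bexI[of _ "- min_velocity 0 x"]) auto
qed

text \<open>Testing against the points \<open>z + m *\<^sub>R quot m f z\<close> of the graph gives strong convergence without
  weak compactness.\<close>

lemma tendsto_min_velocity:
  assumes p: "p \<in> sub z"
    and h1: "\<And>e. 0 < e \<Longrightarrow> \<forall>\<^sub>F i in F. norm (q i)
        \<le> norm (min_velocity f z) + e"
    and h2: "\<And>w p e. p \<in> sub w \<Longrightarrow> 0 < e \<Longrightarrow>
      \<forall>\<^sub>F i in F. q i \<bullet> (z - w) \<le> (f - p) \<bullet> (z - w) + e"
  shows "(q \<longlongrightarrow> min_velocity f z) F"
proof (rule tendstoI)
  fix d :: real assume d: "0 < d"
  define v where "v = min_velocity f z"
  define e where "e n = quot (inverse (real (Suc n))) f z" for n
  have e: "e \<longlonglongrightarrow> v" unfolding e_def v_def by (rule min_velocity_props[OF p])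
  have "(\<lambda>n. 2 * (norm v)\<^sup>2 - 2 * (norm (e n))\<^sup>2 + 2 * (norm v
      + 1) * norm (v - e n)) \<longlonglongrightarrow>
      2 * (norm v)\<^sup>2 - 2 * (norm v)\<^sup>2 + 2 * (norm v + 1) * norm (v - v)"
    by (intro tendsto_intros e)
  then have "\<forall>\<^sub>F n in sequentially. 2 * (norm v)\<^sup>2 - 2 * (norm (e n))\<^sup>2
      + 2 * (norm v + 1) * norm (v - e n) < d\<^sup>2 / 4"
    by (rule order_tendstoD) (use d in simp)
  \<comment> \<open>The Euler velocities converge to \<open>v\<close>, so a single step size makes
    this part of the final expansion of |q i - v|^2 small.\<close>
  then obtain n where n: "2 * (norm v)\<^sup>2 - 2 * (norm (e n))\<^sup>2 + 2 * (norm v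
      + 1) * norm (v - e n) < d\<^sup>2 / 4"
    by (auto simp: eventually_sequentially)
  define m where "m = inverse (real (Suc n))"
  have m: "0 < m" by (simp add: m_def)
  have "((\<lambda>r. (norm v + r)\<^sup>2) \<longlongrightarrow> (norm v
      + 0)\<^sup>2) (at_right 0)"
    by (intro tendsto_intros)
  then have "\<forall>\<^sub>F r in at_right 0. (norm v + r)\<^sup>2 < (norm v)\<^sup>2
      + d\<^sup>2 / 4"
    by (rule order_tendstoD) (use d in simp)
  moreover have "\<forall>\<^sub>F r in at_right 0. r \<in> {0<..<1::real}"
    by (rule eventually_at_right_real) simp
  ultimately have ev: "\<forall>\<^sub>F r in at_right (0::real). r \<in> {0<..<1} \<and> (norm v
      + r)\<^sup>2 < (norm v)\<^sup>2 + d\<^sup>2 / 4"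
    by eventually_elim simp
  obtain r :: real where r: "0 < r" "r < 1" "(norm v + r)\<^sup>2 < (norm v)\<^sup>2
      + d\<^sup>2 / 4"
    using eventually_happens'[OF trivial_limit_at_right_real ev] by auto
  have "\<forall>\<^sub>F i in F. norm (q i) \<le> norm v + r"
    using h1[OF r(1)] by (simp add: v_def)
  \<comment> \<open>The graph point is the one reached by the Euler step. Division by
    \<open>m\<close> turns the inequality into |e n|^2 <= q i . e n + d^2 / 8, hence a tolerance
    proportional to \<open>m\<close>.\<close>
  moreover have "\<forall>\<^sub>F i in F. q i \<bullet> (z - (z + m *\<^sub>R e n))
      \<le> (f - (f - e n)) \<bullet> (z - (z + m *\<^sub>R e n)) + m * d\<^sup>2 / 8"
    by (rule h2) (use quot_sub[OF m, of f z] m d in \<open>auto simp: e_def m_def\<close>)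
  ultimately show "\<forall>\<^sub>F i in F. dist (q i) (min_velocity f z) < d"
  proof eventually_elim
    case (elim i)
    have "m * ((norm (e n))\<^sup>2) \<le> m * (q i \<bullet> e n + d\<^sup>2 / 8)"
      using elim(2) by (simp add: power2_norm_eq_inner algebra_simps)
    then have 1: "(norm (e n))\<^sup>2 \<le> q i \<bullet> e n + d\<^sup>2 / 8" using m by simp
    have "- (q i \<bullet> (v - e n)) \<le> norm (q i) * norm (v - e n)"
      using norm_cauchy_schwarz[of "- q i" "v - e n"] by simp
    also have "\<dots> \<le> (norm v + 1) * norm (v - e n)"
      using elim(1) r(2) by (intro mult_right_mono) auto
    finally have 2: "- (q i \<bullet> (v - e n)) \<le> (norm v + 1) * norm (v - e n)" .
    have 3: "(norm (q i))\<^sup>2 \<le> (norm v)\<^sup>2 + d\<^sup>2 / 4"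
      using power_mono[OF elim(1), of 2] r(3) by simp
    have "(norm (q i - v))\<^sup>2
        = (norm (q i))\<^sup>2 - 2 * (q i \<bullet> e n) - 2 * (q i \<bullet> (v - e n)) + (norm v)\<^sup>2"
      by (simp add: power2_norm_eq_inner inner_diff_left inner_diff_right inner_commute)
    also have "\<dots> < d\<^sup>2"
    proof -
      have "0 < d\<^sup>2" using d by simp
      with 1 2 3 n show ?thesis by (simp only: mult.assoc)
    qed
    finally show ?case using d by (simp add: dist_norm v_def power2_less_imp_less)
  qed
qed

end

section \<open>Differential equations with Lipschitz right-hand side\<close>

text \<open>The minimiser \<open>w\<close> of |w|^2 / 2 - L w exists by \<open>prox_exists\<close>;
  its variational inequality, tested at \<open>w + p\<close> and \<open>w - p\<close>, becomes an
  equality by linearity.\<close>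

lemma riesz_representation:
  fixes L :: "'b::{real_inner,complete_space} \<Rightarrow> real"
  assumes L: "bounded_linear L"
  shows "\<exists>w. \<forall>p. L p = w \<bullet> p"
proof -
  interpret bounded_linear L by (rule L)
  interpret lsc_convex UNIV "\<lambda>x. - L x"
  proof
    show "convex_on UNIV (\<lambda>x. - L x)"
      by (simp add: convex_on_def add scaleR)
    have "closed ((\<lambda>x. - L x) -` {..c})" for c
      by (intro closed_vimage continuous_intros continuous_on)
    then show "closed {x \<in> UNIV. - L x \<le> c}" for c
      by (simp add: vimage_def)
  qed simp
  obtain w where "- w \<in> sub w" using prox_exists[of 1 0] by auto
  then have *: "L v - L w \<le> w \<bullet> (v - w)" for v
    by (auto simp: sub_def dest!: spec[of _ v])
  have "L p = w \<bullet> p" for p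
    using *[of "w + p"] *[of "w - p"] by (simp add: add diff algebra_simps)
  then show ?thesis by blast
qed

text \<open>The library's vector integral is only available on the class \<open>banach\<close>, which a variable of
  sort \<open>{real_inner, complete_space}\<close> does not belong to; the primitive of a continuous function is
  therefore obtained weakly, from the Riesz representation theorem.\<close>

lemma antiderivative_exists:
  fixes f :: "real \<Rightarrow> 'b::{real_inner,complete_space}"
  assumes f: "continuous_on {a..} f"
  shows "\<exists>U. U a = 0
      \<and> (\<forall>t\<ge>a. (U has_vector_derivative f t) (at t within {a..}))"
proof -
  define I where "I t p = integral {a..t} (\<lambda>s. f s \<bullet> p)" for t p
  have c: "continuous_on {a..t} (\<lambda>s. f s \<bullet> p)" for t p
    by (intro continuous_intros continuous_on_subset[OF f]) auto
  have int: "(\<lambda>s. f s \<bullet> p) integrable_on {a..t}" for t p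
    by (rule integrable_continuous_real[OF c])
  have "bounded_linear (I t)" for t
  proof -
    have "compact (f ` {a..t})"
      by (intro compact_continuous_image continuous_on_subset[OF f]) auto
    then obtain B where B: "\<And>s. s \<in> {a..t} \<Longrightarrow> norm (f s) \<le> B"
      using compact_imp_bounded bounded_iff by (metis image_eqI)
    show ?thesis
    proof (rule bounded_linear_intro)
      show "I t (x + y) = I t x + I t y" for x y
        unfolding I_def inner_add_right by (rule integral_add[OF int int])
      show "I t (r *\<^sub>R x) = r *\<^sub>R I t x" for r x
        by (simp add: I_def)
      show "norm (I t x) \<le> norm x * (B * max 0 (t - a))" for x
      proof (cases "a \<le> t")
        case True
        have "norm (I t x) \<le> (B * norm x) * (t - a)"
          unfolding I_def
        proof (rule integral_bound[OF True c])
          fix s assume "s \<in> {a..t}"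
          then have "norm (f s) * norm x \<le> B * norm x" using B by (intro mult_right_mono) auto
          then show "norm (f s \<bullet> x) \<le> B * norm x"
            using Cauchy_Schwarz_ineq2[of "f s" x] by simp
        qed
        then show ?thesis using True by (simp add: algebra_simps)
      qed (simp add: I_def)
    qed
  qed
  then have "\<exists>w. \<forall>p. I t p = w \<bullet> p" for t by (rule riesz_representation)
  then obtain U where U: "\<And>t p. I t p = U t \<bullet> p" by metis
  have "U a = 0" using U[of a "U a"] by (simp add: I_def)
  moreover have "(U has_vector_derivative f t) (at t within {a..})" if t: "t \<ge> a" for t
    unfolding has_vector_derivative_def has_derivative_within_alt
  proof (intro conjI allI impI)
    fix e :: real assume e: "0 < e"
    obtain d where d: "d > 0" "\<And>s. s \<ge> a \<Longrightarrow> dist s t < d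
        \<Longrightarrow> dist (f s) (f t) < e"
      using f t e unfolding continuous_on_iff by (metis atLeast_iff)
    show "\<exists>d>0. \<forall>y\<in>{a..}. norm (y - t) < d \<longrightarrow>
        norm (U y - U t - (y - t) *\<^sub>R f t) \<le> e * norm (y - t)"
    proof (intro exI[of _ d] conjI ballI impI)
      fix y assume y: "y \<in> {a..}" "norm (y - t) < d"
      \<comment> \<open>The remainder is tested against itself: \<open>h y - h t\<close> equals
        |q|^2, and the scalar mean value inequality bounds it by e |q| |y - t|.\<close>
      define q where "q = U y - U t - (y - t) *\<^sub>R f t"
      define h where "h s = U s \<bullet> q - s * (f t \<bullet> q)" for s
      define S where "S = {min y t..max y t}"
      have "norm (h y - h t) \<le> (e * norm q) * norm (y - t)"
      proof (rule field_differentiable_bound[of S h "\<lambda>s. (f s - f t) \<bullet> q"])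
        fix s assume s: "s \<in> S"
        have "((\<lambda>x. integral {a..x} (\<lambda>s. f s \<bullet> q)) has_real_derivative f s \<bullet> q)
            (at s within {a..max y t})"
          by (rule integral_has_real_derivative[OF c]) (use s y t in \<open>auto simp: S_def\<close>)
        then have "((\<lambda>s. U s \<bullet> q) has_real_derivative f s \<bullet> q) (at s within {a..max y t})"
          by (simp add: I_def flip: U)
        then have "((\<lambda>s. U s \<bullet> q) has_real_derivative f s \<bullet> q) (at s within S)"
          by (rule DERIV_subset) (use y t in \<open>auto simp: S_def\<close>)
        then show "(h has_real_derivative (f s - f t) \<bullet> q) (at s within S)"
          unfolding h_def by (auto intro!: derivative_eq_intros simp: inner_diff_left)
        have "dist s t < d" using s y by (auto simp: S_def dist_real_def)
        moreover have "a \<le> s" using s y t by (auto simp: S_def)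
        ultimately have "norm (f s - f t) \<le> e" using d(2)[of s] by (simp add: dist_norm)
        then have "norm (f s - f t) * norm q \<le> e * norm q" by (intro mult_right_mono) auto
        then show "norm ((f s - f t) \<bullet> q) \<le> e * norm q"
          using Cauchy_Schwarz_ineq2[of "f s - f t" q] by simp
      qed (auto simp: S_def)
      moreover have "h y - h t = q \<bullet> q"
        by (simp add: h_def q_def inner_diff_left algebra_simps)
      ultimately have "norm q * norm q \<le> (e * norm (y - t)) * norm q"
        by (simp add: dot_square_norm power2_eq_square algebra_simps)
      then show "norm (U y - U t - (y - t) *\<^sub>R f t) \<le> e * norm (y - t)"
        unfolding q_def[symmetric] using e by (cases "q = 0") auto
    qed (rule d)
  qed (rule bounded_linear_scaleR_left)
  ultimately show ?thesis by blast
qed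

lemma has_vector_derivative_continuous_on:
  assumes "\<And>t. t \<in> S \<Longrightarrow> (u has_vector_derivative u' t) (at t within S)"
  shows "continuous_on S u"
  using assms by (meson continuous_on_eq_continuous_within has_vector_derivative_continuous)

text \<open>In the norm weighted by exp (-2 K (t - t0)) integration gains the factor 1 / (2 K), so
  the Lipschitz constant \<open>K\<close> leaves a contraction by 1/2 on the whole half-line. The
  unknown is u / E, and the uniform bound on \<open>F t 0\<close> keeps the iterates
  bounded.\<close>

lemma picard_lindelof:
  fixes F :: "real \<Rightarrow> 'b::{real_inner,complete_space} \<Rightarrow> 'b"
  assumes K: "0 < K"
    and cont: "\<And>u. continuous_on {t0..} u
        \<Longrightarrow> continuous_on {t0..} (\<lambda>t. F t (u t))"
    and lip: "\<And>t x y. t \<ge> t0 \<Longrightarrow> norm (F t x - F t y) \<le> K * norm (x - y)"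
    and bd: "\<And>t. t \<ge> t0 \<Longrightarrow> norm (F t 0) \<le> M"
  shows "\<exists>u. u t0 = z0
      \<and> (\<forall>t\<ge>t0. (u has_vector_derivative F t (u t)) (at t within {t0..}))"
proof -
  define E where "E t = exp (2 * K * (t - t0))" for t
  have E: "E t > 0" "t \<ge> t0 \<Longrightarrow> E t \<ge> 1" for t using K by (auto simp: E_def)
  have E': "(E has_real_derivative 2 * K * E t) (at t within S)" for t S
    unfolding E_def by (auto intro!: derivative_eq_intros)
  have Ec: "continuous_on S E" for S unfolding E_def by (intro continuous_intros)
  have M: "0 \<le> M" using bd[of t0] norm_ge_zero order_trans by blast
  define k where "k v s = F s (E s *\<^sub>R apply_bcontfun v s)" for v s
  have kc: "continuous_on {t0..} (k v)" for v
    unfolding k_def by (intro cont continuous_intros Ec) auto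
  define Pr where "Pr v = (SOME U. U t0 = 0
      \<and> (\<forall>t\<ge>t0. (U has_vector_derivative k v t) (at t within {t0..})))" for v
  have "Pr v t0 = 0 \<and> (\<forall>t\<ge>t0. (Pr v has_vector_derivative k v t) (at t within {t0..}))" for v
    unfolding Pr_def by (rule someI_ex[OF antiderivative_exists[OF kc]])
  then have Pr0: "Pr v t0 = 0" and Pr': "\<And>t. t \<ge> t0
      \<Longrightarrow> (Pr v has_vector_derivative k v t) (at t within {t0..})" for v
    by auto
  \<comment> \<open>A derivative dominated by \<open>N\<close> times that of \<open>E\<close> forces
    growth dominated by \<open>N * E\<close>; this is where the factor 1 / (2 K) is gained.\<close>
  have grow: "norm (U t) \<le> N * E t"
    if U: "U t0 = 0" "\<And>t. t \<ge> t0
        \<Longrightarrow> (U has_vector_derivative U' t) (at t within {t0..})"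
      and N: "\<And>t. t \<ge> t0 \<Longrightarrow> norm (U' t)
          \<le> N * (2 * K * E t)" and t: "t \<ge> t0"
    for U U' :: "real \<Rightarrow> 'b" and N t
  proof (cases "t = t0")
    case True
    have "0 \<le> N * (2 * K * E t0)" using N[of t0] norm_ge_zero order_trans by blast
    then have "0 \<le> N" using mult_neg_pos[of N "2 * K * E t0"] K E(1)[of t0] by fastforce
    then show ?thesis using True U(1) E(1)[of t0] by simp
  next
    case False
    have "norm (U t - U t0) \<le> N * E t - N * E t0"
    proof (rule differentiable_bound_general)
      show "t0 < t" using False t by simp
      show "continuous_on {t0..t} U"
        by (rule continuous_on_subset[OF has_vector_derivative_continuous_on[OF U(2)]]) auto
      show "continuous_on {t0..t} (\<lambda>t. N * E t)" by (intro continuous_intros Ec)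
      fix s assume s: "t0 < s" "s < t"
      show "(U has_vector_derivative U' s) (at s)"
        using U(2)[of s] s by (simp add: at_within_interior[of _ "{t0..}"])
      show "((\<lambda>t. N * E t) has_vector_derivative N * (2 * K * E s)) (at s)"
        unfolding has_real_derivative_iff_has_vector_derivative[symmetric]
        by (intro DERIV_cmult E')
      show "norm (U' s) \<le> N * (2 * K * E s)" using N s by simp
    qed
    moreover have "0 \<le> N * (2 * K * E t0)" using N[of t0] norm_ge_zero order_trans by blast
    then have "0 \<le> N * E t0"
      using mult_pos_neg[of "2 * K" "N * E t0"] K by (fastforce simp: ac_simps)
    ultimately show ?thesis using U(1) by simp
  qed
  \<comment> \<open>Bounded continuous functions live on the whole line, so the values left of
    \<open>t0\<close> are frozen.\<close>
  define Q where "Q v t = (1 / E (max t t0)) *\<^sub>R (z0 + Pr v (max t t0))" for v t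
  have Q: "Q v \<in> bcontfun" for v
  proof (rule bcontfun_normI)
    have "continuous_on {t0..} (\<lambda>t. (1 / E t) *\<^sub>R (z0 + Pr v t))"
      by (intro continuous_intros Ec has_vector_derivative_continuous_on[OF Pr'])
        (use E(1) in \<open>auto simp: less_imp_neq[symmetric]\<close>)
    then show "continuous_on UNIV (Q v)"
      unfolding Q_def by (rule continuous_on_compose2) (auto intro: continuous_intros)
    fix t
    \<comment> \<open>\<open>?N\<close> collects M / (2 K) from the values \<open>F s 0\<close> and
      |v| / 2 from the Lipschitz part.\<close>
    let ?t = "max t t0" and ?N = "M / (2 * K) + norm v / 2"
    have "norm (Pr v ?t) \<le> ?N * E ?t"
    proof (rule grow[OF Pr0 Pr'])
      fix s assume s: "s \<ge> t0"
      have "norm (k v s) \<le> norm (F s (E s *\<^sub>R apply_bcontfun v s) - F s 0) + norm (F s 0)"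
        unfolding k_def by (metis norm_triangle_ineq diff_add_cancel)
      also have "\<dots> \<le> K * norm (E s *\<^sub>R apply_bcontfun v s) + M"
        using lip[OF s, of "E s *\<^sub>R apply_bcontfun v s" 0] bd[OF s] by simp
      also have "norm (E s *\<^sub>R apply_bcontfun v s) \<le> E s * norm v"
        using E(1)[of s] norm_bounded[of v s] by simp
      also have "M \<le> M * E s" using M E(2)[OF s] by (simp add: mult_le_cancel_left1)
      also have "K * (E s * norm v) + M * E s = ?N * (2 * K * E s)"
        using K by (simp add: field_simps)
      finally show "norm (k v s) \<le> ?N * (2 * K * E s)"
        using K by simp
    qed auto
    then have "norm (Pr v ?t) / E ?t \<le> ?N" using E(1)[of ?t] by (simp add: pos_divide_le_eq)
    moreover have "norm z0 / E ?t \<le> norm z0"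
      using E(2)[of ?t] by (simp add: divide_le_eq mult_le_cancel_left1)
    moreover have "norm (Q v t) \<le> norm z0 / E ?t + norm (Pr v ?t) / E ?t"
      using E(1)[of ?t] norm_triangle_ineq[of z0 "Pr v ?t"]
      by (simp add: Q_def divide_right_mono flip: add_divide_distrib)
    ultimately show "norm (Q v t) \<le> norm z0 + ?N" by simp
  qed
  define P where "P v = Bcontfun (Q v)" for v
  have P: "apply_bcontfun (P v) = Q v" for v
    unfolding P_def by (rule Bcontfun_inverse[OF Q])
  have "dist (P v) (P w) \<le> 1/2 * dist v w" for v w
  proof (rule dist_bound)
    fix t
    let ?t = "max t t0"
    have "norm (Pr v ?t - Pr w ?t) \<le> (dist v w / 2) * E ?t"
    proof (rule grow[where U = "\<lambda>t. Pr v t - Pr w t" and U' = "\<lambda>t. k v t - k w t"])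
      show "Pr v t0 - Pr w t0 = 0" by (simp add: Pr0)
      fix s assume s: "s \<ge> t0"
      show "((\<lambda>t. Pr v t - Pr w t) has_vector_derivative k v s - k w s) (at s within {t0..})"
        by (intro has_vector_derivative_diff Pr' s)
      have "norm (k v s - k w s)
          \<le> K * norm (E s *\<^sub>R (apply_bcontfun v s - apply_bcontfun w s))"
        unfolding k_def scaleR_diff_right by (rule lip[OF s])
      also have "\<dots> \<le> K * (E s * dist v w)"
        using K E(1)[of s] dist_bounded[of v s w] by (simp add: dist_norm)
      finally show "norm (k v s - k w s) \<le> dist v w / 2 * (2 * K * E s)"
        by (simp add: algebra_simps)
    qed simp
    then have "norm (Pr v ?t - Pr w ?t) / E ?t \<le> dist v w / 2"
      using E(1)[of ?t] by (simp add: pos_divide_le_eq)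
    moreover have "Q v t - Q w t = (1 / E ?t) *\<^sub>R (Pr v ?t - Pr w ?t)"
      by (simp add: Q_def flip: scaleR_diff_right)
    ultimately show "dist (apply_bcontfun (P v) t) (apply_bcontfun (P w) t) \<le> 1/2 * dist v w"
      unfolding P dist_norm using E(1)[of ?t] by simp
  qed
  then obtain v where v: "P v = v"
    using banach_fix_type[of "1/2" P] by auto
  define u where "u t = E t *\<^sub>R apply_bcontfun v t" for t
  have u: "u t = z0 + Pr v t" if "t \<ge> t0" for t
  proof -
    have "apply_bcontfun v t = Q v t" using P[of v] v by simp
    then show ?thesis using that E(1)[of t] by (simp add: u_def Q_def max_def)
  qed
  show ?thesis
  proof (intro exI[of _ u] conjI allI impI)
    show "u t0 = z0" by (simp add: u Pr0)
    fix t assume t: "t \<ge> t0"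
    have "((\<lambda>t. z0 + Pr v t) has_vector_derivative F t (u t)) (at t within {t0..})"
      using Pr'[OF t, of v] by (auto intro!: derivative_eq_intros simp: k_def u_def)
    then show "(u has_vector_derivative F t (u t)) (at t within {t0..})"
      by (rule has_vector_derivative_transform[rotated 2]) (use t u in auto)
  qed
qed

section \<open>The regularized flow\<close>

text \<open>Derivatives are taken within \<open>{c..}\<close> because the regularised flow is known
  only to the right of its starting time.\<close>

lemma deriv_nonpos_imp_le:
  fixes h :: "real \<Rightarrow> real"
  assumes ab: "c \<le> a" "a \<le> b"
    and h: "\<And>t. a \<le> t \<Longrightarrow> t \<le> b
        \<Longrightarrow> (h has_real_derivative h' t) (at t within {c..})"
    and h': "\<And>t. a < t \<Longrightarrow> t < b \<Longrightarrow> h' t \<le> 0"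
  shows "h b \<le> h a"
proof (rule DERIV_nonpos_imp_decreasing_open[OF ab(2)])
  show "\<exists>y. (h has_real_derivative y) (at x) \<and> y \<le> 0" if "a < x" "x < b" for x
    using h[of x] h'[of x] that ab by (auto simp: at_within_interior[of _ "{c..}"])
  show "continuous_on {a..b} h"
    unfolding continuous_on_eq_continuous_within
    by (metis DERIV_continuous DERIV_subset ab(1) atLeastAtMost_iff atLeast_iff h order_trans subsetI)
qed

text \<open>The forcing is the derivative of a known \<open>P\<close>, so only the increment of
  \<open>P\<close> enters the bound. Energies can then serve as primitives, without any time
  integral.\<close>

lemma gronwall:
  fixes h :: "real \<Rightarrow> real"
  assumes ab: "c \<le> a" "a \<le> b"
    and h: "\<And>t. a \<le> t \<Longrightarrow> t \<le> b
        \<Longrightarrow> (h has_real_derivative h' t) (at t within {c..})"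
    and P: "\<And>t. a \<le> t \<Longrightarrow> t \<le> b
        \<Longrightarrow> (P has_real_derivative P' t) (at t within {c..})"
    and P0: "\<And>t. a \<le> t \<Longrightarrow> t \<le> b \<Longrightarrow> 0 \<le> P' t"
    and le: "\<And>t. a \<le> t \<Longrightarrow> t \<le> b \<Longrightarrow> h' t \<le> K * h t
        + P' t"
    and K: "0 \<le> K"
  shows "h b \<le> exp (K * (b - a)) * (h a + P b - P a)"
proof -
  define E where "E t = exp (- (K * (t - a)))" for t
  have E': "(E has_real_derivative - K * E t) (at t within S)" for t S
    unfolding E_def by (auto intro!: derivative_eq_intros)
  have "E b * h b - P b \<le> E a * h a - P a"
  proof (rule deriv_nonpos_imp_le[OF ab])
    fix t assume t: "a \<le> t" "t \<le> b"
    show "((\<lambda>t. E t * h t - P t) has_real_derivative (- K * E t * h t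
        + h' t * E t - P' t)) (at t within {c..})"
      by (intro DERIV_diff DERIV_mult E' h P t)
  next
    fix t assume t: "a < t" "t < b"
    have "E t * (h' t - K * h t) \<le> E t * P' t"
      using le[of t] t by (intro mult_left_mono) (auto simp: E_def)
    also have "\<dots> \<le> 1 * P' t"
      using P0[of t] t K by (intro mult_right_mono) (auto simp: E_def)
    finally show "- K * E t * h t + h' t * E t - P' t \<le> 0" by (simp add: algebra_simps)
  qed
  then have "E b * h b \<le> h a + P b - P a" by (simp add: E_def)
  then have "exp (K * (b - a)) * (E b * h b) \<le> exp (K * (b - a)) * (h a + P b - P a)"
    by (intro mult_left_mono) auto
  moreover have "exp (K * (b - a)) * (E b * h b) = h b"
    unfolding E_def mult.assoc[symmetric] exp_add[symmetric] by simp
  ultimately show ?thesis by simp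
qed

lemma has_real_derivative_norm_sq:
  fixes u :: "real \<Rightarrow> 'b::real_inner"
  assumes "(u has_vector_derivative u') (at t within S)"
  shows "((\<lambda>t. (norm (u t))\<^sup>2) has_real_derivative 2 * (u t \<bullet> u')) (at t within S)"
proof -
  have "((\<lambda>t. u t \<bullet> u t) has_derivative (\<lambda>h. u t \<bullet> (h *\<^sub>R u') + (h *\<^sub>R u') \<bullet> u t)) (at t within S)"
    using assms unfolding has_vector_derivative_def by (intro has_derivative_inner)
  then show ?thesis
    unfolding has_field_derivative_def power2_norm_eq_inner
    by (rule has_derivative_eq_rhs) (simp add: fun_eq_iff inner_commute)
qed

lemma has_vector_derivative_quotient_right:
  fixes u :: "real \<Rightarrow> 'c::real_normed_vector"
  assumes u: "(u has_vector_derivative u') (at t within {c..})" and t: "c \<le> t"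
  shows "((\<lambda>h. (1 / h) *\<^sub>R (u (t + h) - u t)) \<longlongrightarrow> u') (at_right 0)"
proof -
  have "(u has_vector_derivative u') (at t within {t..})"
    by (rule has_vector_derivative_within_subset[OF u]) (use t in auto)
  then have "((\<lambda>y. norm (u y - u t - (y - t) *\<^sub>R u') / norm (y - t)) \<longlongrightarrow> 0) (at t within {t..})"
    by (simp add: has_vector_derivative_def has_derivative_iff_norm)
  then have "((\<lambda>y. norm (u y - u t - (y - t) *\<^sub>R u') / norm (y - t)) \<longlongrightarrow> 0) (at_right t)"
    by (rule tendsto_within_subset) auto
  then have "((\<lambda>h. norm (u (h
      + t) - u t - h *\<^sub>R u') / norm h) \<longlongrightarrow> 0) (at_right 0)"
    by (subst (asm) filterlim_at_right_to_0) simp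
  moreover have "\<forall>\<^sub>F h in at_right 0. norm (u (h + t) - u t - h *\<^sub>R u') / norm h
      = norm ((1 / h) *\<^sub>R (u (t + h) - u t) - u')"
    unfolding eventually_at_right_field
  proof (intro exI[of _ 1] conjI allI impI)
    fix h :: real assume h: "0 < h"
    have "(1 / h) *\<^sub>R (u (t + h) - u t) - u' = (1 / h) *\<^sub>R (u (h
        + t) - u t - h *\<^sub>R u')"
      using h by (simp add: algebra_simps)
    then show "norm (u (h + t) - u t - h *\<^sub>R u') / norm h
      = norm ((1 / h) *\<^sub>R (u (t + h) - u t) - u')"
      using h by simp
  qed simp
  ultimately have "((\<lambda>h. norm ((1 / h) *\<^sub>R (u (t
      + h) - u t) - u')) \<longlongrightarrow> 0) (at_right 0)"
    by (rule Lim_transform_eventually)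
  then have "((\<lambda>h. (1 / h) *\<^sub>R (u (t
      + h) - u t) - u') \<longlongrightarrow> 0) (at_right 0)"
    by (rule tendsto_norm_zero_cancel)
  then show ?thesis
    by (rule LIM_zero_cancel)
qed

text \<open>One constant controls both variables; the factor \<open>norm x\<close> in
  \<open>B_time\<close> is the one that arises when the coefficients of a linear map vary with
  time.\<close>

locale gradient_flow = lsc_convex D g
  for D :: "'b::{real_inner,complete_space} set" and g +
  fixes B :: "real \<Rightarrow> 'b \<Rightarrow> 'b" and L t0 :: real and z0 :: 'b
  assumes L: "0 < L"
    and B_lip: "norm (B t x - B t y) \<le> L * norm (x - y)"
    and B_time: "norm (B s x - B t x) \<le> L * \<bar>s - t\<bar> * norm x"
    and B_zero: "B t 0 = 0"
    and z0: "z0 \<in> D"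
begin

lemma B_norm: "norm (B t x) \<le> L * norm x"
  using B_lip[of t x 0] by (simp add: B_zero)

lemma B_dist: "norm (B s x - B t y) \<le> L * norm (x - y) + L * \<bar>s - t\<bar> * norm y"
  using norm_triangle_ineq[of "B s x - B s y" "B s y - B t y"] B_lip[of s x y] B_time[of s y t]
  by simp

lemma B_tendsto:
  assumes "(s \<longlongrightarrow> t) F" "(u \<longlongrightarrow> x) F"
  shows "((\<lambda>i. B (s i) (u i)) \<longlongrightarrow> B t x) F"
proof (rule metric_tendsto_imp_tendsto)
  have "((\<lambda>i. L * norm (u i - x) + L * \<bar>s i - t\<bar> * norm x) \<longlongrightarrow>
      L * norm (x - x) + L * \<bar>t - t\<bar> * norm x) F"
    by (intro tendsto_intros assms)
  then show "((\<lambda>i. L * norm (u i - x)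
      + L * \<bar>s i - t\<bar> * norm x) \<longlongrightarrow> 0) F"
    by simp
  show "\<forall>\<^sub>F i in F. dist (B (s i) (u i)) (B t x) \<le> dist (L * norm (u i - x)
      + L * \<bar>s i - t\<bar> * norm x) 0"
    using B_dist L by (intro always_eventually allI) (simp add: dist_norm)
qed

lemma B_cont: "continuous_on S u \<Longrightarrow> continuous_on S (\<lambda>t. B t (u t))"
  unfolding continuous_on_def by (intro ballI B_tendsto tendsto_ident_at) auto

definition approx :: "real \<Rightarrow> real \<Rightarrow> 'b" where
  "approx l = (SOME u. u t0 = z0 \<and>
     (\<forall>t\<ge>t0. (u has_vector_derivative (B t (u t) - A l (u t))) (at t within {t0..})))"

abbreviation "approx_deriv l t \<equiv> B t (approx l t) - A l (approx l t)"

lemma approx: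
  assumes l: "0 < l"
  shows approx_init: "approx l t0 = z0"
    and approx_deriv: "t \<ge> t0
        \<Longrightarrow> (approx l has_vector_derivative approx_deriv l t) (at t within {t0..})"
proof -
  have Ac: "continuous_on S (A l)" for S
    by (intro lipschitz_on_continuous_on[of "1 / l"] lipschitz_onI)
      (use A_lipschitz l in \<open>auto simp: dist_norm\<close>)
  have "\<exists>u. u t0 = z0 \<and>
     (\<forall>t\<ge>t0. (u has_vector_derivative (B t (u t) - A l (u t))) (at t within {t0..}))"
  proof (rule picard_lindelof)
    show "0 < L + 1 / l" using L l by (simp add: add_pos_pos)
    show "continuous_on {t0..} (\<lambda>t. B t (u t) - A l (u t))" if "continuous_on {t0..} u" for u
      using that by (intro continuous_intros B_cont continuous_on_compose2[OF Ac[of UNIV]]) auto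
    show "norm (B t x - A l x - (B t y - A l y)) \<le> (L + 1 / l) * norm (x - y)" for t x y
      using norm_triangle_ineq4[of "B t x - B t y" "A l x - A l y"] B_lip[of t x y] A_lipschitz[OF l, of x y]
      by (simp add: algebra_simps)
    show "norm (B t 0 - A l 0) \<le> norm (A l 0)" for t by (simp add: B_zero)
  qed
  from someI_ex[OF this, folded approx_def]
  show "approx l t0 = z0" "t \<ge> t0
      \<Longrightarrow> (approx l has_vector_derivative approx_deriv l t) (at t within {t0..})"
    by auto
qed

lemma approx_cont: "0 < l \<Longrightarrow> continuous_on {t0..} (approx l)"
  by (intro has_vector_derivative_continuous_on[OF approx_deriv]) auto

text \<open>Comparison with one graph point (w, p): monotonicity replaces the Yosida value along the
  flow by \<open>A l w\<close>, whose norm is at most |p| for every \<open>l\<close>. Hence one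
  radius serves all parameters.\<close>

lemma approx_bounded:
  "\<exists>R\<ge>0. \<forall>l t. 0 < l \<longrightarrow> t0 \<le> t \<longrightarrow> t \<le> T
      \<longrightarrow> norm (approx l t) \<le> R"
proof -
  obtain w p where p: "p \<in> sub w" by (rule sub_nonempty)
  define c where "c = L * norm w + norm p"
  define S where "S = exp ((2 * L + 1) * \<bar>T - t0\<bar>) * ((norm (z0 - w))\<^sup>2
      + c\<^sup>2 * \<bar>T - t0\<bar>)"
  have "norm (approx l t) \<le> norm w + sqrt S" if l: "0 < l" and t: "t0 \<le> t" "t
      \<le> T" for l t
  proof -
    let ?h = "\<lambda>t. (norm (approx l t - w))\<^sup>2"
    have "?h t \<le> exp ((2 * L + 1) * (t - t0)) * (?h t0 + c\<^sup>2 * t - c\<^sup>2 * t0)"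
    proof (rule gronwall[OF order_refl t(1)])
      fix s assume s: "t0 \<le> s"
      show "(?h has_real_derivative 2 * ((approx l s - w) \<bullet> approx_deriv l s)) (at s within {t0..})"
        by (rule has_real_derivative_norm_sq)
          (use approx_deriv[OF l s] in \<open>auto intro!: derivative_eq_intros\<close>)
      show "((*) (c\<^sup>2) has_real_derivative c\<^sup>2) (at s within {t0..})"
        by (auto intro!: derivative_eq_intros)
      let ?d = "approx l s - w"
      have 1: "- (?d \<bullet> A l (approx l s)) \<le> - (?d \<bullet> A l w)"
        using A_mono[OF l, of "approx l s" w] by (simp add: inner_diff_left inner_commute algebra_simps)
      have 2: "- (?d \<bullet> A l w) \<le> norm ?d * norm p"
        using Cauchy_Schwarz_ineq2[of ?d "A l w"] mult_left_mono[OF A_bound[OF l p], of "norm ?d"]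
        by simp
      have "norm (approx l s) \<le> norm ?d + norm w"
        using norm_triangle_ineq[of ?d w] by simp
      then have "norm (B s (approx l s)) \<le> L * (norm ?d + norm w)"
        using B_norm[of s "approx l s"] L by (meson mult_left_mono less_imp_le order_trans)
      then have 3: "?d \<bullet> B s (approx l s) \<le> norm ?d * (L * (norm ?d + norm w))"
        using norm_cauchy_schwarz[of ?d "B s (approx l s)"]
        by (meson mult_left_mono norm_ge_zero order_trans)
      have "?d \<bullet> approx_deriv l s \<le> norm ?d * (L * (norm ?d + norm w))
          + norm ?d * norm p"
        unfolding inner_diff_right using 1 2 3 by linarith
      also have "\<dots> = L * (norm ?d)\<^sup>2 + norm ?d * c"
        by (simp add: c_def algebra_simps power2_eq_square)
      finally have "2 * (?d \<bullet> approx_deriv l s) \<le> 2 * L * (norm ?d)\<^sup>2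
          + 2 * norm ?d * c"
        by simp
      also have "2 * norm ?d * c \<le> (norm ?d)\<^sup>2 + c\<^sup>2" by (rule sum_squares_bound)
      finally show "2 * (?d \<bullet> approx_deriv l s) \<le> (2 * L + 1) * (norm ?d)\<^sup>2
          + c\<^sup>2"
        by (simp add: algebra_simps)
    qed (use L in auto)
    also have "\<dots> = exp ((2 * L + 1) * (t - t0)) * ((norm (z0 - w))\<^sup>2
        + c\<^sup>2 * (t - t0))"
      using l by (simp add: approx_init algebra_simps)
    also have "\<dots> \<le> S"
      unfolding S_def using t L by (intro mult_mono add_mono mult_left_mono) auto
    finally have "norm (approx l t - w) \<le> sqrt S" by (rule real_le_rsqrt)
    then show ?thesis using norm_triangle_ineq[of "approx l t - w" w] by simp
  qed
  moreover have "0 \<le> S" by (simp add: S_def)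
  ultimately show ?thesis by (intro exI[of _ "norm w + sqrt S"]) auto
qed

definition energy_at :: "real \<Rightarrow> real \<Rightarrow> real" where
  "energy_at l t = env l (approx l t)"

lemma energy_at_deriv:
  "0 < l \<Longrightarrow> t0 \<le> t \<Longrightarrow>
    (energy_at l has_real_derivative A l (approx l t) \<bullet> approx_deriv l t) (at t within {t0..})"
  unfolding energy_at_def by (intro env_derivative approx_deriv)

end

text \<open>Fixing a horizon and a radius that is valid for all parameters makes the constants below
  independent of \<open>l\<close>.\<close>

locale gradient_flow_on = gradient_flow D g B L t0 z0
  for D :: "'b::{real_inner,complete_space} set" and g B L t0 z0 +
  fixes T R :: real
  assumes T: "t0 < T" and R0: "0 \<le> R"
    and R: "0 < l \<Longrightarrow> t0 \<le> t \<Longrightarrow> t \<le> T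
        \<Longrightarrow> norm (approx l t) \<le> R"
begin

lemma B_zl_bound: "0 < l \<Longrightarrow> t0 \<le> t \<Longrightarrow> t \<le> T
    \<Longrightarrow> norm (B t (approx l t)) \<le> L * R"
  using L by (intro order_trans[OF B_norm mult_left_mono[OF R]]) auto

text \<open>Drift = Yosida value + velocity; expanding the squared norm of the drift, at most (L
  R)^2, produces twice the derivative of the envelope energy as cross term.\<close>

lemma energy:
  assumes "0 < l" "t0 \<le> t" "t \<le> T"
  shows "(norm (A l (approx l t)))\<^sup>2
      \<le> (L * R)\<^sup>2 - 2 * (A l (approx l t) \<bullet> approx_deriv l t)"
    and "(norm (approx_deriv l t))\<^sup>2
        \<le> (L * R)\<^sup>2 - 2 * (A l (approx l t) \<bullet> approx_deriv l t)"
proof -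
  have "(norm (B t (approx l t)))\<^sup>2 \<le> (L * R)\<^sup>2"
    using B_zl_bound[OF assms] by (intro power_mono) auto
  moreover have "(norm (B t (approx l t)))\<^sup>2
      = (norm (A l (approx l t)))\<^sup>2 + 2 * (A l (approx l t) \<bullet> approx_deriv l t) + (norm (approx_deriv l t))\<^sup>2"
    by (simp add: power2_norm_eq_inner inner_diff_left inner_diff_right inner_commute)
  ultimately show "(norm (A l (approx l t)))\<^sup>2
      \<le> (L * R)\<^sup>2 - 2 * (A l (approx l t) \<bullet> approx_deriv l t)"
    "(norm (approx_deriv l t))\<^sup>2
        \<le> (L * R)\<^sup>2 - 2 * (A l (approx l t) \<bullet> approx_deriv l t)"
    using zero_le_power2[of "norm (approx_deriv l t)"] zero_le_power2[of "norm (A l (approx l t))"] by linarith+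
qed

lemma energy_at_le:
  assumes l: "0 < l" and ab: "t0 \<le> a" "a \<le> b" "b \<le> T"
  shows "energy_at l b \<le> energy_at l a + (L * R)\<^sup>2 / 2 * (b - a)"
proof -
  have "energy_at l b - (L * R)\<^sup>2 / 2 * b \<le> energy_at l a - (L * R)\<^sup>2 / 2 * a"
  proof (rule deriv_nonpos_imp_le[OF ab(1,2)])
    fix t assume t: "a \<le> t" "t \<le> b"
    show "((\<lambda>t. energy_at l t - (L * R)\<^sup>2 / 2 * t) has_real_derivative
        A l (approx l t) \<bullet> approx_deriv l t - (L * R)\<^sup>2 / 2) (at t within {t0..})"
      using energy_at_deriv[OF l, of t] t ab by (auto intro!: derivative_eq_intros)
  next
    fix t assume t: "a < t" "t < b"
    have "0 \<le> (norm (approx_deriv l t))\<^sup>2" by simp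
    then show "A l (approx l t) \<bullet> approx_deriv l t - (L * R)\<^sup>2 / 2 \<le> 0"
      using energy(2)[OF l, of t] t ab by linarith
  qed
  then show ?thesis by (simp add: field_simps)
qed

lemma energy_at_init: "0 < l \<Longrightarrow> energy_at l t0 \<le> g z0"
  using env_le[OF _ z0] by (simp add: energy_at_def approx_init)

lemma energy_at_lower:
  "\<exists>c. \<forall>l t. 0 < l \<longrightarrow> l \<le> 1 \<longrightarrow> t0 \<le> t
      \<longrightarrow> t \<le> T \<longrightarrow> c \<le> energy_at l t"
proof -
  obtain w p where p: "p \<in> sub w" by (rule sub_nonempty)
  have "g w - norm p * (R + norm w) - (norm p)\<^sup>2 / 2 \<le> energy_at l t"
    if l: "0 < l" "l \<le> 1" "t0 \<le> t" "t \<le> T" for l t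
  proof -
    have "norm (approx l t - w) \<le> R + norm w"
      using norm_triangle_ineq4[of "approx l t" w] R[OF l(1,3,4)] by simp
    then have "norm p * norm (approx l t - w) \<le> norm p * (R + norm w)"
      by (intro mult_left_mono) auto
    moreover have "- (p \<bullet> (approx l t - w)) \<le> norm p * norm (approx l t - w)"
      using norm_cauchy_schwarz[of "- p" "approx l t - w"] by simp
    ultimately show ?thesis
      using env_lower[OF l(1,2) p, of "approx l t"] unfolding energy_at_def by linarith
  qed
  then show ?thesis by blast
qed

text \<open>Coercivity with two parameters leaves only the errors l |b|^2 / 4 and m |a|^2 / 4 in the
  Yosida values. By \<open>energy\<close> their primitives are increments of the envelope energies,
  which are bounded uniformly.\<close>

lemma approx_cauchy:
  "\<exists>C\<ge>0. \<forall>l m t. 0 < l \<longrightarrow> l \<le> 1 \<longrightarrow> 0 < m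
      \<longrightarrow> m \<le> 1 \<longrightarrow> t0 \<le> t \<longrightarrow> t \<le> T \<longrightarrow>
    (norm (approx l t - approx m t))\<^sup>2 \<le> C * (l + m)"
proof -
  obtain c where c: "\<And>l t. 0 < l \<Longrightarrow> l \<le> 1 \<Longrightarrow> t0 \<le> t
      \<Longrightarrow> t \<le> T \<Longrightarrow> c \<le> energy_at l t"
    using energy_at_lower by blast
  define C0 where "C0 = (L * R)\<^sup>2 * (T - t0) + 2 * (g z0 - c)"
  have "c \<le> g z0" using c[of 1 t0] energy_at_init[of 1] T by simp
  then have C0: "0 \<le> C0" using T by (simp add: C0_def)
  have "(norm (approx l t - approx m t))\<^sup>2 \<le> (exp (2 * L * (T - t0)) * C0 / 2) * (l + m)"
    if l: "0 < l" "l \<le> 1" and m: "0 < m" "m \<le> 1" and t: "t0 \<le> t" "t \<le> T" for l m t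
  proof -
    let ?h = "\<lambda>t. (norm (approx l t - approx m t))\<^sup>2"
    \<comment> \<open>Primitive of the Gronwall forcing. The weights are crossed, \<open>l\<close>
      with the energy of the flow for \<open>m\<close> and conversely, as the error terms
      are.\<close>
    define P where "P t = l / 2 * ((L * R)\<^sup>2 * t - 2 * energy_at m t)
        + m / 2 * ((L * R)\<^sup>2 * t - 2 * energy_at l t)" for t
    have energy_at_drop: "(L * R)\<^sup>2 * t - 2 * energy_at k t - ((L * R)\<^sup>2 * t0 - 2 * energy_at k t0) \<le> C0"
      if k: "0 < k" "k \<le> 1" for k
    proof -
      have "(L * R)\<^sup>2 * (t - t0) \<le> (L * R)\<^sup>2 * (T - t0)"
        using t by (intro mult_left_mono) auto
      then show ?thesis
        using c[OF k t] energy_at_init[OF k(1)] by (simp add: C0_def algebra_simps)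
    qed
    have gr: "?h t \<le> exp (2 * L * (t - t0)) * (?h t0 + P t - P t0)"
    proof (rule gronwall[OF order_refl t(1)])
      fix s assume s: "t0 \<le> s" "s \<le> t"
      then have sT: "s \<le> T" using t by simp
      let ?d = "approx l s - approx m s" and ?a = "A l (approx l s)" and ?b = "A m (approx m s)"
      show "(?h has_real_derivative 2 * (?d \<bullet> (approx_deriv l s - approx_deriv m s))) (at s within {t0..})"
        by (intro has_real_derivative_norm_sq has_vector_derivative_diff approx_deriv l m s)
      show "(P has_real_derivative l / 2 * ((L * R)\<^sup>2 - 2 * (?b \<bullet> approx_deriv m s))
          + m / 2 * ((L * R)\<^sup>2 - 2 * (?a \<bullet> approx_deriv l s))) (at s within {t0..})"
        unfolding P_def using energy_at_deriv[OF l(1) s(1)] energy_at_deriv[OF m(1) s(1)]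
        by (auto intro!: derivative_eq_intros simp: algebra_simps)
      have e: "l / 2 * (norm ?b)\<^sup>2
          \<le> l / 2 * ((L * R)\<^sup>2 - 2 * (?b \<bullet> approx_deriv m s))"
         "m / 2 * (norm ?a)\<^sup>2
             \<le> m / 2 * ((L * R)\<^sup>2 - 2 * (?a \<bullet> approx_deriv l s))"
        using energy(1) l m s(1) sT by (auto intro!: mult_left_mono)
      moreover have "0 \<le> l / 2 * (norm ?b)\<^sup>2" "0 \<le> m / 2 * (norm ?a)\<^sup>2"
        using l m by auto
      ultimately show "0 \<le> l / 2 * ((L * R)\<^sup>2 - 2 * (?b \<bullet> approx_deriv m s))
          + m / 2 * ((L * R)\<^sup>2 - 2 * (?a \<bullet> approx_deriv l s))" by linarith
      have 1: "?d \<bullet> (B s (approx l s) - B s (approx m s)) \<le> L * (norm ?d)\<^sup>2"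
      proof -
        have "?d \<bullet> (B s (approx l s) - B s (approx m s))
            \<le> norm ?d * norm (B s (approx l s) - B s (approx m s))"
          by (rule norm_cauchy_schwarz)
        also have "\<dots> \<le> norm ?d * (L * norm ?d)" by (intro mult_left_mono B_lip) auto
        finally show ?thesis by (simp add: power2_eq_square algebra_simps)
      qed
      have 2: "(?a - ?b) \<bullet> (l *\<^sub>R ?a - m *\<^sub>R ?b) \<le> (?a - ?b) \<bullet> ?d"
        by (rule A_coercive) (use l m in auto)
      have 3: "(?a - ?b) \<bullet> (l *\<^sub>R ?a - m *\<^sub>R ?b) = l * (norm ?a)\<^sup>2
          + m * (norm ?b)\<^sup>2 - (l + m) * (?a \<bullet> ?b)"
        by (simp add: power2_norm_eq_inner inner_diff_left inner_diff_right inner_commute algebra_simps)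
      \<comment> \<open>Completing the square with the weights 1 and 1/4 consumes l |a|^2 and m
        |b|^2 entirely, so that only crossed terms survive.\<close>
      have sq: "k * (x \<bullet> y) \<le> k * (norm x)\<^sup>2
          + k / 4 * (norm y)\<^sup>2" if "0 < k" for k and x y :: 'b
      proof -
        have "0 \<le> k * (norm (x - (1/2) *\<^sub>R y))\<^sup>2" using that by simp
        also have "\<dots> = k * (norm x)\<^sup>2 + k / 4 * (norm y)\<^sup>2 - k * (x \<bullet> y)"
          by (simp add: power2_norm_eq_inner inner_diff_left inner_diff_right inner_commute algebra_simps)
        finally show ?thesis by simp
      qed
      have "- (l / 4 * (norm ?b)\<^sup>2 + m / 4 * (norm ?a)\<^sup>2) \<le> (?a - ?b) \<bullet> ?d"
        using 2 3 sq[OF l(1), of ?a ?b] sq[OF m(1), of ?b ?a]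
        by (simp add: distrib_right inner_commute)
      moreover have "?d \<bullet> (approx_deriv l s - approx_deriv m s)
          = ?d \<bullet> (B s (approx l s) - B s (approx m s)) - (?a - ?b) \<bullet> ?d"
        by (simp add: inner_diff_left inner_diff_right inner_commute)
      ultimately have "2 * (?d \<bullet> (approx_deriv l s - approx_deriv m s))
          \<le> 2 * L * (norm ?d)\<^sup>2
          + (l / 2 * (norm ?b)\<^sup>2 + m / 2 * (norm ?a)\<^sup>2)"
        using 1 by (simp add: algebra_simps)
      then show "2 * (?d \<bullet> (approx_deriv l s - approx_deriv m s))
          \<le> 2 * L * (norm ?d)\<^sup>2
          + (l / 2 * ((L * R)\<^sup>2 - 2 * (?b \<bullet> approx_deriv m s)) + m / 2 * ((L * R)\<^sup>2 - 2 * (?a \<bullet> approx_deriv l s)))"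
        using e by linarith
    qed (use L in auto)
    have eq: "exp (2 * L * (t - t0)) * (?h t0 + P t - P t0) = exp (2 * L * (t - t0)) * (P t - P t0)"
      using l m by (simp add: approx_init)
    note gr
    also note eq
    also have "\<dots> \<le> exp (2 * L * (T - t0)) * (l / 2 * C0 + m / 2 * C0)"
    proof (rule mult_mono)
      have "P t - P t0 = l / 2 * ((L * R)\<^sup>2 * t - 2 * energy_at m t - ((L * R)\<^sup>2 * t0 - 2 * energy_at m t0))
          + m / 2 * ((L * R)\<^sup>2 * t - 2 * energy_at l t - ((L * R)\<^sup>2 * t0 - 2 * energy_at l t0))"
        by (simp add: P_def algebra_simps)
      also have "\<dots> \<le> l / 2 * C0 + m / 2 * C0"
        using l m by (intro add_mono mult_left_mono energy_at_drop) auto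
      finally show "P t - P t0 \<le> l / 2 * C0 + m / 2 * C0" .
      have "0 \<le> exp (2 * L * (t - t0)) * (P t - P t0)"
        using order_trans[OF zero_le_power2 gr] unfolding eq .
      then show "0 \<le> P t - P t0" by (simp add: zero_le_mult_iff)
    qed (use t L in auto)
    finally show ?thesis by (simp add: algebra_simps)
  qed
  then show ?thesis using C0
    by (intro exI[of _ "exp (2 * L * (T - t0)) * C0 / 2"]) auto
qed

section \<open>Time shifts and the smoothing effect\<close>

lemma approx_shift:
  assumes l: "0 < l" and h: "0 \<le> h" and st: "t0 \<le> s" "s \<le> t" "t + h \<le> T"
  shows "(norm (approx l (t + h) - approx l t))\<^sup>2
    \<le> exp ((2 * L + 1) * (t - s)) * ((norm (approx l (s + h) - approx l s))\<^sup>2 + (L * R)\<^sup>2 * h\<^sup>2 * (t - s))"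
proof -
  let ?k = "\<lambda>t. (norm (approx l (t
      + h) - approx l t))\<^sup>2" and ?c = "(L * R)\<^sup>2 * h\<^sup>2"
  have "?k t \<le> exp ((2 * L + 1) * (t - s)) * (?k s + ?c * t - ?c * s)"
  proof (rule gronwall[OF st(1,2)])
    fix r assume r: "s \<le> r" "r \<le> t"
    let ?d = "approx l (r + h) - approx l r"
    have rt: "t0 \<le> r" "t0 \<le> r + h" "r + h \<le> T" "r \<le> T" using r st h by auto
    have "((approx l \<circ> (\<lambda>r. r
        + h)) has_vector_derivative 1 *\<^sub>R approx_deriv l (r + h)) (at r within {t0..})"
    proof (rule vector_diff_chain_within)
      show "((\<lambda>r. r + h) has_vector_derivative 1) (at r within {t0..})"
        by (auto intro!: derivative_eq_intros)
      show "(approx l has_vector_derivative approx_deriv l (r + h)) (at (r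
          + h) within (\<lambda>r. r + h) ` {t0..})"
        by (rule has_vector_derivative_within_subset[OF approx_deriv[OF l rt(2)]]) (use h in auto)
    qed
    then show "(?k has_real_derivative 2 * (?d \<bullet> (approx_deriv l (r
        + h) - approx_deriv l r))) (at r within {t0..})"
      by (intro has_real_derivative_norm_sq has_vector_derivative_diff approx_deriv l rt) (simp add: o_def)
    show "((*) ?c has_real_derivative ?c) (at r within {t0..})"
      by (auto intro!: derivative_eq_intros)
    have "norm (B (r + h) (approx l (r + h)) - B r (approx l r)) \<le> L * norm ?d
        + L * h * norm (approx l r)"
      using B_dist[of "r + h" "approx l (r + h)" r "approx l r"] h by simp
    also have "\<dots> \<le> L * norm ?d + L * h * R"
      using R[OF l rt(1) rt(4)] L h by (intro add_left_mono mult_left_mono) auto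
    finally have n: "norm (B (r + h) (approx l (r + h)) - B r (approx l r)) \<le> L * norm ?d
        + L * h * R" .
    have "?d \<bullet> (approx_deriv l (r + h) - approx_deriv l r) = ?d \<bullet> (B (r
        + h) (approx l (r + h)) - B r (approx l r))
        - (A l (approx l (r + h)) - A l (approx l r)) \<bullet> ?d"
      by (simp add: inner_diff_left inner_diff_right inner_commute)
    also have "\<dots> \<le> ?d \<bullet> (B (r + h) (approx l (r + h)) - B r (approx l r))"
      using A_mono[OF l, of "approx l (r + h)" "approx l r"] by simp
    also have "\<dots> \<le> norm ?d * norm (B (r + h) (approx l (r + h)) - B r (approx l r))"
      by (rule norm_cauchy_schwarz)
    also have "\<dots> \<le> norm ?d * (L * norm ?d + L * h * R)" by (intro mult_left_mono n) auto
    finally have "2 * (?d \<bullet> (approx_deriv l (r + h) - approx_deriv l r))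
        \<le> 2 * L * (norm ?d)\<^sup>2 + 2 * norm ?d * (L * R * h)"
      by (simp add: algebra_simps power2_eq_square)
    \<comment> \<open>The time dependence of \<open>B\<close> contributes L R h; Young's inequality
      moves its square into the forcing and raises the rate from 2 L to 2 L + 1.\<close>
    also have "2 * norm ?d * (L * R * h) \<le> (norm ?d)\<^sup>2 + (L * R * h)\<^sup>2"
      by (rule sum_squares_bound)
    finally show "2 * (?d \<bullet> (approx_deriv l (r + h) - approx_deriv l r)) \<le> (2 * L
        + 1) * (norm ?d)\<^sup>2 + ?c"
      by (simp add: algebra_simps power_mult_distrib)
  qed (use L in auto)
  then show ?thesis by (simp add: algebra_simps)
qed

text \<open>Divide \<open>approx_shift\<close> by the square of \<open>h\<close> and let
  \<open>h\<close> decrease to 0.\<close>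

lemma approx_deriv_shift:
  assumes l: "0 < l" and st: "t0 \<le> s" "s \<le> t" "t < T"
  shows "(norm (approx_deriv l t))\<^sup>2 \<le> exp ((2 * L
      + 1) * (t - s)) * ((norm (approx_deriv l s))\<^sup>2 + (L * R)\<^sup>2 * (t - s))"
proof (rule tendsto_le[OF trivial_limit_at_right_real])
  let ?q = "\<lambda>r h. (norm ((1 / h) *\<^sub>R (approx l (r + h) - approx l r)))\<^sup>2"
  show "(?q t \<longlongrightarrow> (norm (approx_deriv l t))\<^sup>2) (at_right 0)"
    using st by (intro tendsto_intros has_vector_derivative_quotient_right[OF approx_deriv] l) auto
  show "((\<lambda>h. exp ((2 * L + 1) * (t - s)) * (?q s h
      + (L * R)\<^sup>2 * (t - s))) \<longlongrightarrow>
      exp ((2 * L + 1) * (t - s)) * ((norm (approx_deriv l s))\<^sup>2 + (L * R)\<^sup>2 * (t - s))) (at_right 0)"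
    using st by (intro tendsto_intros has_vector_derivative_quotient_right[OF approx_deriv] l) auto
  have "?q t h \<le> exp ((2 * L + 1) * (t - s)) * (?q s h + (L * R)\<^sup>2 * (t - s))"
    if h: "0 < h" "h < T - t" for h
  proof -
    have q: "?q r h = (norm (approx l (r + h) - approx l r))\<^sup>2 / h\<^sup>2" for r
      using h by (simp add: power_divide)
    have "?q t h \<le> (exp ((2 * L + 1) * (t - s)) *
        ((norm (approx l (s + h) - approx l s))\<^sup>2 + (L * R)\<^sup>2 * h\<^sup>2 * (t - s))) / h\<^sup>2"
      unfolding q using h by (intro divide_right_mono approx_shift l st) auto
    also have "\<dots> = exp ((2 * L + 1) * (t - s)) * (?q s h + (L * R)\<^sup>2 * (t - s))"
      unfolding q using h by (simp add: field_simps)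
    finally show ?thesis .
  qed
  then show "\<forall>\<^sub>F h in at_right 0. ?q t h \<le> exp ((2 * L + 1) * (t - s)) * (?q s h
      + (L * R)\<^sup>2 * (t - s))"
    unfolding eventually_at_right_field using st by (intro exI[of _ "T - t"]) auto
qed

text \<open>The speed at time t is controlled by that at every earlier s. Averaging over s from t0
  to t trades the initial speed, which is not bounded uniformly in \<open>l\<close>, for the
  dissipated energy, at the price of the factor t - t0.\<close>

lemma approx_deriv_smoothing:
  "\<exists>C\<ge>0. \<forall>l t. 0 < l \<longrightarrow> l \<le> 1 \<longrightarrow> t0 \<le> t
      \<longrightarrow> t < T \<longrightarrow> (t - t0) * (norm (approx_deriv l t))\<^sup>2 \<le> C"
proof -
  obtain c where c: "\<And>l t. 0 < l \<Longrightarrow> l \<le> 1 \<Longrightarrow> t0 \<le> t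
      \<Longrightarrow> t \<le> T \<Longrightarrow> c \<le> energy_at l t"
    using energy_at_lower by blast
  have cg: "c \<le> g z0" using c[of 1 t0] energy_at_init[of 1] T by simp
  define C1 where "C1 = exp ((2 * L + 1) * (T - t0))"
  define C2 where "C2 = (L * R)\<^sup>2 * (T - t0)"
  define C where "C = C1 * (((L * R)\<^sup>2 + C2) * (T - t0) + 2 * (g z0 - c))"
  have C2: "0 \<le> C2" using T by (simp add: C2_def)
  have C: "0 \<le> C" using T C2 cg by (simp add: C_def C1_def)
  have "(t - t0) * (norm (approx_deriv l t))\<^sup>2 \<le> C" if l: "0 < l" "l \<le> 1" and t: "t0
      \<le> t" "t < T" for l t
  proof -
    define N where "N = (norm (approx_deriv l t))\<^sup>2"
    \<comment> \<open>The average over s is taken by monotonicity: with \<open>N\<close> frozen at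
      time t, \<open>approx_deriv_shift\<close> and \<open>energy\<close> make the derivative of
      this expression in s nonpositive.\<close>
    have "t * N - C1 * (((L * R)\<^sup>2 + C2) * t - 2 * energy_at l t)
        \<le> t0 * N - C1 * (((L * R)\<^sup>2 + C2) * t0 - 2 * energy_at l t0)"
    proof (rule deriv_nonpos_imp_le[OF order_refl t(1)])
      fix s assume s: "t0 \<le> s" "s \<le> t"
      show "((\<lambda>s. s * N - C1 * (((L * R)\<^sup>2
          + C2) * s - 2 * energy_at l s)) has_real_derivative
          N - C1 * ((L * R)\<^sup>2 + C2 - 2 * (A l (approx l s) \<bullet> approx_deriv l s))) (at s within {t0..})"
        using energy_at_deriv[OF l(1) s(1)] by (auto intro!: derivative_eq_intros simp: algebra_simps)
    next
      fix s assume s: "t0 < s" "s < t"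
      have "N \<le> exp ((2 * L + 1) * (t - s)) * ((norm (approx_deriv l s))\<^sup>2
          + (L * R)\<^sup>2 * (t - s))"
        unfolding N_def using s t by (intro approx_deriv_shift l) auto
      also have "\<dots> \<le> C1 * ((L * R)\<^sup>2 - 2 * (A l (approx l s) \<bullet> approx_deriv l s) + C2)"
        unfolding C1_def C2_def using s t L T l
        by (intro mult_mono add_mono mult_left_mono energy) auto
      finally show "N - C1 * ((L * R)\<^sup>2
          + C2 - 2 * (A l (approx l s) \<bullet> approx_deriv l s)) \<le> 0"
        by (simp add: algebra_simps)
    qed
    then have "(t - t0) * N \<le> C1 * (((L * R)\<^sup>2 + C2) * (t - t0)
        + 2 * (energy_at l t0 - energy_at l t))"
      by (simp add: algebra_simps)
    also have "\<dots> \<le> C"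
      unfolding C_def
      using c[OF l, of t] energy_at_init[OF l(1)] t C2 by (intro mult_left_mono add_mono diff_mono) (auto simp: C1_def)
    finally show ?thesis by (simp add: N_def)
  qed
  with C show ?thesis by blast
qed

text \<open>The speed bound sqrt (C / (t - t0)) has the primitive 2 sqrt C sqrt (t - t0). Increments
  of one increasing function continuous at t0 are what absolute continuity up to t0
  requires.\<close>

lemma approx_holder:
  assumes C: "\<And>t. t0 \<le> t \<Longrightarrow> t < T
      \<Longrightarrow> (t - t0) * (norm (approx_deriv l t))\<^sup>2 \<le> C"
    and l: "0 < l" and ab: "t0 \<le> a" "a \<le> b" "b < T"
  shows "norm (approx l b - approx l a) \<le> 2 * sqrt C * (sqrt (b - t0) - sqrt (a - t0))"
proof (cases "a = b")
  case False
  have "norm (approx l b - approx l a)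
      \<le> 2 * sqrt C * sqrt (b - t0) - 2 * sqrt C * sqrt (a - t0)"
  proof (rule differentiable_bound_general)
    show "a < b" using False ab by simp
    show "continuous_on {a..b} (approx l)"
      by (rule continuous_on_subset[OF approx_cont[OF l]]) (use ab in auto)
    show "continuous_on {a..b} (\<lambda>t. 2 * sqrt C * sqrt (t - t0))"
      by (intro continuous_intros)
    fix t assume t: "a < t" "t < b"
    then have t0: "t0 < t" "t < T" using ab by auto
    show "(approx l has_vector_derivative approx_deriv l t) (at t)"
      using approx_deriv[OF l, of t] t0 by (simp add: at_within_interior[of _ "{t0..}"])
    show "((\<lambda>t. 2 * sqrt C * sqrt (t - t0)) has_vector_derivative sqrt (C / (t - t0))) (at t)"
      unfolding has_real_derivative_iff_has_vector_derivative[symmetric]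
      using t0 by (auto intro!: derivative_eq_intros simp: real_sqrt_divide field_simps)
    show "norm (approx_deriv l t) \<le> sqrt (C / (t - t0))"
      using C[of t] t0 by (intro real_le_rsqrt) (simp add: field_simps)
  qed
  then show ?thesis by (simp add: algebra_simps)
qed simp

end

section \<open>The limit flow\<close>

context gradient_flow
begin

definition lam :: "nat \<Rightarrow> real" where
  "lam n = inverse (real (Suc n))"

lemma lam_pos: "0 < lam n" and lam_le: "lam n \<le> 1" and lam_lim: "lam
    \<longlonglongrightarrow> 0"
  using LIMSEQ_inverse_real_of_nat
  by (auto simp: lam_def[abs_def] inverse_le_1_iff simp del: of_nat_Suc)

definition flow :: "real \<Rightarrow> 'b" where
  "flow t = lim (\<lambda>n. approx (lam n) t)"

lemma flow_init: "flow t0 = z0"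
  by (simp add: flow_def approx_init lam_pos)

end

context gradient_flow_on
begin

lemma flow_unif:
  "\<exists>d. d \<longlonglongrightarrow> 0 \<and> (\<forall>n t. t0 \<le> t \<longrightarrow> t
      \<le> T \<longrightarrow> norm (approx (lam n) t - flow t) \<le> d n)"
proof -
  obtain C where C: "0 \<le> C" "\<And>l m t. 0 < l \<Longrightarrow> l \<le> 1
      \<Longrightarrow> 0 < m \<Longrightarrow> m \<le> 1 \<Longrightarrow> t0 \<le> t \<Longrightarrow> t \<le> T \<Longrightarrow>
    (norm (approx l t - approx m t))\<^sup>2 \<le> C * (l + m)"
    using approx_cauchy by blast
  have d: "(\<lambda>n. sqrt (C * (lam n + 0))) \<longlonglongrightarrow> sqrt (C * (0 + 0))"
    by (intro tendsto_intros lam_lim)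
  have "norm (approx (lam n) t - flow t) \<le> sqrt (C * (lam n + 0))" if t: "t0 \<le> t" "t
      \<le> T" for n t
  proof -
    have CC: "(norm (approx (lam i) t - approx (lam j) t))\<^sup>2 \<le> C * (lam i
        + lam j)" for i j
      by (intro C t lam_pos lam_le)
    have "Cauchy (\<lambda>n. approx (lam n) t)"
    proof (rule metric_CauchyI)
      fix r :: real assume r: "0 < r"
      have "(\<lambda>n. C * lam n) \<longlonglongrightarrow> C * 0"
        by (intro tendsto_intros lam_lim)
      then have "\<forall>\<^sub>F n in sequentially. C * lam n < r\<^sup>2 / 2"
        by (rule order_tendstoD) (use r in simp)
      then obtain N where N: "\<And>n. n \<ge> N \<Longrightarrow> C * lam n < r\<^sup>2 / 2"
        by (auto simp: eventually_sequentially)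
      have "dist (approx (lam i) t) (approx (lam j) t) < r" if "i \<ge> N" "j \<ge> N" for i j
      proof -
        have "(norm (approx (lam i) t - approx (lam j) t))\<^sup>2 < r\<^sup>2"
          using CC[of i j] N[OF that(1)] N[OF that(2)] by (simp add: distrib_left)
        then show ?thesis using r by (simp add: dist_norm power2_less_imp_less)
      qed
      then show "\<exists>M. \<forall>i\<ge>M. \<forall>j\<ge>M. dist (approx (lam i) t) (approx (lam j) t) < r"
        by blast
    qed
    then have lim: "(\<lambda>n. approx (lam n) t) \<longlonglongrightarrow> flow t"
      unfolding flow_def by (simp add: Cauchy_convergent_iff convergent_LIMSEQ_iff)
    have "(norm (approx (lam n) t - flow t))\<^sup>2 \<le> C * (lam n + 0)"
      by (rule LIMSEQ_le[OF tendsto_power[OF tendsto_norm[OF tendsto_diff[OF tendsto_const lim]]]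
          tendsto_mult[OF tendsto_const tendsto_add[OF tendsto_const lam_lim]]]) (use CC in auto)
    then show ?thesis by (rule real_le_rsqrt)
  qed
  then show ?thesis using d by (intro exI[of _ "\<lambda>n. sqrt (C * (lam n + 0))"]) simp
qed

lemma flow_tendsto: "t0 \<le> t \<Longrightarrow> t \<le> T
    \<Longrightarrow> (\<lambda>n. approx (lam n) t) \<longlonglongrightarrow> flow t"
proof -
  assume t: "t0 \<le> t" "t \<le> T"
  obtain d where d: "d \<longlonglongrightarrow> 0" "\<And>n. norm (approx (lam n) t - flow t)
      \<le> d n"
    using flow_unif t by blast
  have "(\<lambda>n. approx (lam n) t - flow t) \<longlonglongrightarrow> 0"
    by (rule Lim_null_comparison[OF always_eventually d(1)]) (use d(2) in blast)
  then show ?thesis by (rule LIM_zero_cancel)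
qed

lemma flow_bound: "t0 \<le> t \<Longrightarrow> t \<le> T \<Longrightarrow> norm (flow t) \<le> R"
  by (rule LIMSEQ_le_const2[OF tendsto_norm[OF flow_tendsto]]) (auto intro: R lam_pos)

lemma flow_cont_on: "continuous_on {t0..T} flow"
proof (rule uniform_limit_theorem)
  obtain d where d: "d \<longlonglongrightarrow> 0" "\<And>n t. t0 \<le> t \<Longrightarrow> t
      \<le> T \<Longrightarrow> norm (approx (lam n) t - flow t) \<le> d n"
    using flow_unif by blast
  show "uniform_limit {t0..T} (\<lambda>n. approx (lam n)) flow sequentially"
  proof (rule uniform_limitI)
    fix r :: real assume "0 < r"
    then have "\<forall>\<^sub>F n in sequentially. d n < r"
      using order_tendstoD(2)[OF d(1)] by simp
    then show "\<forall>\<^sub>F n in sequentially. \<forall>x\<in>{t0..T}. dist (approx (lam n) x) (flow x) < r"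
    proof eventually_elim
      case (elim n)
      show ?case
      proof
        fix x assume "x \<in> {t0..T}"
        then show "dist (approx (lam n) x) (flow x) < r"
          using d(2)[of x n] elim by (simp add: dist_norm)
      qed
    qed
  qed
  show "\<forall>\<^sub>F n in sequentially. continuous_on {t0..T} (approx (lam n))"
    by (intro always_eventually allI, rule continuous_on_subset[OF approx_cont[OF lam_pos]]) auto
qed simp

lemma flow_shift:
  assumes h: "0 \<le> h" and st: "t0 \<le> s" "s \<le> t" "t + h \<le> T"
  shows "(norm (flow (t + h) - flow t))\<^sup>2
    \<le> exp ((2 * L + 1) * (t - s)) * ((norm (flow (s + h) - flow s))\<^sup>2 + (L * R)\<^sup>2 * h\<^sup>2 * (t - s))"
proof (rule LIMSEQ_le)
  show "(\<lambda>n. (norm (approx (lam n) (t + h) - approx (lam n) t))\<^sup>2)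
      \<longlonglongrightarrow> (norm (flow (t + h) - flow t))\<^sup>2"
    by (intro tendsto_intros flow_tendsto) (use assms in auto)
  show "(\<lambda>n. exp ((2 * L + 1) * (t - s)) * ((norm (approx (lam n) (s
      + h) - approx (lam n) s))\<^sup>2 + (L * R)\<^sup>2 * h\<^sup>2 * (t - s)))
    \<longlonglongrightarrow> exp ((2 * L + 1) * (t - s)) * ((norm (flow (s + h) - flow s))\<^sup>2 + (L * R)\<^sup>2 * h\<^sup>2 * (t - s))"
    by (intro tendsto_intros flow_tendsto) (use assms in auto)
qed (use approx_shift[OF lam_pos assms] in auto)

text \<open>The Yosida value is drift minus velocity and inherits the same rate at t0; the constant
  is enlarged to serve both bounds.\<close>

lemma flow_smoothing:
  "\<exists>C\<ge>0. (\<forall>a b. t0 \<le> a \<longrightarrow> a \<le> b \<longrightarrow> b < T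
      \<longrightarrow> norm (flow b - flow a) \<le> C * (sqrt (b - t0) - sqrt (a - t0)))
    \<and> (\<forall>n t. t0 < t \<longrightarrow> t < T \<longrightarrow> norm (A (lam n) (approx (lam n) t)) \<le> C / sqrt (t - t0) + C)"
proof -
  obtain C where C: "0 \<le> C" "\<And>l t. 0 < l \<Longrightarrow> l \<le> 1 \<Longrightarrow> t0
      \<le> t \<Longrightarrow> t < T \<Longrightarrow> (t - t0) * (norm (approx_deriv l t))\<^sup>2 \<le> C"
    using approx_deriv_smoothing by blast
  define C' where "C' = 2 * sqrt C + L * R"
  have LR: "0 \<le> L * R" using L R0 by simp
  have 1: "norm (flow b - flow a) \<le> 2 * sqrt C * (sqrt (b - t0) - sqrt (a - t0))"
    if ab: "t0 \<le> a" "a \<le> b" "b < T" for a b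
  proof (rule LIMSEQ_le_const2)
    show "(\<lambda>n. norm (approx (lam n) b - approx (lam n) a))
        \<longlonglongrightarrow> norm (flow b - flow a)"
      by (intro tendsto_intros flow_tendsto) (use ab in auto)
    show "\<exists>N. \<forall>n\<ge>N. norm (approx (lam n) b - approx (lam n) a)
        \<le> 2 * sqrt C * (sqrt (b - t0) - sqrt (a - t0))"
      by (intro exI allI impI approx_holder ab lam_pos C lam_le)
  qed
  have 2: "norm (A (lam n) (approx (lam n) t)) \<le> sqrt C / sqrt (t - t0)
      + L * R" if t: "t0 < t" "t < T" for n t
  proof -
    have "norm (approx_deriv (lam n) t) \<le> sqrt (C / (t - t0))"
      using C(2)[OF lam_pos lam_le, of t n] t by (intro real_le_rsqrt) (simp add: field_simps)
    moreover have "norm (B t (approx (lam n) t)) \<le> L * R"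
      using t by (intro B_zl_bound lam_pos) auto
    ultimately show ?thesis
      using norm_triangle_ineq4[of "B t (approx (lam n) t)" "approx_deriv (lam n) t"] by (simp add: real_sqrt_divide)
  qed
  show ?thesis
  proof (intro exI[of _ C'] conjI allI impI)
    show "0 \<le> C'" using C(1) LR by (simp add: C'_def)
    fix a b assume ab: "t0 \<le> a" "a \<le> b" "b < T"
    have "norm (flow b - flow a) \<le> 2 * sqrt C * (sqrt (b - t0) - sqrt (a - t0))"
      by (rule 1[OF ab])
    also have "\<dots> \<le> C' * (sqrt (b - t0) - sqrt (a - t0))"
      using ab LR by (intro mult_right_mono) (auto simp: C'_def)
    finally show "norm (flow b - flow a) \<le> C' * (sqrt (b - t0) - sqrt (a - t0))" .
  next
    fix n t assume t: "t0 < t" "t < T"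
    have "norm (A (lam n) (approx (lam n) t)) \<le> sqrt C / sqrt (t - t0) + L * R"
      by (rule 2[OF t])
    also have "\<dots> \<le> C' / sqrt (t - t0) + C'"
      using LR C(1) t by (intro add_mono divide_right_mono) (auto simp: C'_def)
    finally show "norm (A (lam n) (approx (lam n) t)) \<le> C' / sqrt (t - t0) + C'" .
  qed
qed

text \<open>At a fixed time after t0 the Yosida values are bounded in n, so multiplying them by
  \<open>lam n\<close>, or pairing them with the error of the approximation, gives null
  sequences.\<close>

lemma flow_resolvent:
  assumes t: "t0 < t" "t < T"
  shows "(\<lambda>n. J (lam n) (approx (lam n) t)) \<longlonglongrightarrow> flow t"
    and "(\<lambda>n. A (lam n) (approx (lam n) t) \<bullet> (approx (lam n) t - flow t))
        \<longlonglongrightarrow> 0"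
proof -
  obtain C where C: "\<And>n. norm (A (lam n) (approx (lam n) t)) \<le> C / sqrt (t - t0) + C"
    using flow_smoothing t by blast
  have lim: "(\<lambda>n. approx (lam n) t) \<longlonglongrightarrow> flow t"
    by (rule flow_tendsto) (use t in auto)
  have "(\<lambda>n. lam n *\<^sub>R A (lam n) (approx (lam n) t)) \<longlonglongrightarrow> 0"
  proof (rule Lim_null_comparison)
    show "\<forall>\<^sub>F n in sequentially. norm (lam n *\<^sub>R A (lam n) (approx (lam n) t))
        \<le> lam n * (C / sqrt (t - t0) + C)"
      using C lam_pos by (intro always_eventually allI) (simp add: mult_left_mono less_imp_le)
    show "(\<lambda>n. lam n * (C / sqrt (t - t0) + C)) \<longlonglongrightarrow> 0"
      using tendsto_mult[OF lam_lim tendsto_const] by simp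
  qed
  from tendsto_diff[OF lim this]
  show "(\<lambda>n. J (lam n) (approx (lam n) t)) \<longlonglongrightarrow> flow t"
    by (simp add: J_eq lam_pos)
  show "(\<lambda>n. A (lam n) (approx (lam n) t) \<bullet> (approx (lam n) t - flow t))
      \<longlonglongrightarrow> 0"
  proof (rule Lim_null_comparison)
    have "norm (A (lam n) (approx (lam n) t) \<bullet> (approx (lam n) t - flow t))
        \<le> (C / sqrt (t - t0) + C) * norm (approx (lam n) t - flow t)" for n
      using Cauchy_Schwarz_ineq2 C mult_right_mono norm_ge_zero order_trans real_norm_def by metis
    then show "\<forall>\<^sub>F n in sequentially. norm (A (lam n) (approx (lam n) t) \<bullet> (approx (lam n) t - flow t))
        \<le> (C / sqrt (t - t0) + C) * norm (approx (lam n) t - flow t)" by simp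
    have "(\<lambda>n. (C / sqrt (t - t0) + C) * norm (approx (lam n) t - flow t))
        \<longlonglongrightarrow> (C / sqrt (t - t0) + C) * norm (flow t - flow t)"
      by (intro tendsto_intros lim)
    then show "(\<lambda>n. (C / sqrt (t - t0) + C) * norm (approx (lam n) t - flow t))
        \<longlonglongrightarrow> 0"
      by simp
  qed
qed

lemma flow_sub_bounded:
  "\<exists>C\<ge>0. \<forall>t. t0 < t \<longrightarrow> t < T
      \<longrightarrow> (\<exists>p\<in>sub (flow t). norm p \<le> C / sqrt (t - t0) + C)"
proof -
  obtain C where C: "0 \<le> C" "\<And>n t. t0 < t \<Longrightarrow> t < T
      \<Longrightarrow> norm (A (lam n) (approx (lam n) t)) \<le> C / sqrt (t - t0) + C"
    using flow_smoothing by blast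
  have "\<exists>p\<in>sub (flow t). norm p \<le> C / sqrt (t - t0)
      + C" if t: "t0 < t" "t < T" for t
    by (rule sub_bounded_limit[OF A_sub[OF lam_pos] C(2)[OF t] flow_resolvent(1)[OF t]])
  with C(1) show ?thesis by blast
qed

text \<open>At \<open>a\<close> the subgradient inequality of the envelope exchanges the approximate
  energy for \<open>g (flow a)\<close> up to a vanishing pairing; at \<open>b\<close> lower
  semicontinuity along the resolvents yields the bound for \<open>g (flow b)\<close>.\<close>

lemma flow_energy:
  assumes ab: "t0 \<le> a" "a \<le> b" "b < T"
  shows "flow b \<in> D" and "g (flow b) \<le> g (flow a) + (L * R)\<^sup>2 / 2 * (b - a)"
proof -
  have D: "flow t \<in> D" if "t0 \<le> t" "t < T" for t
    using flow_sub_bounded that z0 sub_D flow_init by (metis order_le_less)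
  then show "flow b \<in> D" using ab by simp
  show "g (flow b) \<le> g (flow a) + (L * R)\<^sup>2 / 2 * (b - a)"
  proof (cases "a = b")
    case False
    with ab have b: "t0 < b" by simp
    have "\<exists>c. c \<longlonglongrightarrow> 0 \<and> (\<forall>n. energy_at (lam n) a
        \<le> g (flow a) + c n)"
    \<comment> \<open>The Yosida values need not stay bounded at \<open>t0\<close>, but there every
      approximation starts exactly at \<open>z0\<close>.\<close>
    proof (cases "a = t0")
      case True
      then show ?thesis
        using energy_at_init[OF lam_pos] flow_init by (intro exI[of _ "\<lambda>_. 0"]) auto
    next
      case False
      with ab have a: "t0 < a" "a < T" by auto
      have "energy_at (lam n) a \<le> g (flow a)
          + A (lam n) (approx (lam n) a) \<bullet> (approx (lam n) a - flow a)" for n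
        using env_sub[OF lam_pos, of n "approx (lam n) a" "flow a"] env_le[OF lam_pos D[of a], of n] a
        by (simp add: energy_at_def inner_diff_right)
      then show ?thesis using flow_resolvent(2)[OF a] by blast
    qed
    then obtain c where c: "c \<longlonglongrightarrow> 0" "\<And>n. energy_at (lam n) a
        \<le> g (flow a) + c n"
      by blast
    have "flow b \<in> D \<and> g (flow b) \<le> g (flow a) + 0 + (L * R)\<^sup>2 / 2 * (b - a)"
    proof (rule lsc_seq[OF _ _ flow_resolvent(1)[OF b ab(3)]])
      show "J (lam n) (approx (lam n) b) \<in> D" for n using A_sub[OF lam_pos] sub_D by blast
      show "g (J (lam n) (approx (lam n) b)) \<le> g (flow a) + c n
          + (L * R)\<^sup>2 / 2 * (b - a)" for n
        using env_ge[OF lam_pos, of n "approx (lam n) b"] energy_at_le[OF lam_pos, of a b n] c(2)[of n] ab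
        unfolding energy_at_def by linarith
      show "(\<lambda>n. g (flow a) + c n + (L * R)\<^sup>2 / 2 * (b - a))
          \<longlonglongrightarrow> g (flow a) + 0 + (L * R)\<^sup>2 / 2 * (b - a)"
        by (intro tendsto_intros c)
    qed
    then show ?thesis by simp
  qed simp
qed

section \<open>Integral inequalities against points of the graph\<close>

lemma approx_dist_deriv:
  assumes l: "0 < l" and p: "p \<in> sub w" and t: "t0 \<le> t"
  shows "((\<lambda>t. (norm (approx l t - w))\<^sup>2) has_real_derivative 2 * ((approx l t - w) \<bullet> approx_deriv l t)) (at t within {t0..})"
    and "2 * ((approx l t - w) \<bullet> approx_deriv l t)
        \<le> 2 * ((B t (approx l t) - p) \<bullet> (approx l t - w)) + l * (norm p)\<^sup>2 / 2"
proof -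
  show "((\<lambda>t. (norm (approx l t - w))\<^sup>2) has_real_derivative 2 * ((approx l t - w) \<bullet> approx_deriv l t)) (at t within {t0..})"
    by (rule has_real_derivative_norm_sq)
      (use approx_deriv[OF l t] in \<open>auto intro!: derivative_eq_intros\<close>)
  have "(approx l t - w) \<bullet> approx_deriv l t
      = (B t (approx l t) - p) \<bullet> (approx l t - w) - (A l (approx l t) - p) \<bullet> (approx l t - w)"
    by (simp add: inner_diff_left inner_diff_right inner_commute)
  then show "2 * ((approx l t - w) \<bullet> approx_deriv l t)
      \<le> 2 * ((B t (approx l t) - p) \<bullet> (approx l t - w)) + l * (norm p)\<^sup>2 / 2"
    using A_sub_ineq[OF l p, of "approx l t"] by simp
qed

text \<open>This is Benilan's integral inequality with the integral bounded by \<open>c\<close>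
  times the length. It contains no derivative of the flow and therefore survives the uniform limit;
  \<open>A_sub_ineq\<close> provides it for the approximations up to an error of order
  \<open>lam n\<close>.\<close>

lemma flow_integral_ineq:
  assumes p: "p \<in> sub w" and st: "t0 \<le> s" "s \<le> t" "t \<le> T"
    and c: "\<And>r. s \<le> r \<Longrightarrow> r \<le> t
        \<Longrightarrow> (B r (flow r) - p) \<bullet> (flow r - w) \<le> c"
  shows "(norm (flow t - w))\<^sup>2 \<le> (norm (flow s - w))\<^sup>2 + 2 * c * (t - s)"
proof -
  obtain d where d: "d \<longlonglongrightarrow> 0" "\<And>n t. t0 \<le> t \<Longrightarrow> t
      \<le> T \<Longrightarrow> norm (approx (lam n) t - flow t) \<le> d n"
    using flow_unif by blast
  \<comment> \<open>\<open>Q * d n\<close> is the price of replacing the approximation by the flow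
    in the pairing of \<open>B r u - p\<close> with \<open>u - w\<close>.\<close>
  define Q where "Q = L * (R + norm w) + (L * R + norm p)"
  have d0: "0 \<le> d n" for n using order_trans[OF norm_ge_zero d(2)[of t n]] st by simp
  have main: "(norm (approx (lam n) t - w))\<^sup>2 \<le> (norm (approx (lam n) s - w))\<^sup>2
      + (2 * (c + Q * d n) + lam n * (norm p)\<^sup>2 / 2) * (t - s)" for n
  proof -
    let ?c = "2 * (c + Q * d n) + lam n * (norm p)\<^sup>2 / 2"
    have "(norm (approx (lam n) t - w))\<^sup>2 - ?c * t
        \<le> (norm (approx (lam n) s - w))\<^sup>2 - ?c * s"
    proof (rule deriv_nonpos_imp_le[OF st(1,2)])
      fix r assume r: "s \<le> r" "r \<le> t"
      then have "t0 \<le> r" using st by simp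
      then show "((\<lambda>t. (norm (approx (lam n) t - w))\<^sup>2 - ?c * t) has_real_derivative
          2 * ((approx (lam n) r - w) \<bullet> approx_deriv (lam n) r) - ?c) (at r within {t0..})"
        by (intro DERIV_diff approx_dist_deriv(1)[OF lam_pos p] DERIV_cmult_Id)
    next
      fix r assume r: "s < r" "r < t"
      then have rT: "t0 \<le> r" "r \<le> T" using st by auto
      let ?u = "approx (lam n) r"
      have "(B r ?u - p) \<bullet> (?u - w) = (B r (flow r) - p) \<bullet> (flow r - w)
          + ((B r ?u - B r (flow r)) \<bullet> (?u - w) + (B r (flow r) - p) \<bullet> (?u - flow r))"
        by (simp add: inner_diff_left inner_diff_right)
      also have "\<dots> \<le> c + (L * d n * (R + norm w) + (L * R + norm p) * d n)"
      proof (intro add_mono c)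
        have "(B r ?u - B r (flow r)) \<bullet> (?u - w)
            \<le> norm (B r ?u - B r (flow r)) * norm (?u - w)"
          by (rule norm_cauchy_schwarz)
        also have "\<dots> \<le> L * d n * (R + norm w)"
        proof (rule mult_mono)
          show "norm (B r ?u - B r (flow r)) \<le> L * d n"
            using L by (intro order_trans[OF B_lip mult_left_mono[OF d(2)[OF rT]]]) simp
          show "norm (?u - w) \<le> R + norm w"
            using norm_triangle_ineq4[of ?u w] R[OF lam_pos rT, of n] by simp
        qed (use L d0 in auto)
        finally show "(B r ?u - B r (flow r)) \<bullet> (?u - w) \<le> L * d n * (R + norm w)" .
        have "(B r (flow r) - p) \<bullet> (?u - flow r)
            \<le> norm (B r (flow r) - p) * norm (?u - flow r)"
          by (rule norm_cauchy_schwarz)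
        also have "\<dots> \<le> (L * R + norm p) * d n"
        proof (rule mult_mono)
          have "norm (B r (flow r)) \<le> L * R"
            using L by (intro order_trans[OF B_norm mult_left_mono[OF flow_bound[OF rT]]]) simp
          then show "norm (B r (flow r) - p) \<le> L * R + norm p"
            using norm_triangle_ineq4[of "B r (flow r)" p] by simp
        qed (use d(2)[OF rT] L R0 in auto)
        finally show "(B r (flow r) - p) \<bullet> (?u - flow r) \<le> (L * R + norm p) * d n" .
      qed (use r in auto)
      also have "\<dots> = c + Q * d n" by (simp add: Q_def algebra_simps)
      finally show "2 * ((?u - w) \<bullet> approx_deriv (lam n) r) - ?c \<le> 0"
        using approx_dist_deriv(2)[OF lam_pos p rT(1), of n] by simp
    qed
    then show ?thesis by (simp only: right_diff_distrib)
  qed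
  have "(norm (flow t - w))\<^sup>2 \<le> (norm (flow s - w))\<^sup>2 + (2 * (c + Q * 0)
      + 0 * (norm p)\<^sup>2 / 2) * (t - s)"
  proof (rule LIMSEQ_le)
    show "(\<lambda>n. (norm (approx (lam n) t - w))\<^sup>2)
        \<longlonglongrightarrow> (norm (flow t - w))\<^sup>2"
      by (intro tendsto_intros flow_tendsto) (use st in auto)
    show "(\<lambda>n. (norm (approx (lam n) s - w))\<^sup>2 + (2 * (c + Q * d n)
        + lam n * (norm p)\<^sup>2 / 2) * (t - s))
      \<longlonglongrightarrow> (norm (flow s - w))\<^sup>2 + (2 * (c + Q * 0) + 0 * (norm p)\<^sup>2 / 2) * (t - s)"
      by (intro tendsto_intros flow_tendsto d lam_lim) (use st in auto)
  qed (use main in auto)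
  then show ?thesis by simp
qed

text \<open>Linear counterpart of the squared inequality. Taken at \<open>w = flow s\<close> it
  bounds the length of a difference quotient by the supremum of |drift - p|.\<close>

lemma flow_dist_ineq:
  assumes p: "p \<in> sub w" and st: "t0 \<le> s" "s \<le> t" "t \<le> T"
    and c: "\<And>r. s \<le> r \<Longrightarrow> r \<le> t
        \<Longrightarrow> norm (B r (flow r) - p) \<le> c"
  shows "norm (flow t - w) \<le> norm (flow s - w) + c * (t - s)"
proof (rule field_le_epsilon)
  fix r :: real assume r: "0 < r"
  obtain d where d: "d \<longlonglongrightarrow> 0" "\<And>n t. t0 \<le> t \<Longrightarrow> t
      \<le> T \<Longrightarrow> norm (approx (lam n) t - flow t) \<le> d n"
    using flow_unif by blast
  have d0: "0 \<le> d n" for n using order_trans[OF norm_ge_zero d(2)[of t n]] st by simp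
  have c0: "0 \<le> c" using c[of s] st norm_ge_zero order_trans by blast
  \<comment> \<open>The norm is smoothed by \<open>r\<close>, as it is not differentiable at 0; the
    lower bound \<open>r\<close> on \<open>y\<close> also lets the error lam n |p|^2 / 4 be written
    as a multiple of \<open>y\<close>.\<close>
  define y where "y n t = sqrt ((norm (approx (lam n) t - w))\<^sup>2 + r\<^sup>2)" for n t
  have main: "y n t \<le> y n s + (c + L * d n
      + lam n * (norm p)\<^sup>2 / (4 * r)) * (t - s)" for n
  proof -
    let ?c = "c + L * d n + lam n * (norm p)\<^sup>2 / (4 * r)"
    have "y n t - ?c * t \<le> y n s - ?c * s"
    proof (rule deriv_nonpos_imp_le[OF st(1,2)])
      fix q assume q: "s \<le> q" "q \<le> t"
      then have qt: "t0 \<le> q" using st by simp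
      have pos: "0 < (norm (approx (lam n) q - w))\<^sup>2 + r\<^sup>2"
        using r by (simp add: add_nonneg_pos)
      have "((\<lambda>t. (norm (approx (lam n) t - w))\<^sup>2 + r\<^sup>2) has_real_derivative
          2 * ((approx (lam n) q - w) \<bullet> approx_deriv (lam n) q) + 0) (at q within {t0..})"
        by (intro DERIV_add approx_dist_deriv(1)[OF lam_pos p qt] DERIV_const)
      from DERIV_chain2[OF DERIV_real_sqrt[OF pos] this]
      have "(y n has_real_derivative ((approx (lam n) q - w) \<bullet> approx_deriv (lam n) q) / y n q) (at q within {t0..})"
        unfolding y_def by (simp add: field_simps)
      then show "((\<lambda>t. y n t - ?c * t) has_real_derivative
          ((approx (lam n) q - w) \<bullet> approx_deriv (lam n) q) / y n q - ?c) (at q within {t0..})"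
        by (intro DERIV_diff DERIV_cmult_Id)
    next
      fix q assume q: "s < q" "q < t"
      then have qT: "t0 \<le> q" "q \<le> T" using st by auto
      let ?u = "approx (lam n) q"
      have y: "norm (?u - w) \<le> y n q" "r \<le> y n q"
        using r by (auto simp: y_def intro!: real_le_rsqrt)
      have "norm (B q ?u - p) \<le> norm (B q ?u - B q (flow q)) + norm (B q (flow q) - p)"
        using norm_triangle_ineq[of "B q ?u - B q (flow q)" "B q (flow q) - p"] by simp
      also have "\<dots> \<le> L * d n + c"
        using L c q by (intro add_mono order_trans[OF B_lip mult_left_mono[OF d(2)[OF qT]]]) auto
      finally have "norm (B q ?u - p) * norm (?u - w) \<le> (L * d n + c) * y n q"
        using y L d0[of n] c0 by (intro mult_mono) auto
      then have "(B q ?u - p) \<bullet> (?u - w) \<le> (L * d n + c) * y n q"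
        using norm_cauchy_schwarz order_trans by blast
      moreover have "lam n * (norm p)\<^sup>2 / 4 \<le> lam n * (norm p)\<^sup>2 / (4 * r) * y n q"
        using y(2) r lam_pos[of n] by (simp add: field_simps mult_right_mono)
      ultimately have "(?u - w) \<bullet> approx_deriv (lam n) q \<le> ?c * y n q"
        using approx_dist_deriv(2)[OF lam_pos p qT(1), of n] by (simp only: distrib_right add.commute)
      then show "((?u - w) \<bullet> approx_deriv (lam n) q) / y n q - ?c \<le> 0"
        using y r by (simp add: pos_divide_le_eq)
    qed
    then show ?thesis by (simp only: right_diff_distrib)
  qed
  have "sqrt ((norm (flow t - w))\<^sup>2 + r\<^sup>2)
      \<le> sqrt ((norm (flow s - w))\<^sup>2 + r\<^sup>2) + (c + L * 0 + 0 * (norm p)\<^sup>2 / (4 * r)) * (t - s)"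
  proof (rule LIMSEQ_le)
    show "(\<lambda>n. y n t) \<longlonglongrightarrow> sqrt ((norm (flow t - w))\<^sup>2
        + r\<^sup>2)"
      unfolding y_def by (intro tendsto_intros flow_tendsto) (use st in auto)
    show "(\<lambda>n. y n s + (c + L * d n + lam n * (norm p)\<^sup>2 / (4 * r)) * (t - s))
      \<longlonglongrightarrow> sqrt ((norm (flow s - w))\<^sup>2 + r\<^sup>2) + (c + L * 0 + 0 * (norm p)\<^sup>2 / (4 * r)) * (t - s)"
      unfolding y_def by (intro tendsto_intros flow_tendsto d lam_lim) (use st r in auto)
  qed (use main in auto)
  then have "sqrt ((norm (flow t - w))\<^sup>2 + r\<^sup>2)
      \<le> sqrt ((norm (flow s - w))\<^sup>2 + r\<^sup>2) + c * (t - s)"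
    by simp
  moreover have "norm (flow t - w) \<le> sqrt ((norm (flow t - w))\<^sup>2 + r\<^sup>2)"
    by (intro real_le_rsqrt) simp
  moreover have "sqrt ((norm (flow s - w))\<^sup>2 + r\<^sup>2) \<le> norm (flow s - w) + r"
    using r by (intro real_le_lsqrt) (auto simp: power2_sum)
  ultimately show "norm (flow t - w) \<le> norm (flow s - w) + c * (t - s) + r" by linarith
qed

end

lemma has_vector_derivative_quotients:
  fixes u :: "real \<Rightarrow> 'c::real_normed_vector"
  assumes right: "((\<lambda>h. (1 / h) *\<^sub>R (u (t
      + h) - u t)) \<longlongrightarrow> u') (at_right 0)"
    and left: "((\<lambda>h. (1 / h) *\<^sub>R (u t - u (t - h))) \<longlongrightarrow> u') (at_right 0)"
  shows "(u has_vector_derivative u') (at t)"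
    and "((\<lambda>h. (1 / h) *\<^sub>R (u (t + h) - u t)) \<longlongrightarrow> u') (at 0)"
proof -
  have "(\<lambda>h. (1 / h) *\<^sub>R (u t - u (t - h))) = (\<lambda>h. (1 / - h) *\<^sub>R (u (t
      + - h) - u t))"
    by (simp add: fun_eq_iff algebra_simps)
  then have "((\<lambda>h. (1 / h) *\<^sub>R (u (t
      + h) - u t)) \<longlongrightarrow> u') (at_left 0)"
    using left by (simp add: filterlim_at_left_to_right)
  with right show lim: "((\<lambda>h. (1 / h) *\<^sub>R (u (t
      + h) - u t)) \<longlongrightarrow> u') (at 0)"
    by (simp add: filterlim_at_split)
  have "((\<lambda>h. norm ((1 / h) *\<^sub>R (u (t
      + h) - u t) - u')) \<longlongrightarrow> 0) (at 0)"
    using tendsto_norm_zero[OF LIM_zero[OF lim]] .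
  moreover have "\<forall>\<^sub>F h in at 0. norm ((1 / h) *\<^sub>R (u (t + h) - u t) - u')
      = norm (u (t + h) - u t - h *\<^sub>R u') / norm h"
    unfolding eventually_at_filter
  proof (intro always_eventually allI impI)
    fix h :: real assume h: "h \<noteq> 0"
    have "(1 / h) *\<^sub>R (u (t + h) - u t) - u' = (1 / h) *\<^sub>R (u (t
        + h) - u t - h *\<^sub>R u')"
      using h by (simp add: algebra_simps)
    then show "norm ((1 / h) *\<^sub>R (u (t + h) - u t) - u') = norm (u (t
        + h) - u t - h *\<^sub>R u') / norm h"
      by simp
  qed
  ultimately have "((\<lambda>h. norm (u (t
      + h) - u t - h *\<^sub>R u') / norm h) \<longlongrightarrow> 0) (at 0)"
    by (rule Lim_transform_eventually)
  then show "(u has_vector_derivative u') (at t)"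
    unfolding has_vector_derivative_def has_derivative_at by (simp add: bounded_linear_scaleR_left)
qed

section \<open>Pointwise velocity of the limit flow\<close>

context gradient_flow
begin

lemma flow_on: "t0 < T \<Longrightarrow> \<exists>R. gradient_flow_on D g B L t0 z0 T R"
  using approx_bounded[of T] gradient_flow_axioms
  by (auto simp: gradient_flow_on_def gradient_flow_on_axioms_def)

lemma flow_cont: "continuous_on {t0..} flow"
  unfolding continuous_on_eq_continuous_within
proof
  fix t assume t: "t \<in> {t0..}"
  then obtain R where "gradient_flow_on D g B L t0 z0 (t + 1) R" using flow_on[of "t + 1"] by auto
  then interpret gradient_flow_on D g B L t0 z0 "t + 1" R .
  have "continuous (at t within {t0..t + 1}) flow"
    using flow_cont_on t by (simp add: continuous_on_eq_continuous_within)
  moreover have "at t within {t0..t + 1} = at t within {t0..}"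
    by (rule at_within_nhd[of _ "{..<t + 1}"]) auto
  ultimately show "continuous (at t within {t0..}) flow" by simp
qed

definition drift :: "real \<Rightarrow> 'b" where "drift t = B t (flow t)"

definition velocity :: "real \<Rightarrow> 'b" where "velocity t = min_velocity (drift t) (flow t)"

text \<open>For \<open>t > t0\<close> this is the subgradient at \<open>flow t\<close> that makes
  the velocity shortest.\<close>

definition xi :: "real \<Rightarrow> 'b" where "xi t = drift t - velocity t"

lemma drift_cont: "continuous_on {t0..} drift"
  unfolding drift_def by (intro B_cont flow_cont)

lemma xi_sub:
  assumes t: "t0 < t"
  shows "xi t \<in> sub (flow t)" and "p \<in> sub (flow t) \<Longrightarrow> norm (velocity t)
      \<le> norm (drift t - p)"
proof -
  obtain R where "gradient_flow_on D g B L t0 z0 (t + 1) R" using flow_on[of "t + 1"] t by auto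
  then interpret gradient_flow_on D g B L t0 z0 "t + 1" R .
  obtain q where q: "q \<in> sub (flow t)" using flow_sub_bounded t by force
  show "xi t \<in> sub (flow t)" unfolding xi_def velocity_def by (rule min_velocity_props[OF q])
  show "p \<in> sub (flow t) \<Longrightarrow> norm (velocity t) \<le> norm (drift t - p)"
    unfolding velocity_def by (rule min_velocity_props)
qed

lemma flow_D: "t0 \<le> t \<Longrightarrow> flow t \<in> D"
  using xi_sub(1)[of t] sub_D flow_init z0 by (cases "t = t0") auto

text \<open>Away from \<open>t0\<close> the rate 1 / sqrt (t - t0) is bounded, and increments of the
  square root become linear because the sum of the two roots is at least sqrt (a - t0).\<close>

lemma local_bound:
  assumes a: "t0 < a"
  shows "\<exists>M\<ge>0. (\<forall>t\<in>{a..b}. norm (velocity t) \<le> M \<and> norm (xi t)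
      \<le> M) \<and> M-lipschitz_on {a..b} flow"
proof -
  \<comment> \<open>The smoothing bounds hold strictly before the horizon, hence the extra
    unit.\<close>
  define T where "T = max a b + 1"
  have T: "t0 < T" using a by (simp add: T_def)
  then obtain R where "gradient_flow_on D g B L t0 z0 T R" using flow_on by auto
  then interpret gradient_flow_on D g B L t0 z0 T R .
  have LR: "0 \<le> L * R" using L R0 by simp
  have drift: "norm (drift t) \<le> L * R" if "t \<in> {a..b}" for t
  proof -
    have "norm (flow t) \<le> R" using that a by (intro flow_bound) (auto simp: T_def)
    then show ?thesis
      unfolding drift_def using L by (intro order_trans[OF B_norm mult_left_mono]) auto
  qed
  obtain C where C: "0 \<le> C" "\<And>t. t0 < t \<Longrightarrow> t < T
      \<Longrightarrow> \<exists>p\<in>sub (flow t). norm p \<le> C / sqrt (t - t0) + C"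
    using flow_sub_bounded by blast
  obtain C' where C': "0 \<le> C'"
    "\<And>x y. t0 \<le> x \<Longrightarrow> x \<le> y \<Longrightarrow> y < T
        \<Longrightarrow> norm (flow y - flow x) \<le> C' * (sqrt (y - t0) - sqrt (x - t0))"
    using flow_smoothing by blast
  define M0 where "M0 = L * R + (C / sqrt (a - t0) + C)"
  define M where "M = (M0 + L * R) + C' / sqrt (a - t0)"
  have M0: "0 \<le> M0" using a C LR by (simp add: M0_def)
  have velocity: "norm (velocity t) \<le> M0" if t: "t \<in> {a..b}" for t
  proof -
    obtain p where p: "p \<in> sub (flow t)" "norm p \<le> C / sqrt (t - t0) + C"
      using C(2)[of t] t a by (auto simp: T_def)
    have "C / sqrt (t - t0) \<le> C / sqrt (a - t0)"
      using t a C(1) by (intro divide_left_mono) auto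
    then show ?thesis
      using xi_sub(2)[of t p] p t a drift[OF t] norm_triangle_ineq4[of "drift t" p] by (auto simp: M0_def)
  qed
  have xi: "norm (xi t) \<le> M0 + L * R" if t: "t \<in> {a..b}" for t
    using velocity[OF t] drift[OF t] norm_triangle_ineq4[of "drift t" "velocity t"] by (simp add: xi_def)
  have lip: "norm (flow y - flow x) \<le> M * (y - x)" if xy: "a \<le> x" "x \<le> y" "y
      \<le> b" for x y
  proof -
    have pos: "0 < sqrt (a - t0)" using a by simp
    have "sqrt (a - t0) \<le> sqrt (y - t0) + sqrt (x - t0)"
      using xy a real_sqrt_le_mono[of "a - t0" "y - t0"] real_sqrt_ge_zero[of "x - t0"] by linarith
    moreover have "(sqrt (y - t0) - sqrt (x - t0)) * (sqrt (y - t0) + sqrt (x - t0)) = y - x"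
      using xy a by (simp add: algebra_simps)
    moreover have "0 \<le> sqrt (y - t0) - sqrt (x - t0)" using xy by simp
    ultimately have "(sqrt (y - t0) - sqrt (x - t0)) * sqrt (a - t0) \<le> y - x"
      by (metis mult_left_mono)
    then have "C' * (sqrt (y - t0) - sqrt (x - t0)) \<le> C' * ((y - x) / sqrt (a - t0))"
      using pos C' by (intro mult_left_mono) (auto simp: pos_le_divide_eq)
    also have "\<dots> = (C' / sqrt (a - t0)) * (y - x)" by simp
    also have "\<dots> \<le> M * (y - x)"
      using M0 LR xy by (intro mult_right_mono) (auto simp: M_def)
    finally show ?thesis using C'(2)[of x y] xy a by (simp add: T_def)
  qed
  have M: "M0 + L * R \<le> M" "0 \<le> M" using C'(1) a M0 LR by (auto simp: M_def)
  have "M-lipschitz_on {a..b} flow"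
  proof (rule lipschitz_onI)
    fix x y assume "x \<in> {a..b}" "y \<in> {a..b}"
    then show "dist (flow x) (flow y) \<le> M * dist x y"
      using lip[of x y] lip[of y x] by (cases "x \<le> y") (auto simp: dist_norm norm_minus_commute)
  qed (rule M)
  moreover have "norm (velocity t) \<le> M \<and> norm (xi t) \<le> M" if "t \<in> {a..b}" for t
    using velocity[OF that] xi[OF that] M LR by linarith
  ultimately show ?thesis using M by blast
qed

lemma drift_near:
  assumes t: "t0 \<le> t" and r: "0 < r"
  shows "\<exists>d>0. \<forall>s. t0 \<le> s \<longrightarrow> \<bar>s - t\<bar> < d
      \<longrightarrow> norm (drift s - drift t) < r"
  using drift_cont[unfolded continuous_on_iff, rule_format, of t r] t r by (auto simp: dist_norm)

lemma pairing_near: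
  assumes t: "t0 \<le> t" and r: "0 < r"
  shows "\<exists>d>0. \<forall>s. t0 \<le> s
      \<longrightarrow> \<bar>s - t\<bar> < d \<longrightarrow>
    (B s (flow s) - p) \<bullet> (flow s - w) \<le> (drift t - p) \<bullet> (flow t - w) + r"
proof -
  have "continuous_on {t0..} (\<lambda>s. (drift s - p) \<bullet> (flow s - w))"
    by (intro continuous_intros drift_cont flow_cont)
  then obtain d where "d > 0" "\<And>s. t0 \<le> s
      \<Longrightarrow> \<bar>s - t\<bar> < d \<Longrightarrow>
      \<bar>(drift s - p) \<bullet> (flow s - w) - (drift t - p) \<bullet> (flow t - w)\<bar> < r"
    using t r unfolding continuous_on_iff by (force simp: dist_real_def)
  then show ?thesis unfolding drift_def[symmetric] by (intro exI[of _ d]) fastforce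
qed

text \<open>The integral inequalities on [t, t + h] feed \<open>tendsto_min_velocity\<close>: the
  linear one at the graph point (flow t, xi t) bounds the length of the quotient, the squared one
  tests it against all graph points.\<close>

lemma right_derivative:
  assumes t: "t0 < t"
  shows "((\<lambda>h. (1 / h) *\<^sub>R (flow (t
      + h) - flow t)) \<longlongrightarrow> velocity t) (at_right 0)"
  unfolding velocity_def
proof (rule tendsto_min_velocity[OF xi_sub(1)[OF t]])
  obtain R where "gradient_flow_on D g B L t0 z0 (t + 1) R" using flow_on[of "t + 1"] t by auto
  then interpret gradient_flow_on D g B L t0 z0 "t + 1" R .
  {
    fix r :: real assume r: "0 < r"
    then obtain d where d: "d > 0" "\<And>s. t0 \<le> s \<Longrightarrow> \<bar>s - t\<bar> < d
        \<Longrightarrow> norm (drift s - drift t) < r"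
      using drift_near[of t r] t by auto
    have "norm ((1 / h) *\<^sub>R (flow (t + h) - flow t))
        \<le> norm (min_velocity (drift t) (flow t)) + r"
      if h: "0 < h" "h < min d 1" for h
    proof -
      have "norm (flow (t + h) - flow t) \<le> norm (flow t - flow t) + (norm (velocity t)
          + r) * (t + h - t)"
      proof (rule flow_dist_ineq[OF xi_sub(1)[OF t]])
        fix q assume q: "t \<le> q" "q \<le> t + h"
        have "norm (drift q - xi t) \<le> norm (drift q - drift t) + norm (velocity t)"
          using norm_triangle_ineq[of "drift q - drift t" "velocity t"] by (simp add: xi_def algebra_simps)
        then show "norm (B q (flow q) - xi t) \<le> norm (velocity t) + r"
          using d(2)[of q] q h t by (simp add: drift_def)
      qed (use t h in auto)
      then show ?thesis using h by (simp add: velocity_def pos_divide_le_eq mult.commute)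
    qed
    then show "\<forall>\<^sub>F h in at_right 0. norm ((1 / h) *\<^sub>R (flow (t + h) - flow t))
        \<le> norm (min_velocity (drift t) (flow t)) + r"
      unfolding eventually_at_right_field using d(1) by (intro exI[of _ "min d 1"]) auto
  next
    fix w p and r :: real assume p: "p \<in> sub w" and r: "0 < r"
    define c where "c = (drift t - p) \<bullet> (flow t - w) + r"
    obtain d where d: "d > 0" "\<And>s. t0 \<le> s \<Longrightarrow> \<bar>s - t\<bar> < d
        \<Longrightarrow> (B s (flow s) - p) \<bullet> (flow s - w) \<le> c"
      using pairing_near[of t r p w] t r by (auto simp: c_def)
    have "((1 / h) *\<^sub>R (flow (t + h) - flow t)) \<bullet> (flow t - w)
        \<le> c" if h: "0 < h" "h < min d 1" for h
    proof -
      define q where "q = (1 / h) *\<^sub>R (flow (t + h) - flow t)"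
      have "(norm (flow (t + h) - w))\<^sup>2 \<le> (norm (flow t - w))\<^sup>2 + 2 * c * (t
          + h - t)"
        by (rule flow_integral_ineq[OF p]) (use t h d in auto)
      moreover have "flow (t + h) - w = (flow t - w) + h *\<^sub>R q" using h by (simp add: q_def)
      then have "(norm (flow (t + h) - w))\<^sup>2 = (norm (flow t - w))\<^sup>2
          + 2 * h * ((flow t - w) \<bullet> q) + h\<^sup>2 * (norm q)\<^sup>2"
        by (simp only: norm_add_scaleR_sq)
      moreover have "0 \<le> h\<^sup>2 * (norm q)\<^sup>2" by simp
      ultimately have "2 * h * ((flow t - w) \<bullet> q) \<le> 2 * c * (t + h - t)" by linarith
      then have "h * ((flow t - w) \<bullet> q) \<le> h * c" by (simp add: mult.commute)
      then show ?thesis using h by (simp add: inner_commute flip: q_def)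
    qed
    then show "\<forall>\<^sub>F h in at_right 0. ((1 / h) *\<^sub>R (flow (t
        + h) - flow t)) \<bullet> (flow t - w) \<le> c"
      unfolding eventually_at_right_field c_def[symmetric] using d(1) by (intro exI[of _ "min d 1"]) auto
  }
qed

text \<open>The linear inequality now starts from \<open>t - h\<close>, so its bound involves
  \<open>velocity (t - h)\<close>; upper semicontinuity of the speed from the left ties this to
  \<open>velocity t\<close>.\<close>

lemma left_derivative:
  assumes t: "t0 < t"
    and vt: "\<And>r. 0 < r \<Longrightarrow> \<forall>\<^sub>F h in at_right 0. norm (velocity (t - h)) \<le> norm (velocity t) + r"
  shows "((\<lambda>h. (1 / h) *\<^sub>R (flow t - flow (t - h))) \<longlongrightarrow> velocity t) (at_right 0)"
proof -
  obtain R where "gradient_flow_on D g B L t0 z0 t R" using flow_on[OF t] by auto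
  then interpret gradient_flow_on D g B L t0 z0 t R .
  have h1: "\<forall>\<^sub>F h in at_right 0. norm ((1 / h) *\<^sub>R (flow t - flow (t - h)))
      \<le> norm (velocity t) + r"
    if r: "0 < r" for r
  proof -
    obtain d where d: "d > 0" "\<And>s. t0 \<le> s \<Longrightarrow> \<bar>s - t\<bar> < d
        \<Longrightarrow> norm (drift s - drift t) < r / 3"
      using drift_near[of t "r / 3"] t r by auto
    have "\<forall>\<^sub>F h in at_right 0. h \<in> {0<..<min d (t - t0)}"
      by (rule eventually_at_right_real) (use d t in auto)
    moreover have "\<forall>\<^sub>F h in at_right 0. norm (velocity (t - h))
        \<le> norm (velocity t) + r / 3"
      using vt[of "r / 3"] r by simp
    ultimately show ?thesis
    proof eventually_elim
      case (elim h)
      then have h: "0 < h" "h < d" "t0 < t - h" by auto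
      have "norm (flow t - flow (t - h)) \<le> norm (flow (t - h) - flow (t - h))
          + (norm (velocity t) + r) * (t - (t - h))"
      proof (rule flow_dist_ineq[OF xi_sub(1)[OF h(3)]])
        fix q assume q: "t - h \<le> q" "q \<le> t"
        have eq: "drift q - xi (t - h) = (drift q - drift t) + (- (drift (t - h) - drift t)
            + velocity (t - h))"
          by (simp add: xi_def)
        have "norm (drift q - xi (t - h)) \<le> norm (drift q - drift t)
            + (norm (drift (t - h) - drift t) + norm (velocity (t - h)))"
          unfolding eq
          using norm_triangle_ineq[of "- (drift (t - h) - drift t)" "velocity (t - h)", unfolded norm_minus_cancel]
          by (intro order_trans[OF norm_triangle_ineq] add_left_mono)
            (simp only: norm_minus_cancel order_refl)
        also have "\<dots> \<le> norm (velocity t) + r"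
        proof -
          have "t0 \<le> q" "\<bar>q - t\<bar> < d" "t0 \<le> t - h" "\<bar>t - h - t\<bar> < d"
            using q h by linarith+
          then have "norm (drift q - drift t) < r / 3" "norm (drift (t - h) - drift t) < r / 3"
            using d(2) by blast+
          with elim(2) show ?thesis by linarith
        qed
        finally show "norm (B q (flow q) - xi (t - h)) \<le> norm (velocity t) + r"
          by (simp add: drift_def)
      qed (use t h in auto)
      then show ?case using h by (simp add: pos_divide_le_eq mult.commute)
    qed
  qed
  show ?thesis
    unfolding velocity_def
  proof (rule tendsto_min_velocity[OF xi_sub(1)[OF t]])
    show "\<forall>\<^sub>F h in at_right 0. norm ((1 / h) *\<^sub>R (flow t - flow (t - h)))
        \<le> norm (min_velocity (drift t) (flow t)) + r"
      if "0 < r" for r using h1[OF that] by (simp add: velocity_def)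
    fix w p and r :: real assume p: "p \<in> sub w" and r: "0 < r"
    define c where "c = (drift t - p) \<bullet> (flow t - w) + r / 2"
    obtain d where d: "d > 0" "\<And>s. t0 \<le> s \<Longrightarrow> \<bar>s - t\<bar> < d
        \<Longrightarrow> (B s (flow s) - p) \<bullet> (flow s - w) \<le> c"
      using pairing_near[of t "r / 2" p w] t r by (auto simp: c_def)
    \<comment> \<open>Looking backwards, the quadratic term of the expansion has the unfavourable
      sign; for \<open>h < k\<close> the quantity h |q|^2 stays below \<open>r\<close>.\<close>
    define k where "k = r / (norm (velocity t) + 1)\<^sup>2"
    have nv: "0 < (norm (velocity t) + 1)\<^sup>2"
      using norm_ge_zero[of "velocity t"] by (intro zero_less_power) linarith
    then have k: "0 < k" using r by (simp add: k_def)
    have "\<forall>\<^sub>F h in at_right 0. h \<in> {0<..<min (min d k) (t - t0)}"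
      by (rule eventually_at_right_real) (use d k t in auto)
    with h1[OF zero_less_one]
    show "\<forall>\<^sub>F h in at_right 0. ((1 / h) *\<^sub>R (flow t - flow (t - h))) \<bullet> (flow t - w) \<le> (drift t - p) \<bullet> (flow t - w) + r"
    proof eventually_elim
      case (elim h)
      define q where "q = (1 / h) *\<^sub>R (flow t - flow (t - h))"
      have h: "0 < h" "h < d" "h < k" "t0 < t - h" using elim by auto
      have nq: "norm q \<le> norm (velocity t) + 1" using elim(1) by (simp only: q_def)
      have "(norm (flow t - w))\<^sup>2 \<le> (norm (flow (t - h) - w))\<^sup>2
          + 2 * c * (t - (t - h))"
        by (rule flow_integral_ineq[OF p]) (use t h d in auto)
      moreover have "flow (t - h) - w = (flow t - w) + (- h) *\<^sub>R q"
        using h by (simp add: q_def)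
      then have "(norm (flow (t - h) - w))\<^sup>2
          = (norm (flow t - w))\<^sup>2 + 2 * (- h) * ((flow t - w) \<bullet> q) + (- h)\<^sup>2 * (norm q)\<^sup>2"
        by (simp only: norm_add_scaleR_sq)
      moreover have "h * (h * (norm q)\<^sup>2) \<le> h * r"
      proof (intro mult_left_mono)
        have "h * (norm q)\<^sup>2 \<le> k * (norm (velocity t) + 1)\<^sup>2"
          using h nq by (intro mult_mono power_mono) auto
        then show "h * (norm q)\<^sup>2 \<le> r" using nv by (simp add: k_def)
      qed (use h in simp)
      ultimately have "2 * h * ((flow t - w) \<bullet> q) \<le> 2 * c * h + h * r"
        by (simp add: power2_eq_square)
      then have "h * ((flow t - w) \<bullet> q) \<le> h * (c + r / 2)"
        by (simp add: algebra_simps)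
      then have "(flow t - w) \<bullet> q \<le> c + r / 2" using h by simp
      then show ?case by (simp add: c_def inner_commute flip: q_def)
    qed
  qed
qed

text \<open>Monotonicity of \<open>xi s\<close> against each graph point supplies the testing
  inequality, and continuity of the speed the length bound; together they upgrade convergence of
  norms to convergence of vectors.\<close>

lemma velocity_continuous:
  assumes t: "t0 < t" and vt: "isCont (\<lambda>t. norm (velocity t)) t"
  shows "isCont velocity t"
  unfolding isCont_def
proof (subst velocity_def, rule tendsto_min_velocity[OF xi_sub(1)[OF t]])
  have bnd: "\<forall>\<^sub>F s in at t. norm (velocity s) < norm (velocity t)
      + r" if "0 < r" for r
    using vt that unfolding isCont_def by (intro order_tendstoD(2)) auto
  show "\<forall>\<^sub>F s in at t. norm (velocity s)
      \<le> norm (min_velocity (drift t) (flow t)) + r" if "0 < r" for r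
    using bnd[OF that] by eventually_elim (simp add: velocity_def)
  have near: "\<forall>\<^sub>F s in at t. t0 < s"
    using t by (intro order_tendstoD(1)[OF tendsto_ident_at])
  fix w p and r :: real assume p: "p \<in> sub w" and r: "0 < r"
  obtain d where d: "d > 0" "\<And>s. t0 \<le> s
      \<Longrightarrow> \<bar>s - t\<bar> < d \<Longrightarrow>
      (B s (flow s) - p) \<bullet> (flow s - w) \<le> (drift t - p) \<bullet> (flow t - w) + r / 2"
    using pairing_near[of t "r / 2" p w] t r by auto
  have "isCont flow t" using continuous_on_interior[OF flow_cont] t by simp
  then have "((\<lambda>s. (norm (velocity t)
      + 1) * norm (flow t - flow s)) \<longlongrightarrow> (norm (velocity t) + 1) * norm (flow t - flow t)) (at t)"
    unfolding isCont_def by (intro tendsto_intros)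
  then have "\<forall>\<^sub>F s in at t. (norm (velocity t) + 1) * norm (flow t - flow s) < r / 2"
    by (rule order_tendstoD) (use r in simp)
  moreover have "\<forall>\<^sub>F s in at t. \<bar>s - t\<bar> < d"
    unfolding eventually_at using d(1) by (intro exI[of _ d]) (auto simp: dist_real_def)
  ultimately show "\<forall>\<^sub>F s in at t. velocity s \<bullet> (flow t - w)
      \<le> (drift t - p) \<bullet> (flow t - w) + r"
    using near bnd[of 1, simplified]
  proof eventually_elim
    case (elim s)
    have "0 \<le> (xi s - p) \<bullet> (flow s - w)" by (rule sub_mono[OF xi_sub(1)[OF elim(3)] p])
    then have "velocity s \<bullet> (flow s - w) \<le> (B s (flow s) - p) \<bullet> (flow s - w)"
      by (simp add: xi_def drift_def inner_diff_left)
    also have "\<dots> \<le> (drift t - p) \<bullet> (flow t - w) + r / 2"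
      using d(2)[of s] elim by simp
    finally have 1: "velocity s \<bullet> (flow s - w) \<le> (drift t - p) \<bullet> (flow t - w)
        + r / 2" .
    have "velocity s \<bullet> (flow t - flow s) \<le> norm (velocity s) * norm (flow t - flow s)"
      by (rule norm_cauchy_schwarz)
    also have "\<dots> \<le> (norm (velocity t) + 1) * norm (flow t - flow s)"
      using elim(4) by (intro mult_right_mono) auto
    finally have "velocity s \<bullet> (flow t - flow s) \<le> r / 2" using elim(1) by simp
    with 1 show ?case by (simp add: inner_diff_right)
  qed
qed

lemma flow_deriv:
  assumes t: "t0 < t" and vt: "isCont (\<lambda>t. norm (velocity t)) t"
  shows "(flow has_vector_derivative velocity t) (at t)"
    and "((\<lambda>h. (1 / h) *\<^sub>R (flow (t
        + h) - flow t)) \<longlongrightarrow> velocity t) (at 0)"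
proof -
  have "((\<lambda>h. norm (velocity (t - h))) \<longlongrightarrow> norm (velocity t)) (at_right 0)"
  proof (rule isCont_tendsto_compose[OF vt])
    have "((\<lambda>h. t - h) \<longlongrightarrow> t - 0) (at_right 0)" by (intro tendsto_intros)
    then show "((\<lambda>h. t - h) \<longlongrightarrow> t) (at_right 0)" by simp
  qed
  then have *: "\<forall>\<^sub>F h in at_right 0. norm (velocity (t - h)) < norm (velocity t)
      + r" if "0 < r" for r
    by (rule order_tendstoD) (use that in simp)
  have "((\<lambda>h. (1 / h) *\<^sub>R (flow t - flow (t - h))) \<longlongrightarrow> velocity t) (at_right 0)"
  proof (rule left_derivative[OF t])
    show "\<forall>\<^sub>F h in at_right 0. norm (velocity (t - h)) \<le> norm (velocity t)
        + r" if "0 < r" for r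
      using *[OF that] by (rule eventually_mono) simp
  qed
  from has_vector_derivative_quotients[OF right_derivative[OF t] this]
  show "(flow has_vector_derivative velocity t) (at t)"
    and "((\<lambda>h. (1 / h) *\<^sub>R (flow (t
        + h) - flow t)) \<longlongrightarrow> velocity t) (at 0)" .
qed

text \<open>The linearisation error \<open>b\<close> is nonnegative and at most the pairing of the
  increments of \<open>xi\<close> and \<open>flow\<close>, by the subgradient inequality at both
  times. Continuity of \<open>xi\<close> makes it o(h).\<close>

lemma g_deriv:
  assumes t: "t0 < t" and vt: "isCont (\<lambda>t. norm (velocity t)) t"
  shows "((\<lambda>s. g (flow s)) has_real_derivative (xi t \<bullet> velocity t)) (at t)"
proof -
  let ?q = "\<lambda>h. (1 / h) *\<^sub>R (flow (t + h) - flow t)"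
  have "isCont drift t" using continuous_on_interior[OF drift_cont] t by simp
  then have xi: "isCont xi t"
    unfolding xi_def using velocity_continuous[OF assms] by (intro continuous_intros)
  have q: "(?q \<longlongrightarrow> velocity t) (at 0)" by (rule flow_deriv(2)[OF assms])
  have xih: "((\<lambda>h. xi (t + h)) \<longlongrightarrow> xi t) (at 0)"
  proof (rule isCont_tendsto_compose[OF xi])
    have "((\<lambda>h. t + h) \<longlongrightarrow> t + 0) (at 0)" by (intro tendsto_intros)
    then show "((\<lambda>h. t + h) \<longlongrightarrow> t) (at 0)" by simp
  qed
  have "((\<lambda>h. (g (flow (t
      + h)) - g (flow t)) / h - xi t \<bullet> ?q h) \<longlongrightarrow> 0) (at 0)"
  proof (rule Lim_null_comparison)
    have "((\<lambda>h. norm (xi (t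
        + h) - xi t) * norm (?q h)) \<longlongrightarrow> norm (xi t - xi t) * norm (velocity t)) (at 0)"
      by (intro tendsto_intros xih q)
    then show "((\<lambda>h. norm (xi (t
        + h) - xi t) * norm (?q h)) \<longlongrightarrow> 0) (at 0)"
      by simp
    have "norm ((g (flow (t + h)) - g (flow t)) / h - xi t \<bullet> ?q h) \<le> norm (xi (t
        + h) - xi t) * norm (?q h)"
      if h: "h \<noteq> 0" "\<bar>h\<bar> < t - t0" for h
    proof -
      have th: "t0 < t + h" using h by linarith
      define b where "b = g (flow (t + h)) - g (flow t) - xi t \<bullet> (flow (t + h) - flow t)"
      have "0 \<le> b" using sub_ineq[OF xi_sub(1)[OF t] flow_D[of "t + h"]] th by (simp add: b_def)
      moreover have "b \<le> (xi (t + h) - xi t) \<bullet> (flow (t + h) - flow t)"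
        using sub_ineq[OF xi_sub(1)[OF th] flow_D[of t]] t
        by (simp add: b_def inner_diff_left inner_diff_right)
      ultimately have "\<bar>b\<bar> \<le> norm (xi (t + h) - xi t) * norm (flow (t + h) - flow t)"
        using norm_cauchy_schwarz[of "xi (t + h) - xi t" "flow (t + h) - flow t"] by linarith
      then have "\<bar>b\<bar> / \<bar>h\<bar> \<le> norm (xi (t + h) - xi t) * norm (flow (t
          + h) - flow t) / \<bar>h\<bar>"
        by (intro divide_right_mono) auto
      moreover have "(g (flow (t + h)) - g (flow t)) / h - xi t \<bullet> ?q h = b / h"
        by (simp add: b_def diff_divide_distrib)
      ultimately show ?thesis by simp
    qed
    then show "\<forall>\<^sub>F h in at 0. norm ((g (flow (t
        + h)) - g (flow t)) / h - xi t \<bullet> ?q h)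
        \<le> norm (xi (t + h) - xi t) * norm (?q h)"
      unfolding eventually_at using t by (intro exI[of _ "t - t0"]) (auto simp: dist_real_def)
  qed
  from tendsto_add[OF this tendsto_inner[OF tendsto_const q, of "xi t"]]
  show ?thesis by (simp add: DERIV_def)
qed

text \<open>Divide \<open>flow_shift\<close> by the square of \<open>h\<close>; only right
  derivatives occur, so the estimate holds at every time after \<open>t0\<close>.\<close>

lemma velocity_decay:
  assumes "gradient_flow_on D g B L t0 z0 T R" and st: "t0 < s" "s \<le> t" "t < T"
  shows "(norm (velocity t))\<^sup>2 \<le> exp ((2 * L
      + 1) * (t - s)) * ((norm (velocity s))\<^sup>2 + (L * R)\<^sup>2 * (t - s))"
proof -
  interpret gradient_flow_on D g B L t0 z0 T R by fact
  let ?q = "\<lambda>r h. (norm ((1 / h) *\<^sub>R (flow (r + h) - flow r)))\<^sup>2"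
  show ?thesis
  proof (rule tendsto_le[OF trivial_limit_at_right_real])
    show "(?q t \<longlongrightarrow> (norm (velocity t))\<^sup>2) (at_right 0)"
      by (intro tendsto_intros right_derivative) (use st in auto)
    show "((\<lambda>h. exp ((2 * L + 1) * (t - s)) * (?q s h
        + (L * R)\<^sup>2 * (t - s))) \<longlongrightarrow>
        exp ((2 * L + 1) * (t - s)) * ((norm (velocity s))\<^sup>2 + (L * R)\<^sup>2 * (t - s))) (at_right 0)"
      by (intro tendsto_intros right_derivative) (use st in auto)
    have "?q t h \<le> exp ((2 * L + 1) * (t - s)) * (?q s h + (L * R)\<^sup>2 * (t - s))"
      if h: "0 < h" "h < T - t" for h
    proof -
      have q: "?q r h = (norm (flow (r + h) - flow r))\<^sup>2 / h\<^sup>2" for r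
        using h by (simp add: power_divide)
      have "?q t h \<le> (exp ((2 * L + 1) * (t - s)) *
          ((norm (flow (s + h) - flow s))\<^sup>2 + (L * R)\<^sup>2 * h\<^sup>2 * (t - s))) / h\<^sup>2"
        unfolding q using h st by (intro divide_right_mono flow_shift) auto
      also have "\<dots> = exp ((2 * L + 1) * (t - s)) * (?q s h + (L * R)\<^sup>2 * (t - s))"
        unfolding q using h by (simp add: field_simps)
      finally show ?thesis .
    qed
    then show "\<forall>\<^sub>F h in at_right 0. ?q t h \<le> exp ((2 * L
        + 1) * (t - s)) * (?q s h + (L * R)\<^sup>2 * (t - s))"
      unfolding eventually_at_right_field using st by (intro exI[of _ "T - t"]) auto
  qed
qed

lemma countable_discontinuities:
  "countable {t. t0 < t \<and> \<not> isCont (\<lambda>t. norm (velocity t)) t}"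
proof -
  have "countable {t \<in> {t0<..<T}. \<not> isCont (\<lambda>t. norm (velocity t)) t}" if T: "t0 < T" for T
  proof -
    obtain R where R: "gradient_flow_on D g B L t0 z0 T R" using flow_on[OF T] by auto
    define K M where "K = 2 * L + 1" and "M = (L * R)\<^sup>2"
    define N where "N t = M * t - exp (- (K * (t - t0))) * (norm (velocity t))\<^sup>2" for t
    have K: "0 < K" and M: "0 \<le> M" using L by (auto simp: K_def M_def)
    have "mono_on {t0<..<T} N"
    proof (rule mono_onI)
      fix s t assume "s \<in> {t0<..<T}" "t \<in> {t0<..<T}" "s \<le> t"
      then have st: "t0 < s" "s \<le> t" "t < T" by auto
      have "exp (- (K * (t - t0))) * (norm (velocity t))\<^sup>2
          \<le> exp (- (K * (t - t0))) * (exp (K * (t - s)) * ((norm (velocity s))\<^sup>2 + M * (t - s)))"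
        unfolding K_def M_def by (intro mult_left_mono velocity_decay[OF R st]) auto
      also have "\<dots> = exp (- (K * (s - t0))) * ((norm (velocity s))\<^sup>2 + M * (t - s))"
        unfolding mult.assoc[symmetric] exp_add[symmetric] by (simp add: algebra_simps)
      also have "\<dots> \<le> exp (- (K * (s - t0))) * (norm (velocity s))\<^sup>2
          + 1 * (M * (t - s))"
        unfolding distrib_left using K M st by (intro add_left_mono mult_right_mono) auto
      finally show "N s \<le> N t" by (simp add: N_def algebra_simps)
    qed
    then have c: "countable {t \<in> {t0<..<T}. \<not> isCont N t}"
      by (intro mono_on_ctble_discont_open) auto
    \<comment> \<open>Solving the definition of \<open>N\<close> for the speed expresses it
      continuously through \<open>N\<close> and t.\<close>
    have N_cont: "isCont (\<lambda>t. norm (velocity t)) t" if N: "isCont N t" for t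
    proof -
      have "norm (velocity t) = sqrt (exp (K * (t - t0)) * (M * t - N t))" for t
        by (simp add: N_def flip: mult.assoc exp_add)
      moreover have "isCont (\<lambda>t. sqrt (exp (K * (t - t0)) * (M * t - N t))) t"
        by (intro continuous_intros N)
      ultimately show ?thesis by simp
    qed
    show ?thesis by (rule countable_subset[OF _ c]) (use N_cont in auto)
  qed
  then have "countable (\<Union>n::nat. {t \<in> {t0<..<t0
      + real (Suc n)}. \<not> isCont (\<lambda>t. norm (velocity t)) t})"
    by (intro countable_UN) auto
  moreover have "{t. t0 < t \<and> \<not> isCont (\<lambda>t. norm (velocity t)) t}
      \<subseteq> (\<Union>n::nat. {t \<in> {t0<..<t0 + real (Suc n)}. \<not> isCont (\<lambda>t. norm (velocity t)) t})"
  proof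
    fix t assume t: "t \<in> {t. t0 < t \<and> \<not> isCont (\<lambda>t. norm (velocity t)) t}"
    obtain n where "t - t0 < real n" using reals_Archimedean2 by blast
    then show "t \<in> (\<Union>n::nat. {t \<in> {t0<..<t0
        + real (Suc n)}. \<not> isCont (\<lambda>t. norm (velocity t)) t})"
      using t by (intro UN_I[of n]) auto
  qed
  ultimately show ?thesis by (rule countable_subset[rotated])
qed

end

section \<open>Absolutely continuous functions\<close>

lemma abs_continuous_on_subset:
  "abs_continuous_on S f \<Longrightarrow> S' \<subseteq> S
      \<Longrightarrow> abs_continuous_on S' f"
  unfolding abs_continuous_on_def by (meson subset_iff)

text \<open>Serves for components, scalar products and weighted squared distances: their increments
  are controlled by those of \<open>f\<close> and of the variable together.\<close>

lemma abs_continuous_on_Lipschitz_comb: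
  fixes f :: "real \<Rightarrow> 'a::metric_space" and r :: "real \<Rightarrow> 'b::metric_space"
  assumes f: "abs_continuous_on S f" and M: "0 < M"
    and r: "\<And>x y. x \<in> S \<Longrightarrow> y \<in> S \<Longrightarrow> dist (r x) (r y)
        \<le> M * (dist (f x) (f y) + \<bar>x - y\<bar>)"
  shows "abs_continuous_on S r"
  unfolding abs_continuous_on_def
proof (intro allI impI)
  fix e :: real assume e: "0 < e"
  then have "0 < e / (2 * M)" using M by simp
  then obtain d where d: "d > 0" "\<And>(n::nat) a b. (\<forall>i<n. a i \<in> S
      \<and> b i \<in> S \<and> a i \<le> b i) \<Longrightarrow>
        disjoint_family_on (\<lambda>i. {a i<..<b i}) {..<n} \<Longrightarrow> (\<Sum>i<n. b i - a i) < d \<Longrightarrow>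
        (\<Sum>i<n. dist (f (a i)) (f (b i))) < e / (2 * M)"
    using f unfolding abs_continuous_on_def by meson
  show "\<exists>\<delta>>0. \<forall>(n::nat) a b. (\<forall>i<n. a i \<in> S \<and> b i \<in> S
      \<and> a i \<le> b i) \<and>
        disjoint_family_on (\<lambda>i. {a i<..<b i}) {..<n} \<and> (\<Sum>i<n. b i - a i) < \<delta> \<longrightarrow>
        (\<Sum>i<n. dist (r (a i)) (r (b i))) < e"
  proof (intro exI[of _ "min d (e / (2 * M))"] conjI allI impI)
    fix n :: nat and a b :: "nat \<Rightarrow> real"
    assume *: "(\<forall>i<n. a i \<in> S \<and> b i \<in> S \<and> a i \<le> b i) \<and>
        disjoint_family_on (\<lambda>i. {a i<..<b i}) {..<n} \<and> (\<Sum>i<n. b i - a i) < min d (e / (2 * M))"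
    have "(\<Sum>i<n. dist (r (a i)) (r (b i))) \<le> (\<Sum>i<n. M * (dist (f (a i)) (f (b i))
        + (b i - a i)))"
    proof (rule sum_mono)
      fix i assume "i \<in> {..<n}"
      then have "a i \<in> S" "b i \<in> S" "a i \<le> b i" using * by auto
      then show "dist (r (a i)) (r (b i)) \<le> M * (dist (f (a i)) (f (b i)) + (b i - a i))"
        using r[of "a i" "b i"] by simp
    qed
    also have "\<dots> = M * ((\<Sum>i<n. dist (f (a i)) (f (b i))) + (\<Sum>i<n. b i - a i))"
      by (simp add: sum.distrib flip: sum_distrib_left)
    also have "\<dots> < M * (e / (2 * M) + e / (2 * M))"
      using * d(2)[of n a b] M by (intro mult_strict_left_mono add_strict_mono) auto
    also have "\<dots> = e" using M by simp
    finally show "(\<Sum>i<n. dist (r (a i)) (r (b i))) < e" .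
  qed (use d \<open>0 < e / (2 * M)\<close> in auto)
qed

text \<open>The definition numbers its intervals, whereas the intervals of a tagged division are
  indexed by the pairs in it; an enumeration of the index set bridges the two.\<close>

lemma abs_continuous_on_finite:
  assumes f: "abs_continuous_on S f" and e: "0 < e"
  shows "\<exists>d>0. \<forall>(I :: 'i set) l u. finite I
      \<longrightarrow> (\<forall>i\<in>I. l i \<in> S \<and> u i \<in> S \<and> l i \<le> u i) \<longrightarrow>
    disjoint_family_on (\<lambda>i. {l i<..<u i}) I \<longrightarrow> (\<Sum>i\<in>I. u i - l i) < d \<longrightarrow>
    (\<Sum>i\<in>I. dist (f (l i)) (f (u i))) < e"
proof -
  obtain d where d: "d > 0" "\<And>(n::nat) a b. (\<forall>i<n. a i \<in> S \<and> b i \<in> S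
      \<and> a i \<le> b i) \<Longrightarrow>
        disjoint_family_on (\<lambda>i. {a i<..<b i}) {..<n} \<Longrightarrow> (\<Sum>i<n. b i - a i) < d \<Longrightarrow>
        (\<Sum>i<n. dist (f (a i)) (f (b i))) < e"
    using f e unfolding abs_continuous_on_def by meson
  show ?thesis
  proof (intro exI[of _ d] conjI allI impI)
    fix I :: "'i set" and l u :: "'i \<Rightarrow> real"
    assume I: "finite I" "\<forall>i\<in>I. l i \<in> S \<and> u i \<in> S \<and> l i \<le> u i"
      "disjoint_family_on (\<lambda>i. {l i<..<u i}) I" "(\<Sum>i\<in>I. u i - l i) < d"
    obtain h where h: "bij_betw h {..<card I} I"
      using ex_bij_betw_nat_finite[OF I(1)] by (auto simp: atLeast0LessThan)
    have hI: "h i \<in> I" if "i < card I" for i using h that by (auto simp: bij_betw_def)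
    have inj: "inj_on h {..<card I}" using h by (simp add: bij_betw_def)
    have "(\<Sum>i<card I. dist (f (l (h i))) (f (u (h i)))) < e"
    proof (rule d(2))
      show "\<forall>i<card I. l (h i) \<in> S \<and> u (h i) \<in> S \<and> l (h i) \<le> u (h i)"
        using hI I(2) by blast
      show "disjoint_family_on (\<lambda>i. {l (h i)<..<u (h i)}) {..<card I}"
        unfolding disjoint_family_on_def
      proof (intro ballI impI)
        fix i j assume ij: "i \<in> {..<card I}" "j \<in> {..<card I}" "i \<noteq> j"
        then have "h i \<noteq> h j" using inj by (auto dest: inj_onD)
        then show "{l (h i)<..<u (h i)} \<inter> {l (h j)<..<u (h j)} = {}"
          using I(3) hI ij unfolding disjoint_family_on_def by blast
      qed
      show "(\<Sum>i<card I. u (h i) - l (h i)) < d"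
        using sum.reindex_bij_betw[OF h, of "\<lambda>i. u i - l i"] I(4) by simp
    qed
    then show "(\<Sum>i\<in>I. dist (f (l i)) (f (u i))) < e"
      using sum.reindex_bij_betw[OF h, of "\<lambda>i. dist (f (l i)) (f (u i))"] by simp
  qed (rule d)
qed

text \<open>Induction with the intervals ordered by left end: all earlier ones end before the new
  one begins. Strictness of \<open>l i < u i\<close> matters, as a degenerate interval could sit
  inside another without violating disjointness.\<close>

lemma sum_mono_on_le:
  fixes H :: "real \<Rightarrow> real"
  assumes H: "\<And>x y. a \<le> x \<Longrightarrow> x \<le> y \<Longrightarrow> H x \<le> H y"
    and I: "finite I"
  shows "(\<forall>i\<in>I. a \<le> l i \<and> l i < u i \<and> u i \<le> b) \<Longrightarrow> a
      \<le> b \<Longrightarrow>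
    disjoint_family_on (\<lambda>i. {l i<..<u i}) I \<Longrightarrow> (\<Sum>i\<in>I. H (u i) - H (l i)) \<le> H b - H a"
  using I
proof (induction I arbitrary: b rule: finite_ranking_induct[where f = l])
  case empty
  then show ?case using H[of a b] by simp
next
  case (insert x I)
  show ?case
  proof (cases "x \<in> I")
    case True
    then show ?thesis using insert by (simp add: insert_absorb)
  next
    case False
    have "u i \<le> l x" if i: "i \<in> I" for i
    proof (rule ccontr)
      assume "\<not> u i \<le> l x"
      moreover have "l i \<le> l x" using insert.hyps(2) i by blast
      moreover have "l x < u x" using insert.prems(1) by simp
      ultimately have "(l x + min (u i) (u x)) / 2 \<in> {l i<..<u i} \<inter> {l x<..<u x}"
        by (auto simp: min_def)
      moreover have "{l i<..<u i} \<inter> {l x<..<u x} = {}"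
        using disjoint_family_onD[OF insert.prems(3), of i x] i False by auto
      ultimately show False by blast
    qed
    then have "(\<Sum>i\<in>I. H (u i) - H (l i)) \<le> H (l x) - H a"
      using insert.prems insert.hyps
      by (intro insert.IH) (auto simp: disjoint_family_on_def)
    moreover have "H (u x) \<le> H b" using insert.prems by (intro H) force+
    ultimately show ?thesis using False insert.hyps(1) by simp
  qed
qed

text \<open>The function \<open>G\<close> may fail to be Lipschitz at the left end point only; there the
  oscillation is controlled by its monotonicity and continuity.\<close>

lemma abs_continuous_on_dominated:
  fixes f :: "real \<Rightarrow> 'a::metric_space" and G :: "real \<Rightarrow> real"
  assumes ab: "a < b" and cont: "continuous_on {a..b} G"
    and dom: "\<And>s t. a \<le> s \<Longrightarrow> s \<le> t \<Longrightarrow> t \<le> b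
        \<Longrightarrow> dist (f s) (f t) \<le> G t - G s"
    and lip: "\<And>c. a < c \<Longrightarrow> c < b
        \<Longrightarrow> \<exists>M. M-lipschitz_on {c..b} G"
  shows "abs_continuous_on {a..b} f"
  unfolding abs_continuous_on_def
proof (intro allI impI)
  fix e :: real assume e: "0 < e"
  have mono: "G s \<le> G t" if "a \<le> s" "s \<le> t" "t \<le> b" for s t
    using dom[OF that] zero_le_dist[of "f s" "f t"] by linarith
  obtain d0 where d0: "d0 > 0" "\<And>x. x \<in> {a..b} \<Longrightarrow> dist x a < d0
      \<Longrightarrow> dist (G x) (G a) < e / 2"
    using cont[unfolded continuous_on_iff, rule_format, of a "e / 2"] ab e by auto
  \<comment> \<open>Left of \<open>c\<close> the total increase of \<open>G\<close> is below e / 2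
    by continuity at \<open>a\<close>; right of it \<open>G\<close> is Lipschitz. The second bound
    in the minimum keeps \<open>c\<close> inside the interval.\<close>
  define c where "c = a + min (d0 / 2) ((b - a) / 2)"
  have c: "a < c" "c < b" using d0 ab by (auto simp: c_def min_def field_simps)
  have Gc: "G c - G a < e / 2"
  proof -
    have "dist c a < d0" using d0(1) ab by (simp add: c_def dist_real_def min_def)
    then have "dist (G c) (G a) < e / 2" using d0(2)[of c] c by simp
    then show ?thesis unfolding dist_real_def by linarith
  qed
  obtain M where M: "M-lipschitz_on {c..b} G" using lip[OF c] by blast
  have M0: "0 \<le> M" using M lipschitz_on_nonneg by blast
  show "\<exists>\<delta>>0. \<forall>(n::nat) l u. (\<forall>i<n. l i \<in> {a..b}
      \<and> u i \<in> {a..b} \<and> l i \<le> u i) \<and>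
        disjoint_family_on (\<lambda>i. {l i<..<u i}) {..<n} \<and> (\<Sum>i<n. u i - l i) < \<delta> \<longrightarrow>
        (\<Sum>i<n. dist (f (l i)) (f (u i))) < e"
  proof (intro exI[of _ "e / (2 * (M + 1))"] conjI allI impI)
    show "0 < e / (2 * (M + 1))" using e M0 by simp
    fix n :: nat and l u :: "nat \<Rightarrow> real"
    assume *: "(\<forall>i<n. l i \<in> {a..b} \<and> u i \<in> {a..b} \<and> l i \<le> u i) \<and>
        disjoint_family_on (\<lambda>i. {l i<..<u i}) {..<n} \<and> (\<Sum>i<n. u i - l i) < e / (2 * (M + 1))"
    let ?m = "\<lambda>x. min x c" and ?M = "\<lambda>x. max x c"
    have split: "dist (f (l i)) (f (u i)) \<le> (G (?m (u i)) - G (?m (l i)))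
        + M * (u i - l i)" if i: "i < n" for i
    proof -
      have lu: "l i \<in> {a..b}" "u i \<in> {a..b}" "l i \<le> u i" using * i by auto
      have "dist (f (l i)) (f (u i)) \<le> G (u i) - G (l i)" using lu by (intro dom) auto
      also have "\<dots> = (G (?m (u i)) - G (?m (l i))) + (G (?M (u i)) - G (?M (l i)))"
        by (simp add: min_def max_def)
      also have "G (?M (u i)) - G (?M (l i)) \<le> M * (?M (u i) - ?M (l i))"
        using lipschitz_onD[OF M, of "?M (u i)" "?M (l i)"] lu c by (auto simp: dist_real_def)
      also have "\<dots> \<le> M * (u i - l i)" using lu M0 by (intro mult_left_mono) auto
      finally show ?thesis by simp
    qed
    have "(\<Sum>i<n. dist (f (l i)) (f (u i))) \<le> (\<Sum>i<n. (G (?m (u i)) - G (?m (l i)))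
        + M * (u i - l i))"
      by (intro sum_mono split) simp
    also have "\<dots> = (\<Sum>i<n. G (?m (u i)) - G (?m (l i))) + M * (\<Sum>i<n. u i - l i)"
      by (simp add: sum.distrib sum_distrib_left)
    \<comment> \<open>Intervals that collapse when cut at \<open>c\<close> contribute 0 and are
      discarded, so that the remaining ones are nondegenerate.\<close>
    also have "(\<Sum>i<n. G (?m (u i)) - G (?m (l i)))
        = (\<Sum>i\<in>{i\<in>{..<n}. ?m (l i) < ?m (u i)}. G (?m (u i)) - G (?m (l i)))"
    proof (rule sum.mono_neutral_right)
      show "\<forall>i\<in>{..<n} - {i\<in>{..<n}. ?m (l i) < ?m (u i)}. G (?m (u i)) - G (?m (l i)) = 0"
      proof
        fix i assume "i \<in> {..<n} - {i\<in>{..<n}. ?m (l i) < ?m (u i)}"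
        then have "\<not> ?m (l i) < ?m (u i)" "l i \<le> u i" using * by auto
        then have "?m (l i) = ?m (u i)" by (auto simp: min_def split: if_splits)
        then show "G (?m (u i)) - G (?m (l i)) = 0" by simp
      qed
    qed auto
    also have "\<dots> \<le> G (min c b) - G (min a b)"
    \<comment> \<open>\<open>G\<close> is known to increase only up to \<open>b\<close>; stopping it
      there makes it monotone on the whole half-line.\<close>
    proof (rule sum_mono_on_le[where H = "\<lambda>x. G (min x b)" and a = a and b = c
          and l = "\<lambda>i. ?m (l i)" and u = "\<lambda>i. ?m (u i)", THEN order_trans[rotated]])
      show "G (min x b) \<le> G (min y b)" if "a \<le> x" "x \<le> y" for x y
        using that ab by (intro mono) auto
      show "\<forall>i\<in>{i\<in>{..<n}. ?m (l i) < ?m (u i)}. a \<le> ?m (l i)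
          \<and> ?m (l i) < ?m (u i) \<and> ?m (u i) \<le> c"
        using * c by auto
      have "disjoint_family_on (\<lambda>i. {l i<..<u i}) {..<n}" using * by blast
      then show "disjoint_family_on (\<lambda>i. {?m (l i)<..<?m (u i)}) {i\<in>{..<n}. ?m (l i) < ?m (u i)}"
        unfolding disjoint_family_on_def by (fastforce simp: min_def split: if_splits)
      have "min (?m (u i)) b = ?m (u i)" "min (?m (l i)) b = ?m (l i)" for i
        using c by auto
      then show "(\<Sum>i\<in>{i\<in>{..<n}. ?m (l i) < ?m (u i)}. G (?m (u i)) - G (?m (l i)))
        \<le> (\<Sum>i\<in>{i\<in>{..<n}. ?m (l i) < ?m (u i)}. G (min (?m (u i)) b) - G (min (?m (l i)) b))"
        by simp
    qed (use c in auto)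
    also have "\<dots> < e / 2" using Gc c ab by (simp add: min_def)
    also have "M * (\<Sum>i<n. u i - l i) \<le> (M + 1) * (e / (2 * (M + 1)))"
      using * M0 by (intro mult_mono sum_nonneg) auto
    also have "\<dots> = e / 2" using M0 by (simp add: field_simps)
    finally show "(\<Sum>i<n. dist (f (l i)) (f (u i))) < e" by simp
  qed
qed

text \<open>The gauge makes every tag outside \<open>N\<close> satisfy the derivative estimate and confines the
  intervals with tag in \<open>N\<close> to an open set of small measure, where absolute continuity applies.\<close>

lemma abs_continuous_FTC:
  fixes f f' :: "real \<Rightarrow> real"
  assumes ab: "a \<le> b" and ac: "abs_continuous_on {a..b} f" and N: "negligible N"
    and f': "\<And>t. t \<in> {a..b} - N
        \<Longrightarrow> (f has_real_derivative f' t) (at t within {a..b})"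
  shows "((\<lambda>t. if t \<in> N then 0 else f' t) has_integral (f b - f a)) {a..b}"
  unfolding has_integral_real
proof (intro allI impI)
  fix e :: real assume e: "0 < e"
  \<comment> \<open>Summed over the division this costs less than e / 2; the added 1 covers the case
    \<open>a = b\<close>.\<close>
  define e1 where "e1 = e / (2 * (b - a + 1))"
  have e1: "0 < e1" using e ab by (simp add: e1_def)
  let ?f' = "\<lambda>t. if t \<in> N then 0 else f' t"
  obtain d where d: "d > 0" "\<And>(I :: (real \<times> real set) set) l u. finite I \<Longrightarrow>
      (\<forall>i\<in>I. l i \<in> {a..b} \<and> u i \<in> {a..b} \<and> l i \<le> u i) \<Longrightarrow>
      disjoint_family_on (\<lambda>i. {l i<..<u i}) I \<Longrightarrow> (\<Sum>i\<in>I. u i - l i) < d \<Longrightarrow>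
      (\<Sum>i\<in>I. dist (f (l i)) (f (u i))) < e / 2"
    using abs_continuous_on_finite[OF ac, of "e / 2", where 'i = "real \<times> real set"] e by auto
  have Nn: "N \<in> null_sets lebesgue" using N by (simp add: negligible_iff_null_sets)
  then have "N \<in> sets lebesgue" by auto
  then obtain U where U: "open U" "N \<subseteq> U" "emeasure lebesgue (U - N) < ennreal d" "U - N \<in> sets lebesgue"
    using sets_lebesgue_outer_open[OF _ d(1)] by (metis fmeasurableD)
  have "emeasure lebesgue U < ennreal d"
    using U emeasure_Diff_null_set[OF Nn, of U] by simp
  then have Ud: "emeasure lborel U < ennreal d"
    using U(1) by simp
  have "\<exists>r>0. x \<in> {a..b} - N
      \<longrightarrow> (\<forall>y\<in>{a..b}. \<bar>y - x\<bar> < r \<longrightarrow> \<bar>f y - f x - f' x * (y - x)\<bar> \<le> e1 * \<bar>y - x\<bar>)" for x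
    using f'[of x, unfolded has_field_derivative_def has_derivative_within_alt] e1
    by (cases "x \<in> {a..b} - N") (auto intro: exI[of _ 1])
  then obtain r where r: "\<And>x. 0 < r x" "\<And>x y. x \<in> {a..b} - N
      \<Longrightarrow> y \<in> {a..b} \<Longrightarrow> \<bar>y - x\<bar> < r x \<Longrightarrow>
      \<bar>f y - f x - f' x * (y - x)\<bar> \<le> e1 * \<bar>y - x\<bar>"
    by metis
  define \<gamma> where "\<gamma> x = (if x \<in> N then U else ball x (r x))" for x
  show "\<exists>\<gamma>. gauge \<gamma> \<and> (\<forall>\<D>. \<D> tagged_division_of {a..b}
      \<and> \<gamma> fine \<D> \<longrightarrow>
        norm ((\<Sum>(x, k)\<in>\<D>. measure lborel k *\<^sub>R ?f' x) - (f b - f a)) < e)"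
  proof (intro exI[of _ \<gamma>] conjI allI impI)
    show "gauge \<gamma>" using U r(1) by (auto simp: gauge_def \<gamma>_def)
    fix \<D> assume D: "\<D> tagged_division_of {a..b} \<and> \<gamma> fine \<D>"
    then have td: "\<D> tagged_division_of {a..b}" by blast
    note tdD = tagged_division_ofD[OF td]
    let ?l = "\<lambda>(x, K). Inf K" and ?u = "\<lambda>(x, K). Sup K"
    have K: "K = {Inf K..Sup K}" "Inf K \<le> x" "x \<le> Sup K" "a \<le> Inf K" "Sup K \<le> b"
        "measure lborel K = Sup K - Inf K" "K \<subseteq> \<gamma> x"
      if xK: "(x, K) \<in> \<D>" for x K
    proof -
      obtain c d where cd: "K = {c..d}" using tdD(4)[OF xK] by auto
      have "c \<le> x" "x \<le> d" using tdD(2)[OF xK] cd by auto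
      moreover have "{c..d} \<subseteq> {a..b}" using tdD(3)[OF xK] cd by simp
      ultimately show "K = {Inf K..Sup K}" "Inf K \<le> x" "x \<le> Sup K" "a \<le> Inf K" "Sup K
          \<le> b"
        "measure lborel K = Sup K - Inf K" using cd by auto
      show "K \<subseteq> \<gamma> x" using D xK by (auto simp: fine_def)
    qed
    let ?t = "\<lambda>(x, K). measure lborel K *\<^sub>R ?f' x - (f (Sup K) - f (Inf K))"
    define D1 where "D1 = {(x, K) \<in> \<D>. x \<notin> N}"
    define D2 where "D2 = {(x, K) \<in> \<D>. x \<in> N}"
    have fin: "finite D1" "finite D2" "D1 \<inter> D2 = {}" "\<D> = D1 \<union> D2"
      using tdD(1) by (auto simp: D1_def D2_def intro: finite_subset[rotated])
    have "(\<Sum>(x, K)\<in>\<D>. measure lborel K *\<^sub>R ?f' x) - (f b - f a) = sum ?t \<D>"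
      unfolding additive_tagged_division_1[OF ab td, symmetric]
      by (simp add: split_def flip: sum_subtractf)
    also have "\<dots> = sum ?t D1 + sum ?t D2"
      unfolding fin(4) by (rule sum.union_disjoint) (use fin in auto)
    finally have eq: "(\<Sum>(x, K)\<in>\<D>. measure lborel K *\<^sub>R ?f' x) - (f b - f a)
        = sum ?t D1 + sum ?t D2" .
    have "norm (sum ?t D1) \<le> (\<Sum>(x, K)\<in>D1. e1 * measure lborel K)"
    proof (rule sum_norm_le)
      fix xK assume "xK \<in> D1"
      then obtain x K where xK: "xK = (x, K)" "(x, K) \<in> \<D>" "x \<notin> N"
        by (auto simp: D1_def)
      note KK = K[OF xK(2)]
      have ball: "K \<subseteq> ball x (r x)" using KK(7) xK(3) by (simp add: \<gamma>_def)
      have x: "x \<in> {a..b} - N" using KK xK(3) by auto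
      have "Inf K \<in> K" "Sup K \<in> K"
        using KK(1-3) by (metis atLeastAtMost_iff order_refl order_trans)+
      then have n: "\<bar>Inf K - x\<bar> < r x" "\<bar>Sup K - x\<bar> < r x"
        using ball by (auto simp: dist_real_def abs_minus_commute subset_iff)
      \<comment> \<open>Straddle estimate: the tag lies between the end points, so the two one-sided
        errors add up to \<open>e1\<close> times the length.\<close>
      have "\<bar>f (Inf K) - f x - f' x * (Inf K - x)\<bar> \<le> e1 * \<bar>Inf K - x\<bar>"
        "\<bar>f (Sup K) - f x - f' x * (Sup K - x)\<bar> \<le> e1 * \<bar>Sup K - x\<bar>"
        by (rule r(2)[OF x]; use KK n in auto)+
      moreover have "\<bar>Inf K - x\<bar> = x - Inf K" "\<bar>Sup K - x\<bar> = Sup K - x"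
        using KK(2,3) by auto
      ultimately have "\<bar>(Sup K - Inf K) * f' x - (f (Sup K) - f (Inf K))\<bar>
          \<le> e1 * (Sup K - Inf K)"
        by (simp add: algebra_simps abs_le_iff) 
      then show "norm (?t xK) \<le> (case xK of (x, K) \<Rightarrow> e1 * measure lborel K)"
        using xK KK(6) by simp
    qed
    also have "\<dots> = e1 * (\<Sum>(x, K)\<in>D1. measure lborel K)"
      by (simp add: sum_distrib_left split_def)
    also have "\<dots> \<le> e1 * (\<Sum>(x, K)\<in>\<D>. measure lborel K)"
      using e1 tdD(1) fin by (intro mult_left_mono sum_mono2) auto
    also have "(\<Sum>(x, K)\<in>\<D>. measure lborel K) = b - a"
      using additive_content_tagged_division[of \<D> a b] td ab by simp
    also have "e1 * (b - a) < e / 2"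
    proof -
      have "e1 * (b - a) < e1 * (b - a + 1)" using e1 by simp
      also have "\<dots> = e / 2" using ab by (simp add: e1_def field_simps)
      finally show ?thesis .
    qed
    finally have S1: "norm (sum ?t D1) < e / 2" .
    \<comment> \<open>For tags in \<open>N\<close> the integrand is 0 and only increments of
      \<open>f\<close> remain, over disjoint intervals inside \<open>U\<close>.\<close>
    have "norm (sum ?t D2) \<le> (\<Sum>i\<in>D2. dist (f (?l i)) (f (?u i)))"
      by (rule sum_norm_le) (auto simp: D2_def dist_real_def)
    also have "\<dots> < e / 2"
    proof (rule d(2))
      show "\<forall>i\<in>D2. ?l i \<in> {a..b} \<and> ?u i \<in> {a..b} \<and> ?l i \<le> ?u i"
        using K by (fastforce simp: D2_def)
      show dis: "disjoint_family_on (\<lambda>i. {?l i<..<?u i}) D2"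
        unfolding disjoint_family_on_def
      proof (intro ballI impI)
        fix i j assume ij: "i \<in> D2" "j \<in> D2" "i \<noteq> j"
        obtain x K y M where *: "i = (x, K)" "j = (y, M)" by (cases i, cases j) auto
        have xy: "(x, K) \<in> \<D>" "(y, M) \<in> \<D>" using ij * by (auto simp: D2_def)
        have "interior K \<inter> interior M = {}" using tdD(5)[OF xy] ij * by auto
        moreover have "interior K = {Inf K<..<Sup K}" "interior M = {Inf M<..<Sup M}"
          using K(1)[OF xy(1)] K(1)[OF xy(2)] by (metis interior_atLeastAtMost_real)+
        ultimately show "{?l i<..<?u i} \<inter> {?l j<..<?u j} = {}" using * by simp
      qed
      have lu: "?l i \<le> ?u i" "{?l i<..<?u i} \<subseteq> U" if i: "i \<in> D2" for i
      proof -
        obtain x K where xK: "i = (x, K)" "(x, K) \<in> \<D>" "x \<in> N"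
          using i by (auto simp: D2_def)
        have "{Inf K<..<Sup K} \<subseteq> K"
          using K(1)[OF xK(2)] by (metis greaterThanLessThan_subseteq_atLeastAtMost_iff order_refl)
        also have "K \<subseteq> U" using K(7)[OF xK(2)] xK(3) by (simp add: \<gamma>_def)
        finally show "{?l i<..<?u i} \<subseteq> U" using xK by simp
        show "?l i \<le> ?u i" using K(2,3)[OF xK(2)] xK(1) by simp
      qed
      have "ennreal (\<Sum>i\<in>D2. ?u i - ?l i) = (\<Sum>i\<in>D2. ennreal (?u i - ?l i))"
        using lu(1) by (intro sum_ennreal[symmetric]) (force simp: algebra_simps)
      also have "\<dots> = (\<Sum>i\<in>D2. emeasure lborel {?l i<..<?u i})"
        using lu(1) by (intro sum.cong refl) (simp add: emeasure_lborel_Ioo)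
      also have "\<dots> = emeasure lborel (\<Union>i\<in>D2. {?l i<..<?u i})"
        by (rule sum_emeasure) (use dis fin in auto)
      also have "\<dots> \<le> emeasure lborel U" using lu(2) U(1) by (intro emeasure_mono) auto
      also note Ud
      finally show "(\<Sum>i\<in>D2. ?u i - ?l i) < d" by (meson ennreal_leI not_less)
    qed (rule fin)
    finally show "norm ((\<Sum>(x, K)\<in>\<D>. measure lborel K *\<^sub>R ?f' x) - (f b - f a)) < e"
      unfolding eq using S1 norm_triangle_ineq[of "sum ?t D1" "sum ?t D2"] by linarith
  qed
qed

section \<open>Measurability and square integrability\<close>

lemma measurable_on_Ioo_limit:
  fixes u :: "nat \<Rightarrow> real \<Rightarrow> 'a::real_normed_vector"
  assumes u: "\<And>n. continuous_on UNIV (u n)"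
    and lim: "\<And>t. a < t \<Longrightarrow> t < b \<Longrightarrow> (\<lambda>n. u n t)
        \<longlonglongrightarrow> F t"
  shows "F measurable_on {a<..<b}"
  unfolding measurable_on_def
proof (intro exI conjI allI impI)
  \<comment> \<open>Continuous cut-offs increasing to the indicator of the open interval; the
    approximants must be continuous on the line and tend to 0 outside.\<close>
  define h where "h n t = min 1 (real n * max 0 (min (t - a) (b - t)))" for n t
  show "negligible {}" by simp
  show "continuous_on UNIV (\<lambda>t. h n t *\<^sub>R u n t)" for n
    unfolding h_def by (intro continuous_intros u)
  fix t
  show "(\<lambda>n. h n t *\<^sub>R u n t)
      \<longlonglongrightarrow> (if t \<in> {a<..<b} then F t else 0)"
  proof (cases "t \<in> {a<..<b}")
    case True
    define m where "m = min (t - a) (b - t)"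
    have m: "0 < m" using True by (simp add: m_def)
    obtain N where N: "1 < real N * m" using m reals_Archimedean3 by blast
    have "h n t = 1" if "n \<ge> N" for n
    proof -
      have "real N * m \<le> real n * m" using that m by (intro mult_right_mono) auto
      with N have "1 \<le> real n * m" by linarith
      then show ?thesis using m by (simp add: h_def flip: m_def)
    qed
    then have "(\<lambda>n. h n t) \<longlonglongrightarrow> 1"
      by (intro tendsto_eventually) (auto simp: eventually_sequentially)
    from tendsto_scaleR[OF this lim[of t]] show ?thesis using True by simp
  next
    case False
    then have "min (t - a) (b - t) \<le> 0" by auto
    then have "h n t = 0" for n by (simp add: h_def max_absorb1)
    then show ?thesis unfolding if_not_P[OF False] by simp
  qed
qed

lemma square_integrable_on_compose:
  fixes F :: "real \<Rightarrow> 'a::real_normed_vector" and k :: "'a \<Rightarrow> 'b::real_normed_vector"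
  assumes F: "square_integrable_on F S" and k: "bounded_linear k"
  shows "square_integrable_on (\<lambda>t. k (F t)) S"
proof -
  interpret bounded_linear k by (rule k)
  obtain K where K: "0 < K" "\<And>x. norm (k x) \<le> norm x * K" using pos_bounded by blast
  have "(k \<circ> F) measurable_on S"
    using F by (intro measurable_on_compose_continuous_0)
      (auto simp: square_integrable_on_def zero intro: continuous_on continuous_on_id)
  moreover have "(\<integral>\<^sup>+t\<in>S. ennreal ((norm (k (F t)))\<^sup>2) \<partial>lebesgue) < \<infinity>"
  proof -
    have "(norm (k x))\<^sup>2 \<le> K\<^sup>2 * (norm x)\<^sup>2" for x
      using power_mono[OF K(2), of x 2] by (simp add: power_mult_distrib mult.commute)
    then have "(\<integral>\<^sup>+t\<in>S. ennreal ((norm (k (F t)))\<^sup>2) \<partial>lebesgue)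
        \<le> (\<integral>\<^sup>+t. ennreal (K\<^sup>2) * (ennreal ((norm (F t))\<^sup>2) * indicator S t) \<partial>lebesgue)"
      by (intro nn_integral_mono) (auto simp: indicator_def ennreal_leI simp flip: ennreal_mult)
    also have "\<dots> = ennreal (K\<^sup>2) * (\<integral>\<^sup>+t\<in>S. ennreal ((norm (F t))\<^sup>2) \<partial>lebesgue)"
    proof (rule nn_integral_cmult)
      have "(norm \<circ> F) measurable_on S"
        using F by (intro measurable_on_compose_continuous_0)
          (auto simp: square_integrable_on_def intro: continuous_intros)
      then have "(\<lambda>t. if t \<in> S then norm (F t) else 0) measurable_on UNIV"
        by (simp add: measurable_on_UNIV o_def)
      then have [measurable]: "(\<lambda>t. if t \<in> S then norm (F t) else 0) \<in> borel_measurable lebesgue"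
        by (rule measurable_on_imp_borel_measurable_lebesgue_UNIV)
      have "(\<lambda>t. ennreal ((if t \<in> S then norm (F t) else 0)\<^sup>2)) \<in> borel_measurable lebesgue"
        by measurable
      moreover have "(\<lambda>t. ennreal ((if t \<in> S then norm (F t) else 0)\<^sup>2))
          = (\<lambda>t. ennreal ((norm (F t))\<^sup>2) * indicator S t)"
        by (auto simp: fun_eq_iff indicator_def)
      ultimately show "(\<lambda>t. ennreal ((norm (F t))\<^sup>2) * indicator S t) \<in> borel_measurable lebesgue"
        by simp
    qed
    also have "\<dots> < \<infinity>"
      using F by (simp add: square_integrable_on_def ennreal_mult_less_top)
    finally show ?thesis .
  qed
  ultimately show ?thesis by (simp add: square_integrable_on_def o_def)
qed

section \<open>Energy dissipation and uniqueness\<close>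

context gradient_flow
begin

text \<open>The increments are dominated by those of C sqrt (t - t0), which is continuous at
  \<open>t0\<close> and Lipschitz after it.\<close>

lemma flow_abs_continuous:
  assumes tT: "t0 < T"
  shows "abs_continuous_on {t0..T} flow"
proof -
  obtain R where "gradient_flow_on D g B L t0 z0 (T + 1) R" using flow_on[of "T + 1"] tT by auto
  then interpret gradient_flow_on D g B L t0 z0 "T + 1" R .
  obtain C where C: "0 \<le> C"
    "\<And>x y. t0 \<le> x \<Longrightarrow> x \<le> y \<Longrightarrow> y < T + 1
        \<Longrightarrow> norm (flow y - flow x) \<le> C * (sqrt (y - t0) - sqrt (x - t0))"
    using flow_smoothing by blast
  show ?thesis
  proof (rule abs_continuous_on_dominated[OF tT])
    show "continuous_on {t0..T} (\<lambda>t. C * sqrt (t - t0))" by (intro continuous_intros)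
    show "dist (flow s) (flow t) \<le> C * sqrt (t - t0) - C * sqrt (s - t0)"
      if "t0 \<le> s" "s \<le> t" "t \<le> T" for s t
      using C(2)[of s t] that by (simp add: dist_norm norm_minus_commute right_diff_distrib)
    fix c assume c: "t0 < c" "c < T"
    have "(C / sqrt (c - t0))-lipschitz_on {c..T} (\<lambda>t. C * sqrt (t - t0))"
    proof (rule lipschitz_onI)
      show "0 \<le> C / sqrt (c - t0)" using C c by simp
      fix x y assume xy: "x \<in> {c..T}" "y \<in> {c..T}"
      have "norm (C * sqrt (x - t0) - C * sqrt (y - t0)) \<le> (C / sqrt (c - t0)) * norm (x - y)"
      proof (rule field_differentiable_bound[where S = "{c..T}" and f' = "\<lambda>t. C / (2 * sqrt (t - t0))"])
        fix t assume t: "t \<in> {c..T}"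
        show "((\<lambda>t. C * sqrt (t - t0)) has_real_derivative C / (2 * sqrt (t - t0))) (at t within {c..T})"
          using t c by (auto intro!: derivative_eq_intros simp: field_simps)
        have "C / (2 * sqrt (t - t0)) \<le> C / sqrt (c - t0)"
        proof (rule divide_left_mono)
          have "sqrt (c - t0) \<le> sqrt (t - t0)" "0 \<le> sqrt (t - t0)" using t c by auto
          then show "sqrt (c - t0) \<le> 2 * sqrt (t - t0)" by linarith
        qed (use t c C in auto)
        then show "norm (C / (2 * sqrt (t - t0))) \<le> C / sqrt (c - t0)" using C t c by simp
      qed (use xy in auto)
      then show "dist (C * sqrt (x - t0)) (C * sqrt (y - t0)) \<le> C / sqrt (c - t0) * dist x y"
        by (simp add: dist_norm)
    qed
    then show "\<exists>M. M-lipschitz_on {c..T} (\<lambda>t. C * sqrt (t - t0))" by blast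
  qed
qed

text \<open>The subgradient inequality at \<open>x\<close> bounds one difference, at
  \<open>y\<close> the opposite one; \<open>local_bound\<close> controls \<open>xi\<close> and the
  flow.\<close>

lemma g_lipschitz:
  assumes a: "t0 < a"
  shows "\<exists>M\<ge>0. \<forall>x\<in>{a..b}. \<forall>y\<in>{a..b}. \<bar>g (flow x) - g (flow y)\<bar> \<le> M * \<bar>x - y\<bar>"
proof -
  obtain M where M: "0 \<le> M" "\<And>t. t \<in> {a..b} \<Longrightarrow> norm (xi t)
      \<le> M" "M-lipschitz_on {a..b} flow"
    using local_bound[OF a] by blast
  have *: "g (flow x) - g (flow y)
      \<le> (M * M) * \<bar>x - y\<bar>" if xy: "x \<in> {a..b}" "y \<in> {a..b}" for x y
  proof -
    have "g (flow x) - g (flow y) \<le> xi x \<bullet> (flow x - flow y)"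
      using sub_ineq[OF xi_sub(1)[of x] flow_D[of y]] xy a by (simp add: inner_diff_right)
    also have "\<dots> \<le> norm (xi x) * norm (flow x - flow y)" by (rule norm_cauchy_schwarz)
    also have "\<dots> \<le> M * (M * \<bar>x - y\<bar>)"
      using M(2)[OF xy(1)] lipschitz_onD[OF M(3) xy] M(1)
      by (intro mult_mono) (auto simp: dist_norm)
    finally show ?thesis by simp
  qed
  show ?thesis
  proof (intro exI[of _ "M * M"] conjI ballI)
    fix x y assume xy: "x \<in> {a..b}" "y \<in> {a..b}"
    show "\<bar>g (flow x) - g (flow y)\<bar> \<le> M * M * \<bar>x - y\<bar>"
      using *[OF xy] *[OF xy(2,1)] by (simp add: abs_le_iff abs_minus_commute)
  qed (use M in simp)
qed

text \<open>By \<open>flow_energy\<close> the function g (flow t) - k t is nonincreasing, so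
  increments of g along the flow are dominated by those of 2 k t - g (flow t). At \<open>t0\<close>
  continuity comes from lower semicontinuity below and from the energy inequality above.\<close>

lemma g_abs_continuous:
  assumes tT: "t0 < T"
  shows "abs_continuous_on {t0..T} (\<lambda>t. g (flow t))"
proof -
  obtain R where "gradient_flow_on D g B L t0 z0 (T + 1) R" using flow_on[of "T + 1"] tT by auto
  then interpret gradient_flow_on D g B L t0 z0 "T + 1" R .
  define k where "k = (L * R)\<^sup>2 / 2"
  have k: "0 \<le> k" by (simp add: k_def)
  have en: "g (flow t) \<le> g (flow s) + k * (t - s)" if "t0 \<le> s" "s \<le> t" "t
      \<le> T" for s t
    unfolding k_def using that by (intro flow_energy) auto
  have cont: "continuous_on {t0..T} (\<lambda>t. g (flow t))"
    unfolding continuous_on_eq_continuous_within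
  proof
    fix t assume t: "t \<in> {t0..T}"
    show "continuous (at t within {t0..T}) (\<lambda>t. g (flow t))"
    proof (cases "t = t0")
      case False
      define a where "a = (t0 + t) / 2"
      have a: "t0 < a" "a < t" using t False by (auto simp: a_def)
      obtain M where M: "0 \<le> M" "\<And>x y. x \<in> {a..T} \<Longrightarrow> y \<in> {a..T}
          \<Longrightarrow> \<bar>g (flow x) - g (flow y)\<bar> \<le> M * \<bar>x - y\<bar>"
        using g_lipschitz[OF a(1)] by blast
      have "M-lipschitz_on {a..T} (\<lambda>t. g (flow t))"
        by (rule lipschitz_onI) (use M in \<open>auto simp: dist_real_def\<close>)
      then have "continuous (at t within {a..T}) (\<lambda>t. g (flow t))"
        using lipschitz_on_continuous_on t a by (force simp: continuous_on_eq_continuous_within)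
      moreover have "at t within {a..T} = at t within {t0..T}"
        by (rule at_within_nhd[of _ "{a<..}"]) (use a in auto)
      ultimately show ?thesis by simp
    next
      case True
      show ?thesis
        unfolding continuous_within True
      proof (rule order_tendstoI)
        fix c assume c: "c < g (flow t0)"
        have "(flow \<longlongrightarrow> flow t0) (at t0 within {t0..T})"
          using continuous_on_subset[OF flow_cont, of "{t0..T}"] tT by (auto simp: continuous_on_def)
        moreover have "open (- {x \<in> D. g x \<le> c})" "flow t0 \<in> - {x \<in> D. g x \<le> c}"
          using closed_sublevel c by auto
        ultimately have "\<forall>\<^sub>F t in at t0 within {t0..T}. flow t \<in> - {x \<in> D. g x \<le> c}"
          by (rule topological_tendstoD)
        moreover have "\<forall>\<^sub>F t in at t0 within {t0..T}. t \<in> {t0..T}"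
          by (auto simp: eventually_at_filter)
        ultimately show "\<forall>\<^sub>F t in at t0 within {t0..T}. c < g (flow t)"
          by eventually_elim (use flow_D in force)
      next
        fix c assume c: "g (flow t0) < c"
        have "((\<lambda>t. g (flow t0) + k * (t - t0)) \<longlongrightarrow> g (flow t0)
            + k * (t0 - t0)) (at t0 within {t0..T})"
          by (intro tendsto_intros)
        then have "\<forall>\<^sub>F t in at t0 within {t0..T}. g (flow t0) + k * (t - t0) < c"
          by (rule order_tendstoD) (use c in simp)
        moreover have "\<forall>\<^sub>F t in at t0 within {t0..T}. t \<in> {t0..T}"
          by (auto simp: eventually_at_filter)
        ultimately show "\<forall>\<^sub>F t in at t0 within {t0..T}. g (flow t) < c"
          by eventually_elim (use en[of t0] in force)
      qed
    qed
  qed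
  show ?thesis
  proof (rule abs_continuous_on_dominated[OF tT])
    show "continuous_on {t0..T} (\<lambda>t. 2 * k * t - g (flow t))"
      by (intro continuous_intros cont)
    show "dist (g (flow s)) (g (flow t)) \<le> 2 * k * t - g (flow t) - (2 * k * s - g (flow s))"
      if st: "t0 \<le> s" "s \<le> t" "t \<le> T" for s t
    proof -
      have "0 \<le> k * (t - s)" using k st by simp
      then show ?thesis using en[OF st] by (simp add: dist_real_def abs_le_iff algebra_simps)
    qed
    fix c assume c: "t0 < c" "c < T"
    obtain M where M: "0 \<le> M" "\<And>x y. x \<in> {c..T} \<Longrightarrow> y \<in> {c..T}
        \<Longrightarrow> \<bar>g (flow x) - g (flow y)\<bar> \<le> M * \<bar>x - y\<bar>"
      using g_lipschitz[OF c(1)] by blast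
    have "(2 * k + M)-lipschitz_on {c..T} (\<lambda>t. 2 * k * t - g (flow t))"
    proof (rule lipschitz_onI)
      fix x y assume xy: "x \<in> {c..T}" "y \<in> {c..T}"
      have "(2 * k * x - g (flow x)) - (2 * k * y - g (flow y))
          = 2 * k * (x - y) - (g (flow x) - g (flow y))"
        by (simp add: algebra_simps)
      also have "\<bar>\<dots>\<bar> \<le> \<bar>2 * k * (x - y)\<bar>
          + \<bar>g (flow x) - g (flow y)\<bar>"
        by (rule abs_triangle_ineq4)
      also have "\<dots> \<le> (2 * k + M) * \<bar>x - y\<bar>"
        using M(2)[OF xy] k by (simp add: abs_mult distrib_right)
      finally show "dist (2 * k * x - g (flow x)) (2 * k * y - g (flow y)) \<le> (2 * k
          + M) * dist x y"
        by (simp add: dist_real_def)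
    qed (use k M in simp)
    then show "\<exists>M. M-lipschitz_on {c..T} (\<lambda>t. 2 * k * t - g (flow t))" by blast
  qed
qed

lemma exceptional_set:
  obtains N where "negligible N" "t0 \<in> N" "\<And>t. t0 < t \<Longrightarrow> t \<notin> N
      \<Longrightarrow> isCont (\<lambda>t. norm (velocity t)) t"
proof
  show "negligible (insert t0 {t. t0 < t \<and> \<not> isCont (\<lambda>t. norm (velocity t)) t})"
    unfolding negligible_iff_null_sets
    using countable_discontinuities by (intro null_sets_completionI countable_imp_null_set_lborel) auto
qed auto

lemma square_integrable_velocity_xi:
  assumes T: "t0 < T"
  shows "square_integrable_on velocity {t0<..<T}" "square_integrable_on xi {t0<..<T}"
proof -
  obtain R where "gradient_flow_on D g B L t0 z0 T R" using flow_on[OF T] by auto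
  then interpret gradient_flow_on D g B L t0 z0 T R .
  obtain N where N: "negligible N" "t0 \<in> N" "\<And>t. t0 < t \<Longrightarrow> t \<notin> N
      \<Longrightarrow> isCont (\<lambda>t. norm (velocity t)) t"
    by (rule exceptional_set) blast
  \<comment> \<open>Off \<open>N\<close> this dominates both |velocity|^2 and |xi|^2, by expanding
    the squared drift; it is integrable because xi . velocity is the derivative of an absolutely
    continuous function.\<close>
  define k where "k t = (L * R)\<^sup>2 - 2 * (if t \<in> N then 0 else xi t \<bullet> velocity t)" for t
  have "((\<lambda>t. if t \<in> N then 0 else xi t \<bullet> velocity t) has_integral (g (flow T) - g (flow t0))) {t0..T}"
  proof (rule abs_continuous_FTC[OF _ g_abs_continuous[OF T] N(1)])
    fix t assume t: "t \<in> {t0..T} - N"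
    then have "t0 < t" using N(2) by (cases "t = t0") auto
    then show "((\<lambda>t. g (flow t)) has_real_derivative xi t \<bullet> velocity t) (at t within {t0..T})"
      using t by (intro has_field_derivative_at_within[OF g_deriv] N(3)) auto
  qed (use T in simp)
  then have int: "(k has_integral ((L * R)\<^sup>2 * (T - t0) - 2 * (g (flow T) - g (flow t0)))) {t0..T}"
    unfolding k_def using has_integral_const_real[of "(L * R)\<^sup>2" t0 T] T
    by (intro has_integral_diff has_integral_mult_right) (simp_all add: mult.commute)
  have le: "(norm (velocity t))\<^sup>2 \<le> k t" "(norm (xi t))\<^sup>2
      \<le> k t" if t: "t \<in> {t0..T} - N" for t
  proof -
    have "norm (drift t) \<le> L * R"
      unfolding drift_def using L t by (intro order_trans[OF B_norm mult_left_mono[OF flow_bound]]) auto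
    then have "(norm (drift t))\<^sup>2 \<le> (L * R)\<^sup>2" by (intro power_mono) auto
    moreover have "(norm (drift t))\<^sup>2 = (norm (velocity t))\<^sup>2
        + 2 * (xi t \<bullet> velocity t) + (norm (xi t))\<^sup>2"
      by (simp add: xi_def power2_norm_eq_inner inner_diff_left inner_diff_right inner_commute)
    moreover have "k t = (L * R)\<^sup>2 - 2 * (xi t \<bullet> velocity t)"
      using t by (simp add: k_def)
    ultimately show "(norm (velocity t))\<^sup>2 \<le> k t" "(norm (xi t))\<^sup>2 \<le> k t"
      using zero_le_power2[of "norm (velocity t)"] zero_le_power2[of "norm (xi t)"] by linarith+
  qed
  have k0: "0 \<le> k t" if "t \<in> {t0..T}" for t
  proof (cases "t \<in> N")
    case False
    then show ?thesis using order_trans[OF zero_le_power2 le(1)] that by blast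
  qed (simp add: k_def)
  have sq: "(\<integral>\<^sup>+t\<in>{t0<..<T}. ennreal ((norm (w t))\<^sup>2) \<partial>lebesgue) < \<infinity>"
    if w: "\<And>t. t \<in> {t0..T} - N \<Longrightarrow> (norm (w t))\<^sup>2
        \<le> k t" for w :: "real \<Rightarrow> 'b"
  proof -
    have "AE t in lebesgue. t \<notin> N"
      using N(1) by (simp add: negligible_iff_null_sets AE_not_in)
    then have "(\<integral>\<^sup>+t\<in>{t0<..<T}. ennreal ((norm (w t))\<^sup>2) \<partial>lebesgue)
        \<le> (\<integral>\<^sup>+t. ennreal (k t) * indicator {t0..T} t \<partial>lebesgue)"
      by (intro nn_integral_mono_AE) (auto elim!: eventually_mono simp: indicator_def intro!: ennreal_leI w)
    also have "\<dots> = (\<integral>\<^sup>+t. ennreal (k t) * indicator {t0..T} t \<partial>lborel)"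
      by (rule nn_integral_completion)
    also have "\<dots> < \<infinity>"
      using nn_integral_has_integral_lebesgue'[OF k0 int] by simp
    finally show ?thesis .
  qed
  define zc where "zc t = flow (max t t0)" for t
  define fc where "fc t = drift (max t t0)" for t
  have mc: "continuous_on UNIV (\<lambda>t. max (t + c) t0)" for c :: real
    by (intro continuous_intros)
  have zcc: "continuous_on UNIV (\<lambda>t. zc (t + c))" for c
    unfolding zc_def by (rule continuous_on_compose2[OF flow_cont mc]) auto
  have fcc: "continuous_on UNIV fc"
    unfolding fc_def by (rule continuous_on_compose2[OF drift_cont]) (use mc[of 0] in auto)
  \<comment> \<open>Forward quotients with step 1 / (n + 1) converge at every \<open>t > t0\<close>;
    freezing the flow left of \<open>t0\<close> makes them continuous on the line.\<close>
  define q where "q n t = real (Suc n) *\<^sub>R (zc (t + inverse (real (Suc n))) - zc (t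
      + 0))" for n t
  have qc: "continuous_on UNIV (q n)" for n
    unfolding q_def by (intro continuous_intros zcc)
  have qlim: "(\<lambda>n. q n t) \<longlonglongrightarrow> velocity t" if t: "t0 < t" for t
  proof -
    have "filterlim (\<lambda>n. inverse (real (Suc n))) (at_right 0) sequentially"
      unfolding filterlim_at using LIMSEQ_inverse_real_of_nat by (auto simp del: of_nat_Suc)
    from filterlim_compose[OF right_derivative[OF t] this]
    moreover have "q n t = (1 / inverse (real (Suc n))) *\<^sub>R (flow (t
        + inverse (real (Suc n))) - flow t)" for n
    proof -
      have "0 < inverse (real (Suc n))" by simp
      then have "max (t + inverse (real (Suc n))) t0 = t + inverse (real (Suc n))" "max t t0 = t"
        using t by linarith+
      then show ?thesis by (simp add: q_def zc_def divide_inverse del: of_nat_Suc)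
    qed
    ultimately show ?thesis by simp
  qed
  show "square_integrable_on velocity {t0<..<T}"
    unfolding square_integrable_on_def
    using measurable_on_Ioo_limit[OF qc qlim] sq[of velocity] le by blast
  have "xi measurable_on {t0<..<T}"
  proof (rule measurable_on_Ioo_limit)
    show "continuous_on UNIV (\<lambda>t. fc t - q n t)" for n by (intro continuous_intros fcc qc)
    show "(\<lambda>n. fc t - q n t) \<longlonglongrightarrow> xi t" if "t0 < t" for t
      unfolding xi_def using that by (intro tendsto_diff qlim) (simp_all add: fc_def max_def)
  qed
  then show "square_integrable_on xi {t0<..<T}"
    unfolding square_integrable_on_def using sq[of xi] le by blast
qed

text \<open>Monotonicity makes the derivative of exp (-2 L t) |w - flow|^2 nonpositive almost
  everywhere. Absolute continuity, assumed only on [s, T] with s > t0, turns this into decrease, and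
  continuity lets s reach \<open>t0\<close>, where the two curves agree.\<close>

lemma uniqueness:
  assumes T: "t0 < T" and w: "continuous_on {t0..T} w"
    and ac: "\<And>s. t0 < s \<Longrightarrow> s < T \<Longrightarrow> abs_continuous_on {s..T} w"
    and w0: "w t0 = z0"
    and eq: "AE t in lebesgue. t \<in> {t0<..T} \<longrightarrow>
      (\<exists>p\<in>sub (w t). (w has_vector_derivative (B t (w t) - p)) (at t within {t0..T}))"
    and t: "t0 \<le> t" "t \<le> T"
  shows "w t = flow t"
proof (cases "t = t0")
  case True
  then show ?thesis by (simp add: w0 flow_init)
next
  case False
  with t have t0t: "t0 < t" by simp
  obtain N0 where N0: "negligible N0" "t0 \<in> N0" "\<And>t. t0 < t
      \<Longrightarrow> t \<notin> N0 \<Longrightarrow> isCont (\<lambda>t. norm (velocity t)) t"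
    by (rule exceptional_set) blast
  obtain N1 where N1_null: "N1 \<in> null_sets lebesgue" and N1_sub: "{t \<in> space lebesgue. \<not> (t \<in> {t0<..T} \<longrightarrow>
      (\<exists>p\<in>sub (w t). (w has_vector_derivative (B t (w t) - p)) (at t within {t0..T})))} \<subseteq> N1"
    using eq unfolding eventually_ae_filter by blast
  have N1: "\<And>t. t \<notin> N1 \<Longrightarrow> t \<in> {t0<..T} \<Longrightarrow>
      \<exists>p\<in>sub (w t). (w has_vector_derivative (B t (w t) - p)) (at t within {t0..T})"
    using N1_sub by auto
  define N where "N = N0 \<union> N1"
  have N: "negligible N" unfolding N_def
    by (intro negligible_Un N0(1)) (simp add: negligible_iff_null_sets N1_null)
  define E where "E t = exp (- (2 * L * t))" for t
  define r where "r t = E t * (norm (w t - flow t))\<^sup>2" for t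
  have zT: "continuous_on {t0..T} flow" by (rule continuous_on_subset[OF flow_cont]) auto
  have rc: "continuous_on {t0..T} r"
    unfolding r_def E_def by (intro continuous_intros w zT)
  have dec: "r t \<le> r s" if s: "t0 < s" "s < t" for s
  proof -
    obtain M where M: "0 \<le> M" "M-lipschitz_on {s..T} flow" using local_bound[OF s(1)] by blast
    \<comment> \<open>Half of the weight is attached to the difference, so that \<open>r\<close> is
      a squared norm and its increments follow from those of \<open>w\<close> and of time.\<close>
    define d where "d x = exp (- (L * x)) *\<^sub>R (w x - flow x)" for x
    have r_d: "r x = (norm (d x))\<^sup>2" for x
      by (simp add: r_def d_def E_def power_mult_distrib flip: exp_double)
    have "continuous_on {t0..T} (\<lambda>x. w x - flow x)" by (intro continuous_intros w zT)
    then have "continuous_on {s..T} (\<lambda>x. w x - flow x)"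
      by (rule continuous_on_subset) (use s in auto)
    then have "bounded ((\<lambda>x. w x - flow x) ` {s..T})"
      by (intro compact_imp_bounded compact_continuous_image) auto
    then obtain Q where "\<forall>y\<in>(\<lambda>x. w x - flow x) ` {s..T}. norm y \<le> Q"
      unfolding bounded_iff by blast
    then have Q: "norm (w x - flow x) \<le> Q" if "x \<in> {s..T}" for x using that by blast
    have Q0: "0 \<le> Q" using order_trans[OF norm_ge_zero Q[of s]] s t by simp
    \<comment> \<open>Bounds the weight on \<open>{s..T}\<close> whatever the signs of the
      times.\<close>
    define X where "X = exp (\<bar>L\<bar> * (\<bar>s\<bar> + \<bar>T\<bar>))"
    have X: "exp (- (L * x)) \<le> X" if "x \<in> {s..T}" for x
    proof -
      have "- (L * x) \<le> \<bar>L\<bar> * \<bar>x\<bar>" by (metis abs_ge_minus_self abs_mult)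
      also have "\<dots> \<le> \<bar>L\<bar> * (\<bar>s\<bar> + \<bar>T\<bar>)"
        using that by (intro mult_left_mono) auto
      finally show ?thesis by (simp add: X_def)
    qed
    have X0: "0 < X" by (simp add: X_def)
    have Xl: "\<bar>exp (- (L * x)) - exp (- (L * y))\<bar>
        \<le> (L * X) * \<bar>x - y\<bar>" if xy: "x \<in> {s..T}" "y \<in> {s..T}" for x y
    proof -
      have "norm (exp (- (L * x)) - exp (- (L * y))) \<le> (L * X) * norm (x - y)"
      proof (rule field_differentiable_bound[where S = "{s..T}" and f' = "\<lambda>x. - L * exp (- (L * x))"])
        show "((\<lambda>x. exp (- (L * x))) has_real_derivative - L * exp (- (L * x))) (at x within {s..T})" for x
          by (auto intro!: derivative_eq_intros)
        show "norm (- L * exp (- (L * x))) \<le> L * X" if "x \<in> {s..T}" for x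
          using X[OF that] L by (simp add: abs_mult)
      qed (use xy in auto)
      then show ?thesis by simp
    qed
    define P where "P = X * (M + 1) + L * X * Q"
    have P0: "0 \<le> P" using X0 M(1) L Q0 by (simp add: P_def)
    have dd: "norm (d x - d y) \<le> P * (dist (w x) (w y)
        + \<bar>x - y\<bar>)" if xy: "x \<in> {s..T}" "y \<in> {s..T}" for x y
    proof -
      have "d x - d y = exp (- (L * x)) *\<^sub>R ((w x - w y) - (flow x - flow y))
          + (exp (- (L * x)) - exp (- (L * y))) *\<^sub>R (w y - flow y)"
        by (simp add: d_def algebra_simps)
      then have "norm (d x - d y)
          \<le> norm (exp (- (L * x)) *\<^sub>R ((w x - w y) - (flow x - flow y)))
          + norm ((exp (- (L * x)) - exp (- (L * y))) *\<^sub>R (w y - flow y))"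
        by (simp only: norm_triangle_ineq)
      also have "\<dots> \<le> X * (dist (w x) (w y) + M * \<bar>x - y\<bar>)
          + ((L * X) * \<bar>x - y\<bar>) * Q"
      proof (rule add_mono)
        have "norm ((w x - w y) - (flow x - flow y)) \<le> dist (w x) (w y) + M * \<bar>x - y\<bar>"
          using norm_triangle_ineq4[of "w x - w y" "flow x - flow y"] lipschitz_onD[OF M(2) xy]
          by (simp add: dist_norm)
        then show "norm (exp (- (L * x)) *\<^sub>R ((w x - w y) - (flow x - flow y)))
            \<le> X * (dist (w x) (w y) + M * \<bar>x - y\<bar>)"
          using X[OF xy(1)] X0 by (auto intro!: mult_mono)
        show "norm ((exp (- (L * x)) - exp (- (L * y))) *\<^sub>R (w y - flow y))
            \<le> ((L * X) * \<bar>x - y\<bar>) * Q"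
          using Xl[OF xy] Q[OF xy(2)] L X0 by (auto intro!: mult_mono)
      qed
      also have "\<dots> \<le> P * (dist (w x) (w y) + \<bar>x - y\<bar>)"
      proof -
        have "0 \<le> X * \<bar>x - y\<bar>" "0 \<le> (X * M) * dist (w x) (w y)" "0
            \<le> (L * X * Q) * dist (w x) (w y)"
          using X0 M(1) L Q0 by auto
        then show ?thesis by (simp add: P_def algebra_simps)
      qed
      finally show ?thesis .
    qed
    have rr: "dist (r x) (r y) \<le> (2 * (X * Q) * P + 1) * (dist (w x) (w y) + \<bar>x - y\<bar>)"
      if xy: "x \<in> {s..T}" "y \<in> {s..T}" for x y
    proof -
      have nd: "norm (d x) \<le> X * Q" if "x \<in> {s..T}" for x
        unfolding d_def using X[OF that] Q[OF that] X0 by (auto intro!: mult_mono)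
      have "dist (r x) (r y) = \<bar>(norm (d x) - norm (d y)) * (norm (d x) + norm (d y))\<bar>"
        by (simp add: r_d dist_real_def power2_eq_square algebra_simps)
      also have "\<dots> = \<bar>norm (d x) - norm (d y)\<bar> * (norm (d x) + norm (d y))"
        by (simp add: abs_mult)
      also have "\<dots> \<le> (P * (dist (w x) (w y) + \<bar>x - y\<bar>)) * (X * Q + X * Q)"
        using order_trans[OF norm_triangle_ineq3 dd[OF xy]] nd[OF xy(1)] nd[OF xy(2)] P0
        by (intro mult_mono add_mono) auto
      also have "\<dots> \<le> (2 * (X * Q) * P + 1) * (dist (w x) (w y) + \<bar>x - y\<bar>)"
        by (simp add: algebra_simps)
      finally show ?thesis .
    qed
    have sT: "s < T" using s t by simp
    have "abs_continuous_on {s..T} r"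
      by (rule abs_continuous_on_Lipschitz_comb[OF ac[OF s(1) sT] _ rr])
        (use X0 Q0 P0 in \<open>auto intro!: add_nonneg_pos\<close>)
    then have rac: "abs_continuous_on {s..t} r"
      by (rule abs_continuous_on_subset) (use t in auto)
    have deriv: "\<exists>r'\<le>0. (r has_real_derivative r') (at x within {s..t})" if x: "x \<in> {s..t} - N" for x
    proof -
      have x1: "t0 < x" "x \<in> {t0<..T}" "x \<notin> N0" "x \<notin> N1"
        using x s t by (auto simp: N_def)
      obtain p where p: "p \<in> sub (w x)" "(w has_vector_derivative (B x (w x) - p)) (at x within {t0..T})"
        using N1[OF x1(4,2)] by blast
      have w': "(w has_vector_derivative (B x (w x) - p)) (at x within {s..t})"
        by (rule has_vector_derivative_within_subset[OF p(2)]) (use s t in auto)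
      have z': "(flow has_vector_derivative velocity x) (at x within {s..t})"
        by (rule has_vector_derivative_at_within[OF flow_deriv(1)[OF x1(1) N0(3)[OF x1(1,3)]]])
      let ?d = "w x - flow x"
      let ?e = "?d \<bullet> (B x (w x) - p - velocity x)"
      have "((\<lambda>x. (norm (w x - flow x))\<^sup>2) has_real_derivative 2 * ?e) (at x within {s..t})"
        by (intro has_real_derivative_norm_sq has_vector_derivative_diff w' z')
      moreover have "(E has_real_derivative - (2 * L) * E x) (at x within {s..t})"
        unfolding E_def by (auto intro!: derivative_eq_intros)
      ultimately have "(r has_real_derivative (- (2 * L) * E x * (norm ?d)\<^sup>2
          + 2 * ?e * E x)) (at x within {s..t})"
        unfolding r_def by (intro DERIV_mult)
      moreover have "?e \<le> L * (norm ?d)\<^sup>2"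
      proof -
        have "0 \<le> (p - xi x) \<bullet> ?d" by (rule sub_mono[OF p(1) xi_sub(1)[OF x1(1)]])
        moreover have "?e = ?d \<bullet> (B x (w x) - B x (flow x)) - (p - xi x) \<bullet> ?d"
          by (simp add: xi_def drift_def inner_diff_left inner_diff_right inner_commute)
        moreover have "?d \<bullet> (B x (w x) - B x (flow x)) \<le> norm ?d * (L * norm ?d)"
          by (intro order_trans[OF norm_cauchy_schwarz] mult_left_mono B_lip) simp
        ultimately show ?thesis by (simp add: power2_eq_square algebra_simps)
      qed
      then have "- (2 * L) * E x * (norm ?d)\<^sup>2 + 2 * ?e * E x \<le> 0"
        using mult_left_mono[of ?e "L * (norm ?d)\<^sup>2" "2 * E x"] by (simp add: E_def algebra_simps)
      ultimately show ?thesis by blast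
    qed
    then obtain r' where r': "\<And>x. x \<in> {s..t} - N \<Longrightarrow> r' x \<le> 0"
      "\<And>x. x \<in> {s..t} - N
          \<Longrightarrow> (r has_real_derivative r' x) (at x within {s..t})" by metis
    have "((\<lambda>x. if x \<in> N then 0 else r' x) has_integral (r t - r s)) {s..t}"
      by (rule abs_continuous_FTC[OF _ rac N r'(2)]) (use s in auto)
    moreover have "((\<lambda>x. 0::real) has_integral 0) {s..t}" by simp
    ultimately have "r t - r s \<le> 0"
      by (rule has_integral_le) (use r'(1) in auto)
    then show ?thesis by simp
  qed
  have "(r \<longlongrightarrow> r t0) (at t0 within {t0..T})"
    using rc T by (simp add: continuous_on_def)
  then have "(r \<longlongrightarrow> r t0) (at_right t0)"
    by (simp add: at_within_Icc_at_right[OF T])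
  moreover have "\<forall>\<^sub>F s in at_right t0. r t \<le> r s"
    using eventually_at_right_real[OF t0t] by eventually_elim (use dec in auto)
  ultimately have "r t \<le> r t0" using tendsto_lowerbound trivial_limit_at_right_real by blast
  also have "\<dots> = 0" by (simp add: r_def w0 flow_init)
  finally have "E t * (norm (w t - flow t))\<^sup>2 \<le> 0" by (simp add: r_def)
  moreover have "0 < E t" by (simp add: E_def)
  ultimately have "(norm (w t - flow t))\<^sup>2 \<le> 0" by (simp add: mult_le_0_iff)
  then show ?thesis by simp
qed

end

section \<open>The first-order system\<close>

lemma dom_fun_real:
  assumes "proper_fun \<phi>" "x \<in> dom_fun \<phi>"
  shows "\<phi> x = ereal (real_of_ereal (\<phi> x))"
  using assms by (cases "\<phi> x") (auto simp: proper_fun_def dom_fun_def)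

lemma convex_fun_real:
  assumes c: "convex_fun \<phi>" and pr: "proper_fun \<phi>"
    and xy: "x \<in> dom_fun \<phi>" "y \<in> dom_fun \<phi>" and u: "0 \<le> u" "u \<le> 1"
  shows "(1 - u) *\<^sub>R x + u *\<^sub>R y \<in> dom_fun \<phi>"
    and "real_of_ereal (\<phi> ((1 - u) *\<^sub>R x + u *\<^sub>R y))
      \<le> (1 - u) * real_of_ereal (\<phi> x) + u * real_of_ereal (\<phi> y)"
proof -
  let ?m = "(1 - u) *\<^sub>R x + u *\<^sub>R y"
  have "\<phi> ?m \<le> ereal (1 - u) * \<phi> x + ereal u * \<phi> y"
    using c u by (auto simp: convex_fun_def)
  also have "\<dots> = ereal ((1 - u) * real_of_ereal (\<phi> x) + u * real_of_ereal (\<phi> y))"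
    by (subst dom_fun_real[OF pr xy(1)], subst dom_fun_real[OF pr xy(2)]) simp
  finally have le: "\<phi> ?m \<le> ereal ((1 - u) * real_of_ereal (\<phi> x)
      + u * real_of_ereal (\<phi> y))" .
  then show m: "?m \<in> dom_fun \<phi>" by (auto simp: dom_fun_def intro: le_less_trans)
  show "real_of_ereal (\<phi> ?m) \<le> (1 - u) * real_of_ereal (\<phi> x)
      + u * real_of_ereal (\<phi> y)"
    using le by (subst (asm) dom_fun_real[OF pr m]) simp
qed

text \<open>The Liminf runs over punctured neighbourhoods; adding the value at the centre makes the
  strict superlevel set open.\<close>

lemma closed_sublevel_ereal:
  assumes "lower_semicontinuous \<phi>"
  shows "closed {x. \<phi> x \<le> ereal c}"
proof -
  have "open {x. ereal c < \<phi> x}"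
    unfolding open_subopen[of "{x. ereal c < \<phi> x}"]
  proof
    fix x assume x: "x \<in> {x. ereal c < \<phi> x}"
    then have "\<forall>\<^sub>F y in at x. ereal c < \<phi> y"
      using assms by (auto simp: lower_semicontinuous_def le_Liminf_iff)
    then have "\<forall>\<^sub>F y in nhds x. ereal c < \<phi> y"
      using x by (auto simp: eventually_at_filter elim: eventually_mono)
    then show "\<exists>T. open T \<and> x \<in> T \<and> T \<subseteq> {x. ereal c < \<phi> x}"
      by (auto simp: eventually_nhds)
  qed
  moreover have "{x. \<phi> x \<le> ereal c} = - {x. ereal c < \<phi> x}" by (auto simp: not_less)
  ultimately show ?thesis by (simp add: closed_def)
qed

section \<open>The convex function lifted to the product space\<close>

definition prod_dom :: "('a::real_inner \<Rightarrow> ereal) \<Rightarrow> ('a \<times> 'a) set" where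
  "prod_dom \<phi> = {p. fst p \<in> dom_fun \<phi>}"

definition prod_fun :: "real \<Rightarrow> ('a::real_inner \<Rightarrow> ereal) \<Rightarrow> 'a \<times> 'a \<Rightarrow> real" where
  "prod_fun \<beta> \<phi> p = \<beta> * real_of_ereal (\<phi> (fst p))"

lemma lsc_convex_prod:
  fixes \<phi> :: "'a::{real_inner,complete_space} \<Rightarrow> ereal"
  assumes c: "convex_fun \<phi>" and l: "lower_semicontinuous \<phi>" and pr: "proper_fun \<phi>" and b: "0 < \<beta>"
  shows "lsc_convex (prod_dom \<phi>) (prod_fun \<beta> \<phi>)"
proof
  obtain x where "\<phi> x \<noteq> \<infinity>" using pr by (auto simp: proper_fun_def)
  then have "(x, 0) \<in> prod_dom \<phi>" by (simp add: prod_dom_def dom_fun_def)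
  then show "prod_dom \<phi> \<noteq> {}" by blast
  show "convex_on (prod_dom \<phi>) (prod_fun \<beta> \<phi>)"
  proof (rule convex_onI)
    show "convex (prod_dom \<phi>)"
      unfolding convex_alt using convex_fun_real(1)[OF c pr] by (auto simp: prod_dom_def)
    fix u :: real and p q assume u: "0 < u" "u < 1" and pq: "p \<in> prod_dom \<phi>" "q \<in> prod_dom \<phi>"
    have "\<beta> * real_of_ereal (\<phi> ((1 - u) *\<^sub>R fst p + u *\<^sub>R fst q))
        \<le> \<beta> * ((1 - u) * real_of_ereal (\<phi> (fst p)) + u * real_of_ereal (\<phi> (fst q)))"
      using u pq b by (intro mult_left_mono convex_fun_real(2)[OF c pr]) (auto simp: prod_dom_def)
    then show "prod_fun \<beta> \<phi> ((1 - u) *\<^sub>R p + u *\<^sub>R q)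
        \<le> (1 - u) * prod_fun \<beta> \<phi> p + u * prod_fun \<beta> \<phi> q"
      by (simp add: prod_fun_def algebra_simps)
  qed
  fix k
  have le_iff: "prod_fun \<beta> \<phi> p \<le> k \<longleftrightarrow> \<phi> (fst p)
      \<le> ereal (k / \<beta>)" if "p \<in> prod_dom \<phi>" for p
    using that b dom_fun_real[OF pr, of "fst p"]
    by (cases "\<phi> (fst p)") (auto simp: prod_dom_def prod_fun_def field_simps)
  have "p \<in> prod_dom \<phi>" if "\<phi> (fst p) \<le> ereal (k / \<beta>)" for p
    using le_less_trans[OF that, of \<infinity>] by (simp add: prod_dom_def dom_fun_def)
  then have "{p \<in> prod_dom \<phi>. prod_fun \<beta> \<phi> p \<le> k} = fst -` {x. \<phi> x
      \<le> ereal (k / \<beta>)}"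
    using le_iff by blast
  then show "closed {p \<in> prod_dom \<phi>. prod_fun \<beta> \<phi> p \<le> k}"
    using closed_vimage_fst[OF closed_sublevel_ereal[OF l]] by simp
qed

text \<open>The lifted function is constant in the second component, which forces that component of
  a subgradient to vanish; the first one is a subgradient of phi scaled by beta.\<close>

lemma sub_prod_iff:
  fixes \<phi> :: "'a::{real_inner,complete_space} \<Rightarrow> ereal"
  assumes c: "convex_fun \<phi>" and l: "lower_semicontinuous \<phi>" and pr: "proper_fun \<phi>" and b: "0 < \<beta>"
  shows "q \<in> lsc_convex.sub (prod_dom \<phi>) (prod_fun \<beta> \<phi>) p
    \<longleftrightarrow> snd q = 0 \<and> (1 / \<beta>) *\<^sub>R fst q \<in> subdifferential \<phi> (fst p)"
proof -
  interpret lsc_convex "prod_dom \<phi>" "prod_fun \<beta> \<phi>" by (rule lsc_convex_prod[OF assms])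
  obtain x y where p: "p = (x, y)" by (cases p)
  obtain r s where q: "q = (r, s)" by (cases q)
  show ?thesis
  proof
    assume qp: "q \<in> sub p"
    have x: "x \<in> dom_fun \<phi>" using sub_D[OF qp] by (simp add: p prod_dom_def)
    have le: "prod_fun \<beta> \<phi> p + q \<bullet> (w - p)
        \<le> prod_fun \<beta> \<phi> w" if "w \<in> prod_dom \<phi>" for w
      by (rule sub_ineq[OF qp that])
    \<comment> \<open>The test point is displaced by \<open>s\<close> itself in the second
      component.\<close>
    have "s \<bullet> s \<le> 0"
      using le[of "(x, y + s)"] x by (simp add: p q prod_dom_def prod_fun_def)
    then have s: "s = 0" using inner_ge_zero[of s] by (simp add: order_antisym)
    have "\<phi> x + ereal (((1 / \<beta>) *\<^sub>R r) \<bullet> (w - x)) \<le> \<phi> w" for w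
    proof (cases "w \<in> dom_fun \<phi>")
      case True
      have "\<beta> * real_of_ereal (\<phi> x) + r \<bullet> (w - x)
          \<le> \<beta> * real_of_ereal (\<phi> w)"
        using le[of "(w, y)"] True by (simp add: p q prod_dom_def prod_fun_def)
      then have "real_of_ereal (\<phi> x) + ((1 / \<beta>) *\<^sub>R r) \<bullet> (w - x)
          \<le> real_of_ereal (\<phi> w)"
        using b by (simp add: field_simps)
      then show ?thesis
        by (subst dom_fun_real[OF pr x], subst dom_fun_real[OF pr True]) simp
    qed (simp add: dom_fun_def)
    with s show "snd q = 0 \<and> (1 / \<beta>) *\<^sub>R fst q \<in> subdifferential \<phi> (fst p)"
      by (simp add: p q subdifferential_def)
  next
    assume "snd q = 0 \<and> (1 / \<beta>) *\<^sub>R fst q \<in> subdifferential \<phi> (fst p)"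
    then have s: "s = 0" and le: "\<And>w. \<phi> x
        + ereal (((1 / \<beta>) *\<^sub>R r) \<bullet> (w - x)) \<le> \<phi> w"
      by (auto simp: p q subdifferential_def)
    obtain w where "\<phi> w \<noteq> \<infinity>" using pr by (auto simp: proper_fun_def)
    then have x: "x \<in> dom_fun \<phi>" using le[of w] by (auto simp: dom_fun_def)
    have "\<beta> * real_of_ereal (\<phi> x) + r \<bullet> (w - x)
        \<le> \<beta> * real_of_ereal (\<phi> w)" if w: "w \<in> dom_fun \<phi>" for w
    proof -
      have "real_of_ereal (\<phi> x) + ((1 / \<beta>) *\<^sub>R r) \<bullet> (w - x)
          \<le> real_of_ereal (\<phi> w)"
        using le[of w]
        by (subst (asm) dom_fun_real[OF pr x], subst (asm) dom_fun_real[OF pr w]) simp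
      then show ?thesis using b by (simp add: field_simps)
    qed
    with x s show "q \<in> sub p" unfolding sub_def p q by (auto simp: prod_dom_def prod_fun_def)
  qed
qed

text \<open>The coefficients are frozen to the left of \<open>t0\<close>, which makes them globally Lipschitz.\<close>

definition sys_op :: "real \<Rightarrow> real \<Rightarrow> real \<Rightarrow> real \<Rightarrow> 'a::real_inner \<times> 'a \<Rightarrow> 'a \<times> 'a" where
  "sys_op \<alpha> \<beta> t0 t p =
    ((1 / \<beta> - \<alpha> / max t t0) *\<^sub>R fst p - (1 / \<beta>) *\<^sub>R snd p,
     (1 / \<beta> - \<alpha> / max t t0 + \<alpha> * \<beta> / (max t t0)\<^sup>2) *\<^sub>R fst p - (1 / \<beta>) *\<^sub>R snd p)"

lemma sys_op_lipschitz:
  assumes a: "0 \<le> \<alpha>" and b: "0 < \<beta>" and t0: "0 < t0"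
  shows "\<exists>L>0. (\<forall>t (p::'a::real_inner \<times> 'a) q. norm (sys_op \<alpha> \<beta> t0 t p - sys_op \<alpha> \<beta> t0 t q) \<le> L * norm (p - q)) \<and>
    (\<forall>s t (p::'a \<times> 'a). norm (sys_op \<alpha> \<beta> t0 s p - sys_op \<alpha> \<beta> t0 t p) \<le> L * \<bar>s - t\<bar> * norm p)"
proof -
  \<comment> \<open>\<open>K\<close> bounds the coefficients for times from \<open>t0\<close> on;
    \<open>M\<close> bounds their rates of change, the powers of \<open>t0\<close> coming from the
    derivatives of 1 / t and 1 / t^2.\<close>
  define K where "K = 1 / \<beta> + \<alpha> / t0 + \<alpha> * \<beta> / t0\<^sup>2"
  define M where "M = \<alpha> / t0\<^sup>2 + 2 * \<alpha> * \<beta> / t0 ^ 3"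
  \<comment> \<open>The operator has four entries bounded by \<open>K\<close>, two of which vary
    with time at rate at most \<open>M\<close>; one constant has to serve both estimates.\<close>
  define L where "L = 4 * K + 2 * M"
  have K: "0 < K" and M: "0 \<le> M" using a b t0 by (auto simp: K_def M_def intro!: add_pos_nonneg)
  have pair: "norm ((c *\<^sub>R fst p - d *\<^sub>R snd p, c' *\<^sub>R fst p - d *\<^sub>R snd p) :: 'a \<times> 'a) \<le> (\<bar>c\<bar> + \<bar>c'\<bar> + 2 * \<bar>d\<bar>) * norm p"
    for c c' d and p :: "'a \<times> 'a"
  proof -
    have "norm ((c *\<^sub>R fst p - d *\<^sub>R snd p, c' *\<^sub>R fst p - d *\<^sub>R snd p) :: 'a \<times> 'a)
        \<le> norm (c *\<^sub>R fst p - d *\<^sub>R snd p) + norm (c' *\<^sub>R fst p - d *\<^sub>R snd p)"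
      by (rule norm_Pair_le)
    also have "\<dots> \<le> (\<bar>c\<bar> * norm (fst p) + \<bar>d\<bar> * norm (snd p))
        + (\<bar>c'\<bar> * norm (fst p) + \<bar>d\<bar> * norm (snd p))"
      by (intro add_mono order_trans[OF norm_triangle_ineq4]) simp_all
    also have "\<dots> \<le> (\<bar>c\<bar> * norm p + \<bar>d\<bar> * norm p)
        + (\<bar>c'\<bar> * norm p + \<bar>d\<bar> * norm p)"
      using norm_fst_le[of "fst p" "snd p"] norm_snd_le[of "snd p" "fst p"]
      by (intro add_mono mult_left_mono) simp_all
    finally show ?thesis by (simp add: algebra_simps)
  qed
  have coef: "\<bar>1 / \<beta> - \<alpha> / r\<bar> \<le> K" "\<bar>1 / \<beta> - \<alpha> / r
      + \<alpha> * \<beta> / r\<^sup>2\<bar> \<le> K" if r: "t0 \<le> r" for r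
  proof -
    have "0 \<le> \<alpha> / r" "\<alpha> / r \<le> \<alpha> / t0" "0
        \<le> \<alpha> * \<beta> / r\<^sup>2" "\<alpha> * \<beta> / r\<^sup>2 \<le> \<alpha> * \<beta> / t0\<^sup>2" "0 < 1 / \<beta>"
      using r t0 a b by (auto intro!: divide_left_mono power_mono mult_pos_pos)
    then show "\<bar>1 / \<beta> - \<alpha> / r\<bar> \<le> K" "\<bar>1 / \<beta> - \<alpha> / r
        + \<alpha> * \<beta> / r\<^sup>2\<bar> \<le> K"
      unfolding K_def by linarith+
  qed
  have inv: "\<bar>1 / r - 1 / s\<bar>
      \<le> \<bar>r - s\<bar> / t0\<^sup>2" "\<bar>1 / r\<^sup>2 - 1 / s\<^sup>2\<bar> \<le> 2 * \<bar>r - s\<bar> / t0 ^ 3"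
    if rs: "t0 \<le> r" "t0 \<le> s" for r s
  proof -
    have pos: "0 < r" "0 < s" using rs t0 by auto
    have "\<bar>1 / r - 1 / s\<bar> = \<bar>r - s\<bar> / (r * s)"
      using pos by (simp add: field_simps abs_minus_commute abs_divide abs_mult)
    also have "\<dots> \<le> \<bar>r - s\<bar> / t0\<^sup>2"
      using rs t0 pos by (intro divide_left_mono) (auto simp: power2_eq_square intro!: mult_mono)
    finally show 1: "\<bar>1 / r - 1 / s\<bar> \<le> \<bar>r - s\<bar> / t0\<^sup>2" .
    have "\<bar>1 / r\<^sup>2 - 1 / s\<^sup>2\<bar> = \<bar>1 / r - 1 / s\<bar> * (1 / r + 1 / s)"
    proof -
      have "1 / r\<^sup>2 - 1 / s\<^sup>2 = (1 / r - 1 / s) * (1 / r + 1 / s)"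
        using pos by (simp add: field_simps power2_eq_square)
      then show ?thesis using pos by (simp add: abs_mult)
    qed
    also have "\<dots> \<le> (\<bar>r - s\<bar> / t0\<^sup>2) * (1 / t0 + 1 / t0)"
      using rs t0 pos by (intro mult_mono 1 add_mono divide_left_mono) auto
    also have "\<dots> = 2 * \<bar>r - s\<bar> / t0 ^ 3"
      using t0 by (simp add: field_simps power2_eq_square power3_eq_cube)
    finally show "\<bar>1 / r\<^sup>2 - 1 / s\<^sup>2\<bar> \<le> 2 * \<bar>r - s\<bar> / t0 ^ 3" .
  qed
  have lip: "norm (sys_op \<alpha> \<beta> t0 t p - sys_op \<alpha> \<beta> t0 t q)
      \<le> L * norm (p - q)" for t and p q :: "'a \<times> 'a"
  proof -
    let ?r = "max t t0"
    have "sys_op \<alpha> \<beta> t0 t p - sys_op \<alpha> \<beta> t0 t q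
        = sys_op \<alpha> \<beta> t0 t (p - q)"
      by (simp add: sys_op_def algebra_simps)
    also have "norm \<dots> \<le> (\<bar>1 / \<beta> - \<alpha> / ?r\<bar>
        + \<bar>1 / \<beta> - \<alpha> / ?r + \<alpha> * \<beta> / ?r\<^sup>2\<bar> + 2 * \<bar>1 / \<beta>\<bar>) * norm (p - q)"
      unfolding sys_op_def by (rule pair)
    also have "\<dots> \<le> L * norm (p - q)"
    proof (rule mult_right_mono)
      have "\<bar>1 / \<beta>\<bar> \<le> K" using a b t0 by (simp add: K_def)
      then show "\<bar>1 / \<beta> - \<alpha> / ?r\<bar> + \<bar>1 / \<beta> - \<alpha> / ?r
          + \<alpha> * \<beta> / ?r\<^sup>2\<bar> + 2 * \<bar>1 / \<beta>\<bar> \<le> L"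
        using coef[of ?r, OF max.cobounded2] M unfolding L_def by linarith
    qed simp
    finally show ?thesis .
  qed
  have time: "norm (sys_op \<alpha> \<beta> t0 s p - sys_op \<alpha> \<beta> t0 t p)
      \<le> L * \<bar>s - t\<bar> * norm p" for s t and p :: "'a \<times> 'a"
  proof -
    let ?s = "max s t0" and ?t = "max t t0"
    define c where "c = - \<alpha> * (1 / ?s - 1 / ?t)"
    define c' where "c' = c + \<alpha> * \<beta> * (1 / ?s\<^sup>2 - 1 / ?t\<^sup>2)"
    have st: "\<bar>?s - ?t\<bar> \<le> \<bar>s - t\<bar>" by (simp add: max_def)
    have i: "\<bar>1 / ?s - 1 / ?t\<bar>
        \<le> \<bar>s - t\<bar> / t0\<^sup>2" "\<bar>1 / ?s\<^sup>2 - 1 / ?t\<^sup>2\<bar> \<le> 2 * \<bar>s - t\<bar> / t0 ^ 3"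
      using st t0 by (auto intro!: order_trans[OF inv(1)] order_trans[OF inv(2)] divide_right_mono)
    have c: "\<bar>c\<bar> \<le> \<alpha> * (\<bar>s - t\<bar> / t0\<^sup>2)"
      using mult_left_mono[OF i(1) a] a by (simp add: c_def abs_mult)
    have d: "\<bar>\<alpha> * \<beta> * (1 / ?s\<^sup>2 - 1 / ?t\<^sup>2)\<bar>
        \<le> \<alpha> * \<beta> * (2 * \<bar>s - t\<bar> / t0 ^ 3)"
      using mult_left_mono[OF i(2), of "\<alpha> * \<beta>"] a b by (simp add: abs_mult)
    have M_eq: "\<alpha> * (\<bar>s - t\<bar> / t0\<^sup>2)
        + \<alpha> * \<beta> * (2 * \<bar>s - t\<bar> / t0 ^ 3) = M * \<bar>s - t\<bar>"
      by (simp add: M_def algebra_simps)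
    have "0 \<le> \<alpha> * \<beta> * (2 * \<bar>s - t\<bar> / t0 ^ 3)" using a b t0 by simp
    then have cc: "\<bar>c\<bar> + \<bar>c'\<bar> + 2 * \<bar>0::real\<bar>
        \<le> 2 * M * \<bar>s - t\<bar>"
      using c d M_eq abs_triangle_ineq[of c "\<alpha> * \<beta> * (1 / ?s\<^sup>2 - 1 / ?t\<^sup>2)"] unfolding c'_def by linarith
    have "sys_op \<alpha> \<beta> t0 s p - sys_op \<alpha> \<beta> t0 t p
        = (c *\<^sub>R fst p - 0 *\<^sub>R snd p, c' *\<^sub>R fst p - 0 *\<^sub>R snd p)"
      by (simp add: sys_op_def c_def c'_def algebra_simps)
    also have "norm \<dots> \<le> (\<bar>c\<bar> + \<bar>c'\<bar>
        + 2 * \<bar>0::real\<bar>) * norm p"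
      by (rule pair)
    also have "\<dots> \<le> (2 * M * \<bar>s - t\<bar>) * norm p"
      by (intro mult_right_mono cc) simp
    also have "\<dots> \<le> (L * \<bar>s - t\<bar>) * norm p"
      using K by (intro mult_right_mono) (auto simp: L_def)
    finally show ?thesis .
  qed
  have "0 < L" using K M by (simp add: L_def)
  with lip time show ?thesis by blast
qed

text \<open>Naming the subgradient behind the membership of 0 puts both relations in the form
  derivative = linear part - subgradient used by the abstract flow.\<close>

lemma strong_solution_AE:
  assumes "strong_solution \<phi> \<alpha> \<beta> t0 T u w"
  shows "AE t in lebesgue. t \<in> {t0<..T}
      \<longrightarrow> (\<exists>u' w' p. p \<in> subdifferential \<phi> (u t) \<and>
      (u has_vector_derivative u') (at t within {t0..T}) \<and>
      (w has_vector_derivative w') (at t within {t0..T}) \<and>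
      u' = (1 / \<beta> - \<alpha> / t) *\<^sub>R u t - (1 / \<beta>) *\<^sub>R w t - \<beta> *\<^sub>R p \<and>
      w' = (1 / \<beta> - \<alpha> / t + \<alpha> * \<beta> / t\<^sup>2) *\<^sub>R u t - (1 / \<beta>) *\<^sub>R w t)"
proof -
  have "AE t in lebesgue. t \<in> {t0<..T} \<longrightarrow>
        (\<exists>x' y'.
           (u has_vector_derivative x') (at t within {t0..T}) \<and>
           (w has_vector_derivative y') (at t within {t0..T}) \<and>
           0 \<in> (\<lambda>p. x' + \<beta> *\<^sub>R p - (1 / \<beta> - \<alpha> / t) *\<^sub>R u t + (1 / \<beta>) *\<^sub>R w t)
                 ` subdifferential \<phi> (u t) \<and>
           y' - (1 / \<beta> - \<alpha> / t + \<alpha> * \<beta> / t\<^sup>2) *\<^sub>R u t + (1 / \<beta>) *\<^sub>R w t = 0)"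
    using assms by (simp add: strong_solution_def)
  then show ?thesis
  proof eventually_elim
    case (elim t)
    show ?case
    proof
      assume "t \<in> {t0<..T}"
      then obtain x' y' p where *: "(u has_vector_derivative x') (at t within {t0..T})"
        "(w has_vector_derivative y') (at t within {t0..T})" "p \<in> subdifferential \<phi> (u t)"
        "x' + \<beta> *\<^sub>R p - (1 / \<beta> - \<alpha> / t) *\<^sub>R u t
            + (1 / \<beta>) *\<^sub>R w t = 0"
        "y' - (1 / \<beta> - \<alpha> / t + \<alpha> * \<beta> / t\<^sup>2) *\<^sub>R u t
            + (1 / \<beta>) *\<^sub>R w t = 0"
        using elim by (auto simp: image_iff)
      have "x' = (1 / \<beta> - \<alpha> / t) *\<^sub>R u t - (1 / \<beta>) *\<^sub>R w t - \<beta> *\<^sub>R p"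
        "y' = (1 / \<beta> - \<alpha> / t
            + \<alpha> * \<beta> / t\<^sup>2) *\<^sub>R u t - (1 / \<beta>) *\<^sub>R w t"
        using *(4,5) by (simp_all add: algebra_simps eq_neg_iff_add_eq_0 add_eq_0_iff)
      with *(1-3) show "\<exists>u' w' p. p \<in> subdifferential \<phi> (u t) \<and>
          (u has_vector_derivative u') (at t within {t0..T}) \<and>
          (w has_vector_derivative w') (at t within {t0..T}) \<and>
          u' = (1 / \<beta> - \<alpha> / t) *\<^sub>R u t - (1 / \<beta>) *\<^sub>R w t - \<beta> *\<^sub>R p \<and>
          w' = (1 / \<beta> - \<alpha> / t + \<alpha> * \<beta> / t\<^sup>2) *\<^sub>R u t - (1 / \<beta>) *\<^sub>R w t"
        by blast
    qed
  qed
qed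

text \<open>The comparison with a primitive is made on scalar products because the target need not be of
  class \<open>banach\<close>.\<close>

lemma AE_primitive:
  fixes y :: "real \<Rightarrow> 'a::{real_inner,complete_space}"
  assumes ac: "\<And>T. a < T
      \<Longrightarrow> abs_continuous_on {a..T} y" and c: "continuous_on {a..} y'"
    and N: "negligible N" and d: "\<And>t. a \<le> t \<Longrightarrow> t \<notin> N
        \<Longrightarrow> (y has_vector_derivative y' t) (at t)"
    and t: "a \<le> t"
  shows "(y has_vector_derivative y' t) (at t within {a..})"
proof -
  obtain U where U: "U a = 0" "\<And>t. a \<le> t
      \<Longrightarrow> (U has_vector_derivative y' t) (at t within {a..})"
    using antiderivative_exists[OF c] by blast
  have inner_deriv: "((\<lambda>s. u s \<bullet> p) has_real_derivative u' \<bullet> p) (at s within S)"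
    if "(u has_vector_derivative u') (at s within S)" for u :: "real \<Rightarrow> 'a" and u' s S p
    using bounded_linear.has_vector_derivative[OF bounded_linear_inner_left that, of p]
    by (simp add: has_real_derivative_iff_has_vector_derivative)
  have eq: "y T = y a + U T" if T: "a \<le> T" for T
  proof (cases "a = T")
    case False
    with T have aT: "a < T" by simp
    \<comment> \<open>After pairing with \<open>p\<close>, the theorem for absolutely continuous
      functions and the classical one for \<open>U\<close> compute the same integral.\<close>
    have "(y T - y a) \<bullet> p = U T \<bullet> p" for p
    proof -
      have "abs_continuous_on {a..T} (\<lambda>s. y s \<bullet> p)"
      proof (rule abs_continuous_on_Lipschitz_comb[OF ac[OF aT]])
        show "0 < norm p + 1" by (simp add: add_nonneg_pos)
        fix x s
        have "dist (y x \<bullet> p) (y s \<bullet> p) \<le> norm (y x - y s) * norm p"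
          using Cauchy_Schwarz_ineq2[of "y x - y s" p] by (simp add: dist_real_def inner_diff_left)
        also have "\<dots> \<le> (dist (y x) (y s) + \<bar>x - s\<bar>) * (norm p + 1)"
          by (intro mult_mono) (auto simp: dist_norm)
        finally show "dist (y x \<bullet> p) (y s \<bullet> p) \<le> (norm p
            + 1) * (dist (y x) (y s) + \<bar>x - s\<bar>)"
          by (simp add: mult.commute)
      qed
      then have "((\<lambda>s. if s \<in> N then 0 else y' s \<bullet> p) has_integral (y T \<bullet> p - y a \<bullet> p)) {a..T}"
        by (rule abs_continuous_FTC[OF T _ N])
          (auto intro!: inner_deriv has_vector_derivative_at_within[OF d])
      then have "((\<lambda>s. y' s \<bullet> p) has_integral (y T \<bullet> p - y a \<bullet> p)) {a..T}"
        by (rule has_integral_spike[OF N, rotated]) auto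
      moreover have "((\<lambda>s. y' s \<bullet> p) has_integral (U T \<bullet> p - U a \<bullet> p)) {a..T}"
      proof (rule fundamental_theorem_of_calculus[OF T])
        fix s assume s: "s \<in> {a..T}"
        show "((\<lambda>s. U s \<bullet> p) has_vector_derivative y' s \<bullet> p) (at s within {a..T})"
          unfolding has_real_derivative_iff_has_vector_derivative[symmetric]
          by (rule inner_deriv, rule has_vector_derivative_within_subset[OF U(2)]) (use s in auto)
      qed
      ultimately have "y T \<bullet> p - y a \<bullet> p = U T \<bullet> p - U a \<bullet> p"
        by (rule has_integral_unique)
      then show ?thesis by (simp add: inner_diff_left U(1))
    qed
    then have "(y T - y a - U T) \<bullet> (y T - y a - U T) = 0"
      by (simp only: inner_diff_left[of "y T - y a" "U T"])
    then have "y T - y a - U T = 0" by (simp only: inner_eq_zero_iff)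
    then show ?thesis by (simp add: algebra_simps)
  qed (use U in simp)
  show ?thesis
  proof (rule has_vector_derivative_transform)
    show "((\<lambda>t. y a + U t) has_vector_derivative y' t) (at t within {a..})"
      using U(2)[OF t] by (auto intro!: derivative_eq_intros)
    show "y s = y a + U s" if "s \<in> {a..}" for s using that by (intro eq) simp
  qed (use t in simp)
qed

theorem theorem4p4:
  fixes \<phi> :: "'a::{real_inner, complete_space} \<Rightarrow> ereal"
    and \<alpha> \<beta> t0 :: real
    and x0 y0 :: 'a
  assumes "convex_fun \<phi>" and "lower_semicontinuous \<phi>" and "proper_fun \<phi>"
    and "\<alpha> \<ge> 0" and "\<beta> > 0" and "t0 > 0"
    and "x0 \<in> dom_fun \<phi>"
  shows "\<exists>x y :: real \<Rightarrow> 'a.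
    global_strong_solution \<phi> \<alpha> \<beta> t0 x y \<and> x t0 = x0 \<and> y t0 = y0 \<and>
    (\<forall>u v. global_strong_solution \<phi> \<alpha> \<beta> t0 u v \<and> u t0 = x0 \<and> v t0 = y0
        \<longrightarrow> (\<forall>t\<ge>t0. u t = x t \<and> v t = y t)) \<and>
    \<comment> \<open>(i)\<close>
    (\<exists>y'. continuous_on {t0..} y' \<and>
      (\<forall>t\<ge>t0. (y has_vector_derivative y' t) (at t within {t0..}) \<and>
        y' t - (1 / \<beta> - \<alpha> / t + \<alpha> * \<beta> / t\<^sup>2) *\<^sub>R x t + (1 / \<beta>) *\<^sub>R y t = 0)) \<and>
    \<comment> \<open>(ii)\<close>
    (\<forall>T>t0. abs_continuous_on {t0..T} x) \<and>
    (\<exists>x'. (AE t in lebesgue. t > t0 \<longrightarrow> (x has_vector_derivative x' t) (at t within {t0..})) \<and>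
      (\<forall>T>t0. square_integrable_on x' {t0<..<T})) \<and>
    \<comment> \<open>(iii)\<close>
    (\<forall>t>t0. x t \<in> dom_subdifferential \<phi>) \<and>
    \<comment> \<open>(iv)\<close>
    (\<forall>a b. t0 < a \<and> a \<le> b \<longrightarrow> (\<exists>L. L-lipschitz_on {a..b} x)) \<and>
    \<comment> \<open>(v)\<close>
    (\<forall>t\<ge>t0. \<bar>\<phi> (x t)\<bar> \<noteq> \<infinity>) \<and>
    (\<forall>T>t0. abs_continuous_on {t0..T} (\<lambda>t. real_of_ereal (\<phi> (x t)))) \<and>
    \<comment> \<open>(vi)\<close>
    (\<exists>\<xi> :: real \<Rightarrow> 'a.
      (\<forall>t>t0. \<xi> t \<in> subdifferential \<phi> (x t)) \<and>
      (AE t in lebesgue. t > t0 \<longrightarrow>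
        (\<exists>x'. (x has_vector_derivative x') (at t within {t0..}) \<and>
          x' + \<beta> *\<^sub>R \<xi> t - (1 / \<beta> - \<alpha> / t) *\<^sub>R x t + (1 / \<beta>) *\<^sub>R y t = 0)) \<and>
      (\<forall>T>t0. square_integrable_on \<xi> {t0<..<T}) \<and>
      (AE t in lebesgue. t > t0 \<longrightarrow>
        (\<exists>x'. (x has_vector_derivative x') (at t within {t0..}) \<and>
          ((\<lambda>s. real_of_ereal (\<phi> (x s))) has_real_derivative (\<xi> t \<bullet> x')) (at t within {t0..}))))"
proof -
  note conv = assms(1) and lsc = assms(2) and pr = assms(3)
    and a0 = assms(4) and b0 = assms(5) and t00 = assms(6) and x0 = assms(7)
  obtain L where L: "0 < L"
    "\<And>t (p :: 'a \<times> 'a) q. norm (sys_op \<alpha> \<beta> t0 t p - sys_op \<alpha> \<beta> t0 t q) \<le> L * norm (p - q)"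
    "\<And>s t (p :: 'a \<times> 'a). norm (sys_op \<alpha> \<beta> t0 s p - sys_op \<alpha> \<beta> t0 t p) \<le> L * \<bar>s - t\<bar> * norm p"
    using sys_op_lipschitz[OF a0 b0 t00, where 'a = 'a] by blast
  interpret F: gradient_flow "prod_dom \<phi>" "prod_fun \<beta> \<phi>" "sys_op \<alpha> \<beta> t0" L t0 "(x0, y0)"
  proof (intro gradient_flow.intro gradient_flow_axioms.intro lsc_convex_prod[OF conv lsc pr b0] L)
    show "sys_op \<alpha> \<beta> t0 t 0 = 0" for t by (simp add: sys_op_def zero_prod_def)
    show "(x0, y0) \<in> prod_dom \<phi>" using x0 by (simp add: prod_dom_def)
  qed
  note sub_iff = sub_prod_iff[OF conv lsc pr b0]
  define ca where "ca t = 1 / \<beta> - \<alpha> / t" for t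
  define cb where "cb t = 1 / \<beta> - \<alpha> / t + \<alpha> * \<beta> / t\<^sup>2" for t
  define x where "x t = fst (F.flow t)" for t
  define y where "y t = snd (F.flow t)" for t
  \<comment> \<open>The lifted function is beta times phi, so the factor is divided out
    again.\<close>
  define \<xi> where "\<xi> t = (1 / \<beta>) *\<^sub>R fst (F.xi t)" for t
  define y' where "y' t = cb t *\<^sub>R x t - (1 / \<beta>) *\<^sub>R y t" for t
  have z_eq: "F.flow = (\<lambda>t. (x t, y t))" by (simp add: x_def y_def)
  have xi: "\<xi> t \<in> subdifferential \<phi> (x t)" "snd (F.xi t) = 0" if "t0 < t" for t
    using F.xi_sub(1)[OF that] unfolding sub_iff by (simp_all add: \<xi>_def x_def)
  \<comment> \<open>\<open>F.xi t\<close> has no second component, so the formula for the second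
    velocity holds at every \<open>t > t0\<close> and not only almost everywhere.\<close>
  have v: "fst (F.velocity t)
      = ca t *\<^sub>R x t - (1 / \<beta>) *\<^sub>R y t - \<beta> *\<^sub>R \<xi> t" "snd (F.velocity t) = y' t"
    if t: "t0 < t" for t
  proof -
    have "F.velocity t = sys_op \<alpha> \<beta> t0 t (F.flow t) - F.xi t"
      by (simp add: F.xi_def F.drift_def)
    moreover have "max t t0 = t" using t by simp
    ultimately show "fst (F.velocity t)
        = ca t *\<^sub>R x t - (1 / \<beta>) *\<^sub>R y t - \<beta> *\<^sub>R \<xi> t" "snd (F.velocity t) = y' t"
      using xi(2)[OF t] b0 by (simp_all add: sys_op_def \<xi>_def x_def y_def y'_def ca_def cb_def)
  qed
  obtain N where N: "negligible N" "t0 \<in> N" "\<And>t. t0 < t \<Longrightarrow> t \<notin> N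
      \<Longrightarrow> isCont (\<lambda>t. norm (F.velocity t)) t"
    by (rule F.exceptional_set) blast
  have AE_N: "AE t in lebesgue. t \<notin> N"
    using N(1) by (simp add: negligible_iff_null_sets AE_not_in)
  have zd: "(F.flow has_vector_derivative F.velocity t) (at t)" if "t0 < t" "t \<notin> N" for t
    using F.flow_deriv(1) N(3) that by blast
  have xd: "(x has_vector_derivative fst (F.velocity t)) (at t)" if "t0 < t" "t \<notin> N" for t
    unfolding x_def by (rule bounded_linear.has_vector_derivative[OF bounded_linear_fst zd[OF that]])
  have yd: "(y has_vector_derivative y' t) (at t)" if "t0 < t" "t \<notin> N" for t
    unfolding v(2)[OF that(1), symmetric] y_def
    by (rule bounded_linear.has_vector_derivative[OF bounded_linear_snd zd[OF that]])
  have ac: "abs_continuous_on {t0..T} (\<lambda>t. (x t, y t))" if "t0 < T" for T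
    using F.flow_abs_continuous[OF that] by (simp add: z_eq)
  have acx: "abs_continuous_on {t0..T} x" if "t0 < T" for T
  proof (rule abs_continuous_on_Lipschitz_comb[OF ac[OF that] zero_less_one])
    show "dist (x r) (x s) \<le> 1 * (dist (x r, y r) (x s, y s) + \<bar>r - s\<bar>)" for r s
      using dist_fst_le[of "(x r, y r)" "(x s, y s)"] by simp
  qed
  have acy: "abs_continuous_on {t0..T} y" if "t0 < T" for T
  proof (rule abs_continuous_on_Lipschitz_comb[OF ac[OF that] zero_less_one])
    show "dist (y r) (y s) \<le> 1 * (dist (x r, y r) (x s, y s) + \<bar>r - s\<bar>)" for r s
      using dist_snd_le[of "(x r, y r)" "(x s, y s)"] by simp
  qed
  have zc: "continuous_on {t0..} F.flow" by (rule F.flow_cont)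
  then have xc: "continuous_on {t0..} x" and yc: "continuous_on {t0..} y"
    unfolding x_def y_def by (auto intro: continuous_on_fst continuous_on_snd)
  have y'c: "continuous_on {t0..} y'"
    unfolding y'_def cb_def by (intro continuous_intros xc yc) (use t00 in auto)
  \<comment> \<open>The flow gives this derivative off \<open>N\<close> only; as \<open>y'\<close>
    is continuous and \<open>y\<close> absolutely continuous, it extends to every time,
    \<open>t0\<close> included.\<close>
  have y_deriv: "(y has_vector_derivative y' t) (at t within {t0..})" if "t0 \<le> t" for t
  proof (rule AE_primitive[OF acy y'c N(1) _ that])
    fix s assume "t0 \<le> s" "s \<notin> N"
    then show "(y has_vector_derivative y' s) (at s)" using yd[of s] N(2) by (cases "s = t0") auto
  qed
  have strong: "strong_solution \<phi> \<alpha> \<beta> t0 T x y" if T: "t0 < T" for T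
    unfolding strong_solution_def
  proof (intro conjI allI impI)
    show "continuous_on {t0..T} (\<lambda>t. (x t, y t))"
      using continuous_on_subset[OF zc, of "{t0..T}"] by (simp add: z_eq)
    show "abs_continuous_on K (\<lambda>t. (x t, y t))" if "compact K
        \<and> K \<subseteq> {t0<..T}" for K
      by (rule abs_continuous_on_subset[OF ac[OF T]]) (use that in auto)
    show "AE t in lebesgue. t \<in> {t0<..T} \<longrightarrow> x t \<in> dom_subdifferential \<phi>"
      using xi(1) by (auto simp: dom_subdifferential_def intro!: always_eventually)
    show "AE t in lebesgue. t \<in> {t0<..T} \<longrightarrow>
        (\<exists>x' y'.
           (x has_vector_derivative x') (at t within {t0..T}) \<and>
           (y has_vector_derivative y') (at t within {t0..T}) \<and>
           0 \<in> (\<lambda>p. x' + \<beta> *\<^sub>R p - (1 / \<beta> - \<alpha> / t) *\<^sub>R x t + (1 / \<beta>) *\<^sub>R y t)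
                 ` subdifferential \<phi> (x t) \<and>
           y' - (1 / \<beta> - \<alpha> / t + \<alpha> * \<beta> / t\<^sup>2) *\<^sub>R x t + (1 / \<beta>) *\<^sub>R y t = 0)"
      using AE_N
    proof eventually_elim
      case (elim t)
      show ?case
      proof (intro impI exI conjI)
        assume "t \<in> {t0<..T}"
        then have t: "t0 < t" by simp
        show "(x has_vector_derivative fst (F.velocity t)) (at t within {t0..T})"
          by (rule has_vector_derivative_at_within[OF xd[OF t elim]])
        show "(y has_vector_derivative y' t) (at t within {t0..T})"
          by (rule has_vector_derivative_at_within[OF yd[OF t elim]])
        show "0 \<in> (\<lambda>p. fst (F.velocity t)
            + \<beta> *\<^sub>R p - (1 / \<beta> - \<alpha> / t) *\<^sub>R x t + (1 / \<beta>) *\<^sub>R y t)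
                 ` subdifferential \<phi> (x t)"
          by (rule image_eqI[OF _ xi(1)[OF t]]) (simp add: v(1)[OF t] ca_def)
        show "y' t - (1 / \<beta> - \<alpha> / t + \<alpha> * \<beta> / t\<^sup>2) *\<^sub>R x t
            + (1 / \<beta>) *\<^sub>R y t = 0"
          by (simp add: y'_def cb_def)
      qed
    qed
  qed
  have unique: "u t = x t \<and> w t = y t"
    if sol: "global_strong_solution \<phi> \<alpha> \<beta> t0 u w" and init: "u t0 = x0" "w t0
        = y0" and t: "t0 \<le> t" for u w t
  proof -
    \<comment> \<open>A horizon beyond \<open>t\<close> keeps \<open>t0 < ?T\<close> also when
      \<open>t = t0\<close>.\<close>
    let ?T = "t + 1"
    have T: "t0 < ?T" using t by simp
    then have s: "strong_solution \<phi> \<alpha> \<beta> t0 ?T u w"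
      using sol by (simp add: global_strong_solution_def)
    have "(u t, w t) = F.flow t"
    proof (rule F.uniqueness[OF T, where w = "\<lambda>t. (u t, w t)"])
      show "continuous_on {t0..?T} (\<lambda>t. (u t, w t))"
        using s by (simp add: strong_solution_def)
      show "abs_continuous_on {r..?T} (\<lambda>t. (u t, w t))" if "t0 < r" for r
      proof -
        have "compact {r..?T}" "{r..?T} \<subseteq> {t0<..?T}" using that by auto
        then show ?thesis using s unfolding strong_solution_def by blast
      qed
      show "(u t0, w t0) = (x0, y0)" using init by simp
      show "AE t in lebesgue. t \<in> {t0<..?T} \<longrightarrow> (\<exists>p\<in>F.sub (u t, w t).
          ((\<lambda>t. (u t, w t)) has_vector_derivative sys_op \<alpha> \<beta> t0 t (u t, w t) - p) (at t within {t0..?T}))"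
        using strong_solution_AE[OF s]
      proof eventually_elim
        case (elim r)
        show ?case
        proof
          assume r: "r \<in> {t0<..?T}"
          then obtain u' w' p where *: "p \<in> subdifferential \<phi> (u r)"
            "(u has_vector_derivative u') (at r within {t0..?T})"
            "(w has_vector_derivative w') (at r within {t0..?T})"
            "u' = (1 / \<beta> - \<alpha> / r) *\<^sub>R u r - (1 / \<beta>) *\<^sub>R w r - \<beta> *\<^sub>R p"
            "w' = (1 / \<beta> - \<alpha> / r
                + \<alpha> * \<beta> / r\<^sup>2) *\<^sub>R u r - (1 / \<beta>) *\<^sub>R w r"
            using elim by blast
          have "(\<beta> *\<^sub>R p, 0) \<in> F.sub (u r, w r)"
            unfolding sub_iff using *(1) b0 by simp
          moreover have "sys_op \<alpha> \<beta> t0 r (u r, w r) - (\<beta> *\<^sub>R p, 0)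
              = (u', w')"
            using r *(4,5) by (simp add: sys_op_def max_absorb1)
          ultimately show "\<exists>p\<in>F.sub (u r, w r).
            ((\<lambda>t. (u t, w t)) has_vector_derivative sys_op \<alpha> \<beta> t0 r (u r, w r) - p) (at r within {t0..?T})"
            using has_vector_derivative_Pair[OF *(2,3)] by (intro bexI[of _ "(\<beta> *\<^sub>R p, 0)"]) simp_all
        qed
      qed
    qed (use t in auto)
    then show ?thesis by (simp add: z_eq)
  qed
  have xdom: "x t \<in> dom_fun \<phi>" if "t0 \<le> t" for t
    using F.flow_D[OF that] by (simp add: prod_dom_def x_def)
  have phi_eq: "real_of_ereal (\<phi> (x t))
      = (1 / \<beta>) * prod_fun \<beta> \<phi> (F.flow t)" for t
    using b0 by (simp add: prod_fun_def x_def)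
  have phi_ac: "abs_continuous_on {t0..T} (\<lambda>t. real_of_ereal (\<phi> (x t)))" if T: "t0 < T" for T
  proof (rule abs_continuous_on_Lipschitz_comb[OF F.g_abs_continuous[OF T]])
    show "0 < 1 / \<beta>" using b0 by simp
    show "dist (real_of_ereal (\<phi> (x r))) (real_of_ereal (\<phi> (x s)))
        \<le> 1 / \<beta> * (dist (prod_fun \<beta> \<phi> (F.flow r)) (prod_fun \<beta> \<phi> (F.flow s)) + \<bar>r - s\<bar>)" for r s
    proof -
      have "dist (real_of_ereal (\<phi> (x r))) (real_of_ereal (\<phi> (x s)))
          = (1 / \<beta>) * dist (prod_fun \<beta> \<phi> (F.flow r)) (prod_fun \<beta> \<phi> (F.flow s))"
        using b0 unfolding phi_eq dist_real_def right_diff_distrib[symmetric] by (simp add: abs_mult)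
      also have "\<dots> \<le> 1 / \<beta> * (dist (prod_fun \<beta> \<phi> (F.flow r)) (prod_fun \<beta> \<phi> (F.flow s)) + \<bar>r - s\<bar>)"
        using b0 by (intro mult_left_mono) auto
      finally show ?thesis .
    qed
  qed
  have phi_deriv: "((\<lambda>s. real_of_ereal (\<phi> (x s))) has_real_derivative (\<xi> t \<bullet> fst (F.velocity t))) (at t)"
    if t: "t0 < t" "t \<notin> N" for t
  proof -
    have "((\<lambda>s. (1 / \<beta>) * prod_fun \<beta> \<phi> (F.flow s)) has_real_derivative (1 / \<beta>) * (F.xi t \<bullet> F.velocity t)) (at t)"
      by (intro DERIV_cmult F.g_deriv N(3) t)
    \<comment> \<open>The second components drop out of the product inner product because that of
      \<open>F.xi t\<close> is 0.\<close>
    moreover have "(1 / \<beta>) * (F.xi t \<bullet> F.velocity t)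
        = \<xi> t \<bullet> fst (F.velocity t)"
      using xi(2)[OF t(1)] by (simp add: \<xi>_def inner_prod_def)
    ultimately show ?thesis by (simp add: phi_eq)
  qed
  have x'_L2: "square_integrable_on (\<lambda>t. fst (F.velocity t)) {t0<..<T}" if "t0 < T" for T
    by (rule square_integrable_on_compose[OF F.square_integrable_velocity_xi(1)[OF that] bounded_linear_fst])
  have xi_L2: "square_integrable_on \<xi> {t0<..<T}" if "t0 < T" for T
    unfolding \<xi>_def
    by (rule square_integrable_on_compose[OF F.square_integrable_velocity_xi(2)[OF that]])
      (intro bounded_linear_scaleR_right[THEN bounded_linear_compose] bounded_linear_fst)
  show ?thesis
  proof (rule exI[of _ x], rule exI[of _ y], intro conjI)
    show "global_strong_solution \<phi> \<alpha> \<beta> t0 x y"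
      using strong by (simp add: global_strong_solution_def)
    show "x t0 = x0" "y t0 = y0" by (simp_all add: x_def y_def F.flow_init)
    show "\<forall>u v. global_strong_solution \<phi> \<alpha> \<beta> t0 u v \<and> u t0 = x0
        \<and> v t0 = y0
        \<longrightarrow> (\<forall>t\<ge>t0. u t = x t \<and> v t = y t)" using unique by blast
    show "\<exists>y'. continuous_on {t0..} y' \<and>
      (\<forall>t\<ge>t0. (y has_vector_derivative y' t) (at t within {t0..}) \<and>
        y' t - (1 / \<beta> - \<alpha> / t + \<alpha> * \<beta> / t\<^sup>2) *\<^sub>R x t + (1 / \<beta>) *\<^sub>R y t = 0)"
      using y'c y_deriv by (intro exI[of _ y']) (simp add: y'_def cb_def)
    show "\<forall>T>t0. abs_continuous_on {t0..T} x" using acx by blast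
    show "\<exists>x'. (AE t in lebesgue. t > t0
        \<longrightarrow> (x has_vector_derivative x' t) (at t within {t0..})) \<and>
      (\<forall>T>t0. square_integrable_on x' {t0<..<T})"
    proof (intro exI[of _ "\<lambda>t. fst (F.velocity t)"] conjI allI impI)
      show "AE t in lebesgue. t > t0
          \<longrightarrow> (x has_vector_derivative fst (F.velocity t)) (at t within {t0..})"
        using AE_N by eventually_elim (auto intro: has_vector_derivative_at_within[OF xd])
    qed (rule x'_L2)
    show "\<forall>t>t0. x t \<in> dom_subdifferential \<phi>"
      using xi(1) by (auto simp: dom_subdifferential_def)
    show "\<forall>a b. t0 < a \<and> a \<le> b
        \<longrightarrow> (\<exists>L. L-lipschitz_on {a..b} x)"
    proof (intro allI impI)
      fix a b assume "t0 < a \<and> a \<le> b"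
      then obtain M where M: "M-lipschitz_on {a..b} F.flow" using F.local_bound by blast
      have "M-lipschitz_on {a..b} x"
      proof (rule lipschitz_onI)
        show "0 \<le> M" by (rule lipschitz_on_nonneg[OF M])
        show "dist (x r) (x s) \<le> M * dist r s" if "r \<in> {a..b}" "s \<in> {a..b}" for r s
          unfolding x_def by (rule order_trans[OF dist_fst_le lipschitz_onD[OF M that]])
      qed
      then show "\<exists>L. L-lipschitz_on {a..b} x" by blast
    qed
    show "\<forall>t\<ge>t0. \<bar>\<phi> (x t)\<bar> \<noteq> \<infinity>"
    proof (intro allI impI)
      fix t assume "t0 \<le> t"
      then show "\<bar>\<phi> (x t)\<bar> \<noteq> \<infinity>"
        by (subst dom_fun_real[OF pr xdom]) simp_all
    qed
    show "\<forall>T>t0. abs_continuous_on {t0..T} (\<lambda>t. real_of_ereal (\<phi> (x t)))"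
      using phi_ac by blast
    show "\<exists>\<xi> :: real \<Rightarrow> 'a.
      (\<forall>t>t0. \<xi> t \<in> subdifferential \<phi> (x t)) \<and>
      (AE t in lebesgue. t > t0 \<longrightarrow>
        (\<exists>x'. (x has_vector_derivative x') (at t within {t0..}) \<and>
          x' + \<beta> *\<^sub>R \<xi> t - (1 / \<beta> - \<alpha> / t) *\<^sub>R x t + (1 / \<beta>) *\<^sub>R y t = 0)) \<and>
      (\<forall>T>t0. square_integrable_on \<xi> {t0<..<T}) \<and>
      (AE t in lebesgue. t > t0 \<longrightarrow>
        (\<exists>x'. (x has_vector_derivative x') (at t within {t0..}) \<and>
          ((\<lambda>s. real_of_ereal (\<phi> (x s))) has_real_derivative (\<xi> t \<bullet> x')) (at t within {t0..})))"
    proof (intro exI[of _ \<xi>] conjI)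
      show "\<forall>t>t0. \<xi> t \<in> subdifferential \<phi> (x t)" using xi(1) by blast
      show "AE t in lebesgue. t > t0 \<longrightarrow>
        (\<exists>x'. (x has_vector_derivative x') (at t within {t0..}) \<and>
          x' + \<beta> *\<^sub>R \<xi> t - (1 / \<beta> - \<alpha> / t) *\<^sub>R x t + (1 / \<beta>) *\<^sub>R y t = 0)"
        using AE_N
      proof eventually_elim
        case (elim t)
        show ?case
          using has_vector_derivative_at_within[OF xd[OF _ elim]]
          by (auto intro!: exI[of _ "fst (F.velocity t)"] simp: v(1) ca_def)
      qed
      show "\<forall>T>t0. square_integrable_on \<xi> {t0<..<T}" using xi_L2 by blast
      show "AE t in lebesgue. t > t0 \<longrightarrow>
        (\<exists>x'. (x has_vector_derivative x') (at t within {t0..}) \<and>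
          ((\<lambda>s. real_of_ereal (\<phi> (x s))) has_real_derivative (\<xi> t \<bullet> x')) (at t within {t0..}))"
        using AE_N
      proof eventually_elim
        case (elim t)
        show ?case
          using has_vector_derivative_at_within[OF xd[OF _ elim]]
            has_field_derivative_at_within[OF phi_deriv[OF _ elim]] by blast
      qed
    qed
  qed
qed

end
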